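(* Let $K(\mathcal{X})$ be the function field of the Kummer extension $\mathcal{X}: Y^m=f(X)^\lambda$ and let $P_1$ and $P_2$ be distinct totally ramified places of the extension $K(\mathcal{X})/K(x)$, both distinct from $P_\infty$. For $0\leq k\leq r-3-\lfloor r/m\rfloor$ set $$G_{k,0}^1=\{(mk+j_2,j_1):1\leq j_i\leq m-1-\lfloor m(k+2)/r\rfloor\text{ for }i=1,2\},$$ $$G_{k,0}^3=\left\{(mk+j,j_1):\begin{array}{l}m-\lfloor m(k+2)/r\rfloor\leq j\leq m-1-\lfloor m(k+1)/r\rfloor\\ \text{and }1\leq j_1\leq m-1-\lfloor m(k+2)/r\rfloor\end{array}\right\},$$ $$G_{k,0}^4=\{(b,a)\in\mathbb{N}^2:(a,b)\in G_{k,0}^3\}-\mathbf{w}_k,$$ where all indices are integers. Then $$G_0(P_1,P_2)=\bigcup_{0\leq j\leq k\leq r-3-\lfloor r/m\rfloor}\left((G_{k,0}^1\cup G_{k,0}^3\cup G_{k,0}^4)+\mathbf{w}_j\right)$$ and $$|G_0(P_1,P_2)|=\sum_{k=1}^{r-2-\lfloor r/m\rfloor}k\left[\left(m-\left\lceil\frac{mk}{r}\right\rceil\right)^2-\left(\left\lceil\frac{m(k+1)}{r}\right\rceil-\left\lceil\frac{mk}{r}\right\rceil\right)^2\right].$$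
   Context: $K$ is the algebraic closure of $\mathbb{F}_q$, with characteristic $p$; $\lambda\in\mathbb{N}$, $m\geq 2$ is an integer with $p\nmid m$, and $f(X)\in K[X]$ is a separable polynomial of degree $r\geq 2$ with $\gcd(m,\lambda r)=1$. $K(\mathcal{X})=K(x,y)$ with $y^m=f(x)^\lambda$, and $P_\infty$ is its single place at infinity (the totally ramified places other than $P_\infty$ are those lying over the roots of $f$). $\mathbb{N}$ is the set of positive integers, $\mathbb{N}_0=\mathbb{N}\cup\{0\}$. $\ell(D)$ is the $K$-dimension of the Riemann-Roch space of a divisor $D$. A pair $(s_1,s_2)\in\mathbb{N}_0^2$ is a pure gap at $P_1,P_2$ if $\ell(s_1P_1+s_2P_2)=\ell(s_1P_1+s_2P_2-P_j)$ for all $j\in\{1,2\}$; $G_0(P_1,P_2)$ is the set of pure gaps. $\mathbf{w}_j=(-jm,jm)\in\mathbb{Z}^2$ and $S\pm\mathbf{w}_j$ denotes the translate of a set $S$. A union or sum over an empty index range is empty, respectively zero. *)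

theory Defs
  imports
    "HOL-Algebra.Algebraic_Closure_Type"
    "HOL-Library.Poly_Mapping"
    "HOL-Library.Product_Plus"
begin

text \<open>
  A function field \<open>F/K\<close> is given by an ambient field (a type), a subfield \<open>F\<close> of it (a set),
  and an embedding \<open>\<iota>\<close> of the type \<open>'k\<close> of constants, with \<open>K = range \<iota>\<close>. All notions below are
  relative to \<open>F\<close>, so that they apply to both \<open>K(x)\<close> and \<open>K(x,y)\<close>.
\<close>

definition field_embedding :: "('k::field \<Rightarrow> 'a::field) \<Rightarrow> bool" where
  "field_embedding \<iota> \<longleftrightarrow>
     \<iota> 1 = 1 \<and> (\<forall>a b. \<iota> (a + b) = \<iota> a + \<iota> b) \<and> (\<forall>a b. \<iota> (a * b) = \<iota> a * \<iota> b)"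

definition is_subring :: "'a::field set \<Rightarrow> bool" where
  "is_subring R \<longleftrightarrow> 1 \<in> R \<and> (\<forall>a\<in>R. \<forall>b\<in>R. a - b \<in> R \<and> a * b \<in> R)"

definition is_subfield :: "'a::field set \<Rightarrow> bool" where
  "is_subfield F \<longleftrightarrow> is_subring F \<and> (\<forall>a\<in>F. inverse a \<in> F)"

definition adjoin :: "('k::field \<Rightarrow> 'a::field) \<Rightarrow> 'a set \<Rightarrow> 'a set" where
  "adjoin \<iota> S = is_subfield hull (range \<iota> \<union> S)"

definition transcendental_over :: "('k::field \<Rightarrow> 'a::field) \<Rightarrow> 'a \<Rightarrow> bool" where
  "transcendental_over \<iota> x \<longleftrightarrow> (\<forall>g. poly (map_poly \<iota> g) x = 0 \<longrightarrow> g = 0)"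

text \<open>The degree \<open>[F : E]\<close>, as the size of an \<open>E\<close>-basis of \<open>F\<close> (meaningful for finite extensions).\<close>

definition extension_degree :: "'a::field set \<Rightarrow> 'a set \<Rightarrow> nat" where
  "extension_degree E F = (THE n. \<exists>B. B \<subseteq> F \<and> finite B \<and> card B = n \<and>
     (\<forall>z\<in>F. \<exists>!c. c \<in> (\<Pi>\<^sub>E b\<in>B. E) \<and> z = (\<Sum>b\<in>B. c b * b)))"

definition valuation_rings :: "'a::field set \<Rightarrow> 'a set \<Rightarrow> 'a set set" where
  "valuation_rings K F =
     {R. is_subring R \<and> K \<subset> R \<and> R \<subset> F \<and> (\<forall>z\<in>F. z \<in> R \<or> inverse z \<in> R)}"

text \<open>
  A place is the maximal ideal, i.e. the set of non-units, of a valuation ring. Here and below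
  zero is listed separately because \<open>inverse 0 = 0\<close>.
\<close>

definition places :: "'a::field set \<Rightarrow> 'a set \<Rightarrow> 'a set set" where
  "places K F = (\<lambda>R. {z \<in> R. z = 0 \<or> inverse z \<notin> R}) ` valuation_rings K F"

definition ring_at :: "'a::field set \<Rightarrow> 'a set \<Rightarrow> 'a set" where
  "ring_at F P = {z \<in> F. z = 0 \<or> inverse z \<notin> P}"

definition uniformizer :: "'a::field set \<Rightarrow> 'a set \<Rightarrow> 'a \<Rightarrow> bool" where
  "uniformizer F P t \<longleftrightarrow> t \<in> P \<and> P = (\<lambda>z. t * z) ` ring_at F P"

text \<open>The discrete valuation at a place \<open>P\<close> of \<open>F\<close>; only meaningful for nonzero \<open>z \<in> F\<close>.\<close>

definition val :: "'a::field set \<Rightarrow> 'a set \<Rightarrow> 'a \<Rightarrow> int" where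
  "val F P z = (THE n. \<exists>t u. uniformizer F P t \<and> u \<in> ring_at F P - P \<and> z = t powi n * u)"

text \<open>The ramification index of \<open>P\<close> over the place \<open>P \<inter> E\<close> of the subfield \<open>E\<close> below it.\<close>

definition ramification_index :: "'a::field set \<Rightarrow> 'a set \<Rightarrow> 'a set \<Rightarrow> nat" where
  "ramification_index E F P =
     (THE e. \<forall>z \<in> E - {0}. val F P z = int e * val E (P \<inter> E) z)"

definition totally_ramified :: "'a::field set \<Rightarrow> 'a set \<Rightarrow> 'a set \<Rightarrow> bool" where
  "totally_ramified E F P \<longleftrightarrow> ramification_index E F P = extension_degree E F"

text \<open>Divisors are finite formal sums of places; the type itself also admits other sets as points.\<close>

type_synonym 'a divisor = "'a set \<Rightarrow>\<^sub>0 int"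

definition riemann_roch_space ::
  "('k::field \<Rightarrow> 'a::field) \<Rightarrow> 'a set \<Rightarrow> 'a divisor \<Rightarrow> 'a set" where
  "riemann_roch_space \<iota> F D =
     {z \<in> F. z = 0 \<or> (\<forall>P \<in> places (range \<iota>) F. val F P z \<ge> - Poly_Mapping.lookup D P)}"

definition ell :: "('k::field \<Rightarrow> 'a::field) \<Rightarrow> 'a set \<Rightarrow> 'a divisor \<Rightarrow> nat" where
  "ell \<iota> F D = vector_space.dim (\<lambda>c z. \<iota> c * z) (riemann_roch_space \<iota> F D)"

text \<open>The set \<open>G\<^sub>0(P\<^sub>1, P\<^sub>2)\<close>, a subset of the pairs of nonnegative integers.\<close>

definition pure_gaps ::
  "('k::field \<Rightarrow> 'a::field) \<Rightarrow> 'a set \<Rightarrow> 'a set \<Rightarrow> 'a set \<Rightarrow> (int \<times> int) set" where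
  "pure_gaps \<iota> F P1 P2 =
     {(s1, s2). s1 \<ge> 0 \<and> s2 \<ge> 0 \<and>
        (let D = Poly_Mapping.single P1 s1 + Poly_Mapping.single P2 s2
         in \<forall>P \<in> {P1, P2}. ell \<iota> F D = ell \<iota> F (D - Poly_Mapping.single P 1))}"

definition wvec :: "nat \<Rightarrow> int \<Rightarrow> int \<times> int" where
  "wvec m j = (- j * int m, j * int m)"

definition G1 :: "nat \<Rightarrow> nat \<Rightarrow> int \<Rightarrow> (int \<times> int) set" where
  "G1 m r k = {(int m * k + j2, j1) | j1 j2.
     1 \<le> j1 \<and> j1 \<le> int m - 1 - \<lfloor>real m * (k + 2) / real r\<rfloor> \<and>
     1 \<le> j2 \<and> j2 \<le> int m - 1 - \<lfloor>real m * (k + 2) / real r\<rfloor>}"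

definition G3 :: "nat \<Rightarrow> nat \<Rightarrow> int \<Rightarrow> (int \<times> int) set" where
  "G3 m r k = {(int m * k + j, j1) | j j1.
     int m - \<lfloor>real m * (k + 2) / real r\<rfloor> \<le> j \<and> j \<le> int m - 1 - \<lfloor>real m * (k + 1) / real r\<rfloor> \<and>
     1 \<le> j1 \<and> j1 \<le> int m - 1 - \<lfloor>real m * (k + 2) / real r\<rfloor>}"

definition G4 :: "nat \<Rightarrow> nat \<Rightarrow> int \<Rightarrow> (int \<times> int) set" where
  "G4 m r k = (\<lambda>s. s - wvec m k) ` {(b, a). b \<ge> 1 \<and> a \<ge> 1 \<and> (a, b) \<in> G3 m r k}"

end

theory Submission
  imports Defs
begin

text \<open>
  Replacing \<open>y\<close> by a suitable monomial in \<open>y\<close> and \<open>f\<close> one may assume \<open>\<lambda> = 1\<close>, with a generator \<open>w\<close>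
  such that \<open>w\<^sup>m = f(x)\<close>. Every function is \<open>\<Sum>i<m. h\<^sub>i(x) w\<^sup>i\<close> with rational \<open>h\<^sub>i\<close>. At the places
  over the roots of \<open>f\<close> and at infinity the orders of the terms are distinct modulo \<open>m\<close>, so that the
  order of the sum is their minimum; since moreover the affine curve \<open>w\<^sup>m = f(x)\<close> is smooth, a function
  is in \<open>L(s\<^sub>1P\<^sub>1 + s\<^sub>2P\<^sub>2)\<close> iff all its terms are. Hence \<open>(s\<^sub>1, s\<^sub>2)\<close> is a pure gap iff, for
  \<open>i \<equiv> -s\<^sub>1\<close> and for \<open>i \<equiv> -s\<^sub>2\<close> modulo \<open>m\<close>, no \<open>h w\<^sup>i\<close> with a pole of the exact order fits under the degree bound at infinity, which is the
  inequality \<open>\<lfloor>(s\<^sub>1 + i) / m\<rfloor> + \<lfloor>(s\<^sub>2 + i) / m\<rfloor> < i r / m\<close>. That there are enough places over each point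
  \<open>x = \<beta>\<close> follows from Chevalley's extension theorem.
\<close>

text \<open>\<open>val\<close>, \<open>ell\<close> and \<open>ramification_index\<close> are
  definite descriptions, so nothing can be said at a place before a uniformizer is known. All places
  of F are therefore classified. Over a point (\<beta>, b) of the affine curve with b \<noteq> 0 the
  function x - \<beta> is a uniformizer, because the characteristic does not divide m; over a root
  of f it is w; at infinity it is a monomial in x and w with exponents from a Bezout relation
  between m and r. In the first case the ramification index is 1 < m, so the totally ramified places
  other than the one at infinity lie over the roots of f. Dimensions are compared, never computed:
  nested subspaces of finite dimension have equal dimension iff they are equal, so a gap at P1 means
  that no function of the larger space has the exact order - s1. For coordinates m q + a and m q' +
  b with residues in 1..m the inequality depends on the quotients only through their sum k. Each k
  thus contributes one set of residue pairs, repeated for the k + 1 ways to split k into two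
  quotients; these are the translates by \<open>wvec m j\<close>.\<close>

lemma is_subring_zero: "is_subring R \<Longrightarrow> 0 \<in> R"
  unfolding is_subring_def by (metis diff_self)

lemma is_subring_one: "is_subring R \<Longrightarrow> 1 \<in> R"
  unfolding is_subring_def by blast

lemma is_subring_diff: "is_subring R \<Longrightarrow> a \<in> R \<Longrightarrow> b \<in> R \<Longrightarrow> a - b \<in> R"
  unfolding is_subring_def by blast

lemma is_subring_mult: "is_subring R \<Longrightarrow> a \<in> R \<Longrightarrow> b \<in> R \<Longrightarrow> a * b \<in> R"
  unfolding is_subring_def by blast

lemma is_subring_uminus: "is_subring R \<Longrightarrow> a \<in> R \<Longrightarrow> - a \<in> R"
  using is_subring_diff[of R 0 a] is_subring_zero[of R] by simp

lemma is_subring_add: "is_subring R \<Longrightarrow> a \<in> R \<Longrightarrow> b \<in> R \<Longrightarrow> a + b \<in> R"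
  using is_subring_diff[of R a "- b"] is_subring_uminus[of R b] by simp

lemma is_subring_power: "is_subring R \<Longrightarrow> a \<in> R \<Longrightarrow> a ^ n \<in> R"
  by (induction n) (auto intro: is_subring_one is_subring_mult)

lemma is_subring_sum: "is_subring R \<Longrightarrow> (\<And>i. i \<in> I \<Longrightarrow> g i \<in> R) \<Longrightarrow> sum g I \<in> R"
  by (induction I rule: infinite_finite_induct) (auto intro: is_subring_zero is_subring_add)

lemma is_subring_poly:
  assumes "is_subring R" "\<And>i. Polynomial.coeff p i \<in> R" "z \<in> R"
  shows "poly p z \<in> R"
  unfolding poly_altdef using assms
  by (auto intro!: is_subring_sum is_subring_mult is_subring_power)

lemmas is_subring_intros =
  is_subring_zero is_subring_one is_subring_diff is_subring_mult is_subring_uminus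
  is_subring_add is_subring_power is_subring_sum

lemma is_subfield_is_subring: "is_subfield F \<Longrightarrow> is_subring F"
  unfolding is_subfield_def by blast

lemma is_subfield_inverse: "is_subfield F \<Longrightarrow> a \<in> F \<Longrightarrow> inverse a \<in> F"
  unfolding is_subfield_def by blast

lemma is_subfield_divide: "is_subfield F \<Longrightarrow> a \<in> F \<Longrightarrow> b \<in> F \<Longrightarrow> a / b \<in> F"
  by (simp add: divide_inverse is_subfield_inverse is_subfield_is_subring is_subring_mult)

lemma is_subfield_powi: "is_subfield F \<Longrightarrow> a \<in> F \<Longrightarrow> a powi n \<in> F"
  by (simp add: power_int_def is_subfield_inverse is_subfield_is_subring is_subring_power)

lemma is_subfield_Inter:
  "(\<And>F. F \<in> \<F> \<Longrightarrow> is_subfield F) \<Longrightarrow> is_subfield (\<Inter>\<F>)"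
  unfolding is_subfield_def is_subring_def by blast

lemma is_subfield_adjoin: "is_subfield (adjoin \<iota> S)"
  unfolding adjoin_def by (rule hull_in) (auto intro: is_subfield_Inter)

lemma adjoin_superset: "range \<iota> \<union> S \<subseteq> adjoin \<iota> S"
  unfolding adjoin_def by (rule hull_subset)

lemma adjoin_minimal: "is_subfield F \<Longrightarrow> range \<iota> \<union> S \<subseteq> F \<Longrightarrow> adjoin \<iota> S \<subseteq> F"
  unfolding adjoin_def by (rule hull_minimal)


section \<open>Places and their valuations\<close>

locale ff_place =
  fixes K F P :: "'a::field set"
  assumes F_subfield: "is_subfield F" and P_place: "P \<in> places K F"
begin

abbreviation R :: "'a set" where "R \<equiv> ring_at F P"
abbreviation U :: "'a set" where "U \<equiv> R - P"

lemma F_subring: "is_subring F"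
  using F_subfield by (rule is_subfield_is_subring)

text \<open>If z is outside the valuation ring, its inverse is a non-unit of the ring and hence in
  P; so the place determines its ring.\<close>

lemma ring_at_valuation_ring:
  "R \<in> valuation_rings K F \<and> P = {z \<in> R. z = 0 \<or> inverse z \<notin> R}"
proof -
  obtain S where S: "S \<in> valuation_rings K F" "P = {z \<in> S. z = 0 \<or> inverse z \<notin> S}"
    using P_place unfolding places_def by blast
  have SF: "S \<subseteq> F" "\<And>z. z \<in> F \<Longrightarrow> z \<in> S \<or> inverse z \<in> S"
    using S(1) unfolding valuation_rings_def by auto
  have "0 \<in> S" using S(1) is_subring_zero unfolding valuation_rings_def by auto
  then have "R = S"
    unfolding ring_at_def S(2) using SF by auto
  then show ?thesis using S by simp
qed

lemma R_subring: "is_subring R"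
  and K_subset_R: "K \<subseteq> R"
  and R_subset_F: "R \<subseteq> F"
  and R_neq_F: "R \<noteq> F"
  and R_dichotomy: "z \<in> F \<Longrightarrow> z \<in> R \<or> inverse z \<in> R"
  using ring_at_valuation_ring unfolding valuation_rings_def by auto

lemma mem_P_iff: "z \<in> P \<longleftrightarrow> z \<in> R \<and> (z = 0 \<or> inverse z \<notin> R)"
  using ring_at_valuation_ring by blast

lemma mem_U_iff: "u \<in> U \<longleftrightarrow> u \<noteq> 0 \<and> u \<in> R \<and> inverse u \<in> R"
  using mem_P_iff[of u] by blast

lemma P_subset_R: "P \<subseteq> R"
  using mem_P_iff by blast

lemma zero_in_P: "0 \<in> P"
  using mem_P_iff R_subring is_subring_zero by blast

lemma one_in_U: "1 \<in> U"
  using mem_U_iff R_subring is_subring_one by auto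

lemma one_notin_P: "1 \<notin> P"
  using one_in_U by blast

lemma U_mult: "u \<in> U \<Longrightarrow> v \<in> U \<Longrightarrow> u * v \<in> U"
  unfolding mem_U_iff using R_subring by (auto intro: is_subring_mult)

lemma U_inverse: "u \<in> U \<Longrightarrow> inverse u \<in> U"
  unfolding mem_U_iff by auto

lemma U_divide: "u \<in> U \<Longrightarrow> v \<in> U \<Longrightarrow> u / v \<in> U"
  by (simp only: divide_inverse) (intro U_mult U_inverse)

lemma U_power: "u \<in> U \<Longrightarrow> u ^ n \<in> U"
  by (induction n) (use one_in_U U_mult in auto)

lemma U_powi: "u \<in> U \<Longrightarrow> u powi n \<in> U"
  unfolding power_int_def using U_power U_inverse by auto

lemma P_mult: "a \<in> P \<Longrightarrow> b \<in> R \<Longrightarrow> a * b \<in> P"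
proof -
  assume a: "a \<in> P" and b: "b \<in> R"
  have "a * b \<in> R" using a b R_subring P_subset_R by (auto intro: is_subring_mult)
  moreover have "inverse (a * b) \<notin> R" if "a * b \<noteq> 0"
  proof
    assume "inverse (a * b) \<in> R"
    then have "b * inverse (a * b) \<in> R" using b R_subring by (auto intro: is_subring_mult)
    moreover have "b * inverse (a * b) = inverse a" using that by (simp add: field_simps)
    ultimately have "inverse a \<in> R" by (simp only:)
    then show False using a that mem_P_iff[of a] by auto
  qed
  ultimately show "a * b \<in> P" using mem_P_iff[of "a * b"] by blast
qed

lemma P_mult': "a \<in> R \<Longrightarrow> b \<in> P \<Longrightarrow> a * b \<in> P"
  using P_mult[of b a] by (simp add: mult.commute)

text \<open>Of two nonzero elements one divides the other in R, so their sum is a multiple of one of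
  them.\<close>

lemma P_add: "a \<in> P \<Longrightarrow> b \<in> P \<Longrightarrow> a + b \<in> P"
proof -
  have *: "a + b \<in> P" if "a \<in> P" "b \<in> P" "a \<noteq> 0" "b / a \<in> R" for a b
  proof -
    have "a * (1 + b / a) \<in> P"
      using that R_subring by (intro P_mult is_subring_add is_subring_one) auto
    then show ?thesis using that(3) by (simp add: distrib_left)
  qed
  assume ab: "a \<in> P" "b \<in> P"
  show ?thesis
  proof (cases "a = 0 \<or> b = 0")
    case False
    have "b / a \<in> F"
      using ab P_subset_R R_subset_F F_subfield by (auto intro: is_subfield_divide)
    then have "b / a \<in> R \<or> a / b \<in> R"
      using R_dichotomy[of "b / a"] by simp
    then show ?thesis
      using *[of a b] *[of b a] ab False by (auto simp: add.commute)
  qed (use ab in auto)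
qed

lemma P_uminus: "a \<in> P \<Longrightarrow> - a \<in> P"
  using P_mult[of a "- 1"] R_subring by (auto intro: is_subring_uminus is_subring_one)

lemma P_diff: "a \<in> P \<Longrightarrow> b \<in> P \<Longrightarrow> a - b \<in> P"
  using P_add[of a "- b"] P_uminus[of b] by simp

lemma P_prime: "a \<in> R \<Longrightarrow> b \<in> R \<Longrightarrow> a * b \<in> P \<Longrightarrow> a \<in> P \<or> b \<in> P"
  using U_mult by blast

lemma P_power: "a \<in> R \<Longrightarrow> a ^ n \<in> P \<Longrightarrow> a \<in> P"
proof (induction n)
  case (Suc n)
  then show ?case using P_prime[of a "a ^ n"] R_subring by (auto intro: is_subring_power)
qed (use one_notin_P in auto)

lemma P_power_pos: "a \<in> P \<Longrightarrow> n > 0 \<Longrightarrow> a ^ n \<in> P"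
proof (induction n)
  case (Suc n)
  then show ?case using P_mult[of a "a ^ n"] R_subring P_subset_R
    by (auto intro: is_subring_power)
qed auto

lemma U_add_P: "u \<in> U \<Longrightarrow> a \<in> P \<Longrightarrow> u + a \<in> U"
  using P_diff[of "u + a" a] R_subring P_subset_R by (auto intro: is_subring_add)

lemma not_R_imp: "z \<in> F \<Longrightarrow> z \<notin> R \<Longrightarrow> inverse z \<in> P"
  using R_dichotomy[of z] mem_P_iff[of "inverse z"] by auto

lemma U_of_power: "z \<in> F \<Longrightarrow> z ^ n \<in> U \<Longrightarrow> n > 0 \<Longrightarrow> z \<in> U"
proof -
  assume z: "z \<in> F" and n: "z ^ n \<in> U" "n > 0"
  have "z \<in> R"
  proof (rule ccontr)
    assume "z \<notin> R"
    then have "inverse z ^ n \<in> P" using z n not_R_imp P_power_pos by blast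
    then have "inverse (z ^ n) \<in> P" by (simp add: power_inverse)
    then show False using U_inverse[OF n(1)] by blast
  qed
  then show "z \<in> U" using n P_power_pos by blast
qed

lemma R_of_power: "z \<in> F \<Longrightarrow> z ^ n \<in> R \<Longrightarrow> n > 0 \<Longrightarrow> z \<in> R"
proof (rule ccontr)
  assume z: "z \<in> F" "z ^ n \<in> R" "n > 0" "z \<notin> R"
  then have "inverse z \<in> P" using not_R_imp by blast
  then have "inverse z ^ n * z ^ n \<in> P" using z P_power_pos P_mult by blast
  moreover have "z \<noteq> 0" using z(4) R_subring is_subring_zero by blast
  ultimately show False using one_notin_P by (simp add: power_inverse)
qed

text \<open>A relation instead of a function: it is used with t any nonzero element of P, not yet
  known to be a uniformizer, and z may have no order with respect to t. Orders can thus be computed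
  before discreteness is proved.\<close>

definition has_val :: "'a \<Rightarrow> 'a \<Rightarrow> int \<Rightarrow> bool" where
  "has_val t z n \<longleftrightarrow> z / t powi n \<in> U"

definition discrete_at :: "'a \<Rightarrow> bool" where
  "discrete_at t \<longleftrightarrow> t \<in> P \<and> t \<noteq> 0 \<and> (\<forall>z \<in> F - {0}. \<exists>n. has_val t z n)"

end

locale ff_place_elt = ff_place +
  fixes t assumes t_in_P: "t \<in> P" and t_nz: "t \<noteq> 0"
begin

lemma t_in_R: "t \<in> R"
  using t_in_P P_subset_R by auto

lemma hv_nz: "has_val t z n \<Longrightarrow> z \<noteq> 0"
  unfolding has_val_def mem_U_iff by auto

lemma hv_unit: "u \<in> U \<Longrightarrow> has_val t u 0"
  unfolding has_val_def by simp

lemma hv_0_iff: "has_val t u 0 \<longleftrightarrow> u \<in> U"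
  unfolding has_val_def by simp

lemma hv_self: "has_val t t 1"
  unfolding has_val_def using t_nz one_in_U by simp

lemma hv_mult: "has_val t z n \<Longrightarrow> has_val t z' n' \<Longrightarrow> has_val t (z * z') (n + n')"
  unfolding has_val_def using U_mult[of "z / t powi n" "z' / t powi n'"] t_nz
  by (simp add: power_int_add)

lemma hv_inverse: "has_val t z n \<Longrightarrow> has_val t (inverse z) (- n)"
  unfolding has_val_def using U_inverse[of "z / t powi n"]
  by (simp add: power_int_minus field_simps)

lemma hv_divide: "has_val t z n \<Longrightarrow> has_val t z' n' \<Longrightarrow> has_val t (z / z') (n - n')"
  using hv_mult[of z n "inverse z'" "- n'"] hv_inverse[of z' n'] by (simp add: divide_inverse)

lemma hv_power: "has_val t z n \<Longrightarrow> has_val t (z ^ k) (int k * n)"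
  by (induction k) (use hv_unit[OF one_in_U] hv_mult in \<open>auto simp: algebra_simps\<close>)

lemma hv_powi: "has_val t z n \<Longrightarrow> has_val t (z powi k) (k * n)"
  using hv_power[of z n "nat k"] hv_inverse[OF hv_power[of z n "nat (- k)"]]
  by (auto simp: power_int_def power_inverse)

lemma hv_nonneg: "has_val t z n \<Longrightarrow> n \<ge> 0 \<Longrightarrow> z \<in> R"
proof -
  assume z: "has_val t z n" "n \<ge> 0"
  have "z / t powi n * t ^ nat n \<in> R"
    using z t_in_R R_subring unfolding has_val_def
    by (intro is_subring_mult is_subring_power) auto
  then show ?thesis using z(2) t_nz by (simp add: power_int_def)
qed

lemma hv_pos: "has_val t z n \<Longrightarrow> n > 0 \<Longrightarrow> z \<in> P"
proof -
  assume z: "has_val t z n" "n > 0"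
  have "z / t powi n * t ^ nat n \<in> P"
    using z t_in_P R_subring unfolding has_val_def
    by (intro P_mult' P_power_pos) auto
  then show ?thesis using z(2) t_nz by (simp add: power_int_def)
qed

text \<open>With n > n' the quotient z / z = 1 would have positive order and lie in P.\<close>

lemma hv_unique: "has_val t z n \<Longrightarrow> has_val t z n' \<Longrightarrow> n = n'"
proof -
  have *: "\<not> n > n'" if "has_val t z n" "has_val t z n'" for n n'
    using hv_pos[OF hv_divide[OF that]] hv_nz[OF that(1)] one_notin_P by auto
  assume "has_val t z n" "has_val t z n'"
  then show ?thesis using *[of n n'] *[of n' n] by force
qed

lemma hv_in_R_iff: "has_val t z n \<Longrightarrow> z \<in> R \<longleftrightarrow> n \<ge> 0"
proof
  assume z: "has_val t z n" "z \<in> R"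
  show "n \<ge> 0"
  proof (rule ccontr)
    assume "\<not> n \<ge> 0"
    then have "inverse z \<in> P" using hv_pos[OF hv_inverse[OF z(1)]] by simp
    then have "inverse z * z \<in> P" using z(2) P_mult by blast
    then show False using hv_nz[OF z(1)] one_notin_P by simp
  qed
qed (rule hv_nonneg)

lemma hv_add_less:
  assumes "has_val t z n" "has_val t z' n'" "n < n'"
  shows "has_val t (z + z') n"
proof -
  have "z' / t powi n \<in> P"
    using hv_pos[OF hv_divide[OF assms(2) hv_powi[OF hv_self, of n]]] assms(3) by simp
  then show ?thesis
    using assms(1) U_add_P[of "z / t powi n"] unfolding has_val_def by (simp add: add_divide_distrib)
qed

lemma hv_sum:
  assumes "finite I" "I \<noteq> {}" "\<And>i. i \<in> I \<Longrightarrow> has_val t (g i) (n i)" "inj_on n I"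
  shows "has_val t (sum g I) (Min (n ` I))"
  using assms
proof (induction I rule: finite_ne_induct)
  case (insert i I)
  have IH: "has_val t (sum g I) (Min (n ` I))" using insert by auto
  have "Min (n ` I) \<in> n ` I" using insert by (intro Min_in) auto
  moreover have "n i \<notin> n ` I" using insert by auto
  ultimately have "n i \<noteq> Min (n ` I)" by metis
  then consider "n i < Min (n ` I)" | "Min (n ` I) < n i" by linarith
  then show ?case
  proof cases
    case 1
    then show ?thesis
      using hv_add_less[OF insert(5)[of i] IH] insert(1-3) by (simp add: min_absorb1)
  next
    case 2
    then show ?thesis
      using hv_add_less[OF IH insert(5)[of i]] insert(1-3) by (simp add: min_absorb2 add.commute)
  qed
qed simp

lemma discrete_uniformizer:
  assumes "discrete_at t"
  shows "uniformizer F P t"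
proof -
  have "z \<in> (\<lambda>z. t * z) ` R" if z: "z \<in> P" for z
  proof (cases "z = 0")
    case True
    then show ?thesis using R_subring is_subring_zero by force
  next
    case False
    then obtain n where n: "has_val t z n"
      using assms z P_subset_R R_subset_F unfolding discrete_at_def by blast
    have "n \<ge> 0" using n z P_subset_R hv_in_R_iff by blast
    moreover have "n \<noteq> 0" using n z hv_0_iff by blast
    ultimately have "n - 1 \<ge> 0" by simp
    then have "z / t \<in> R" using hv_divide[OF n hv_self] hv_in_R_iff by blast
    moreover have "z = t * (z / t)" using t_nz by simp
    ultimately show ?thesis by blast
  qed
  then show ?thesis
    unfolding uniformizer_def using t_in_P P_mult by blast
qed

lemma val_eq:
  assumes t: "discrete_at t" and z: "has_val t z n"
  shows "val F P z = n"
  unfolding val_def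
proof (rule the_equality)
  have "z = t powi n * (z / t powi n)" using t_nz by simp
  then show "\<exists>t u. uniformizer F P t \<and> u \<in> U \<and> z = t powi n * u"
    using z discrete_uniformizer[OF t] unfolding has_val_def by blast
next
  fix n' assume "\<exists>t u. uniformizer F P t \<and> u \<in> U \<and> z = t powi n' * u"
  then obtain s u where s: "uniformizer F P s" "u \<in> U" "z = s powi n' * u" by blast
  \<comment> \<open>Two uniformizers divide each other in R, so they differ by a unit and give the
    same orders.\<close>
  have "t \<in> (\<lambda>z. s * z) ` R" "s \<in> (\<lambda>z. t * z) ` R"
    using t_in_P s(1) discrete_uniformizer[OF t] unfolding uniformizer_def by auto
  then obtain a b where ab: "t = s * a" "a \<in> R" "s = t * b" "b \<in> R" by blast
  then have "t * (a * b) = t * 1" by (simp add: mult.commute mult.left_commute)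
  then have "a * b = 1" using t_nz by simp
  then have "b \<in> U" unfolding mem_U_iff using ab
    by (metis inverse_unique mult.commute mult_zero_left zero_neq_one)
  then have "has_val t s 1" using ab t_nz unfolding has_val_def by simp
  then have "has_val t z n'"
    using hv_mult[OF hv_powi hv_unit[OF s(2)], of s 1 n'] s(3) by simp
  then show "n' = n" using hv_unique z by blast
qed

lemma hv_val: "discrete_at t \<Longrightarrow> z \<in> F \<Longrightarrow> z \<noteq> 0 \<Longrightarrow> has_val t z (val F P z)"
  using val_eq unfolding discrete_at_def by fastforce

lemma val_nonneg_iff:
  assumes "discrete_at t" "z \<in> F" "z \<noteq> 0"
  shows "val F P z \<ge> 0 \<longleftrightarrow> z \<in> R"
  using hv_in_R_iff[OF hv_val[OF assms]] by simp

end


section \<open>Extension of prime ideals to places\<close>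

text \<open>For a subring J this is the ring J[z]; for an ideal J of a subring B it is the ideal
  generated by J in B[z].\<close>

definition poly_values :: "'a::field set \<Rightarrow> 'a \<Rightarrow> 'a set" where
  "poly_values J z = {poly p z | p. \<forall>i. Polynomial.coeff p i \<in> J}"

lemma is_subring_poly_values:
  assumes B: "is_subring B"
  shows "is_subring (poly_values B z)"
  unfolding is_subring_def
proof (intro conjI ballI)
  have "\<forall>i. Polynomial.coeff 1 i \<in> B"
    using B by (auto simp: is_subring_zero is_subring_one coeff_1)
  then show "1 \<in> poly_values B z" unfolding poly_values_def
    by (auto intro!: exI[of _ "1 :: 'a poly"])
  fix a b assume "a \<in> poly_values B z" "b \<in> poly_values B z"
  then obtain p q where pq: "a = poly p z" "b = poly q z"
    "\<forall>i. Polynomial.coeff p i \<in> B" "\<forall>i. Polynomial.coeff q i \<in> B"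
    unfolding poly_values_def by blast
  have "\<forall>i. Polynomial.coeff (p - q) i \<in> B" using pq B by (auto intro: is_subring_diff)
  then show "a - b \<in> poly_values B z"
    unfolding poly_values_def pq by (auto intro!: exI[of _ "p - q"])
  have "\<forall>i. Polynomial.coeff (p * q) i \<in> B"
    unfolding coeff_mult using pq B by (auto intro!: is_subring_sum is_subring_mult)
  then show "a * b \<in> poly_values B z"
    unfolding poly_values_def pq by (auto intro!: exI[of _ "p * q"])
qed

lemma poly_values_superset: "is_subring B \<Longrightarrow> B \<subseteq> poly_values B z"
proof
  fix b assume "is_subring B" "b \<in> B"
  then have "\<forall>i. Polynomial.coeff [:b:] i \<in> B"
    by (auto simp: coeff_pCons is_subring_zero split: nat.split)
  then show "b \<in> poly_values B z" unfolding poly_values_def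
    by (auto intro!: exI[of _ "[:b:]"])
qed

lemma poly_values_self: "is_subring B \<Longrightarrow> z \<in> poly_values B z"
proof -
  assume "is_subring B"
  then have "\<forall>i. Polynomial.coeff [:0, 1:] i \<in> B"
    by (auto simp: coeff_pCons is_subring_zero is_subring_one split: nat.split)
  then show "z \<in> poly_values B z" unfolding poly_values_def
    by (auto intro!: exI[of _ "[:0, 1:]"])
qed

text \<open>The ideals to be extended are those of points of the affine curve, with the generators x
  - \<beta> and w - b; a single generator is listed twice.\<close>

definition ideal2 :: "'a::field \<Rightarrow> 'a \<Rightarrow> 'a set \<Rightarrow> 'a set" where
  "ideal2 s t B = {s * a + t * b | a b. a \<in> B \<and> b \<in> B}"

lemma ideal2_subset: "is_subring B \<Longrightarrow> s \<in> B \<Longrightarrow> t \<in> B \<Longrightarrow> ideal2 s t B \<subseteq> B"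
  unfolding ideal2_def by (auto intro!: is_subring_add is_subring_mult)

lemma ideal2_zero: "is_subring B \<Longrightarrow> 0 \<in> ideal2 s t B"
  unfolding ideal2_def using is_subring_zero by force

lemma ideal2_generators:
  assumes "is_subring B"
  shows "s \<in> ideal2 s t B" "t \<in> ideal2 s t B"
proof -
  have "s = s * 1 + t * 0" "t = s * 0 + t * 1" by simp_all
  then show "s \<in> ideal2 s t B" "t \<in> ideal2 s t B"
    unfolding ideal2_def using is_subring_zero[OF assms] is_subring_one[OF assms] by blast+
qed

lemma ideal2_diff:
  assumes "is_subring B" "c \<in> ideal2 s t B" "d \<in> ideal2 s t B"
  shows "c - d \<in> ideal2 s t B"
proof -
  obtain a b a' b' where "c = s * a + t * b" "d = s * a' + t * b'"
    "a \<in> B" "b \<in> B" "a' \<in> B" "b' \<in> B" using assms unfolding ideal2_def by blast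
  then have "c - d = s * (a - a') + t * (b - b')" "a - a' \<in> B" "b - b' \<in> B"
    using assms(1) by (auto simp: algebra_simps is_subring_diff)
  then show ?thesis unfolding ideal2_def by blast
qed

lemma ideal2_mult:
  assumes "is_subring B" "c \<in> ideal2 s t B" "d \<in> B"
  shows "d * c \<in> ideal2 s t B"
proof -
  obtain a b where "c = s * a + t * b" "a \<in> B" "b \<in> B" using assms unfolding ideal2_def by blast
  then have "d * c = s * (d * a) + t * (d * b)" "d * a \<in> B" "d * b \<in> B"
    using assms by (auto simp: algebra_simps is_subring_mult)
  then show ?thesis unfolding ideal2_def by blast
qed

lemma ideal2_add:
  assumes "is_subring B" "c \<in> ideal2 s t B" "d \<in> ideal2 s t B"
  shows "c + d \<in> ideal2 s t B"
  using ideal2_diff[OF assms(1,2), of "0 - d"] ideal2_diff[OF assms(1) ideal2_zero assms(3)] assms(1)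
  by simp

lemma poly_values_ideal2:
  assumes B: "is_subring B"
  shows "ideal2 s t (poly_values B z) \<subseteq> poly_values (ideal2 s t B) z"
proof
  fix c assume "c \<in> ideal2 s t (poly_values B z)"
  then obtain p q where pq: "c = s * poly p z + t * poly q z"
    "\<forall>i. Polynomial.coeff p i \<in> B" "\<forall>i. Polynomial.coeff q i \<in> B"
    unfolding ideal2_def poly_values_def by blast
  have "\<forall>i. Polynomial.coeff (Polynomial.smult s p + Polynomial.smult t q) i \<in> ideal2 s t B"
    using pq unfolding ideal2_def by auto
  moreover have "c = poly (Polynomial.smult s p + Polynomial.smult t q) z" using pq by simp
  ultimately show "c \<in> poly_values (ideal2 s t B) z" unfolding poly_values_def by blast
qed


text \<open>
  Elimination of the leading term: an expression of \<open>1\<close> as a polynomial in \<open>z\<close> with coefficients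
  in the ideal can be shortened with the help of one that is not longer, in \<open>inverse z\<close>.
\<close>

lemma ideal_relation_shorten:
  fixes a b :: "nat \<Rightarrow> 'a::field"
  assumes M: "is_subring M" and z: "z \<noteq> 0" and n: "n > 0"
    and a: "\<And>i. a i \<in> ideal2 s t M" "(\<Sum>i\<le>n. a i * z ^ i) = 1"
    and b: "\<And>i. b i \<in> ideal2 s t M" "(\<Sum>i\<le>k. b i * inverse z ^ i) = 1" "\<And>i. i > k \<Longrightarrow> b i = 0"
    and k: "k \<le> n" and u: "1 - b 0 \<noteq> 0" "inverse (1 - b 0) \<in> M"
    and sub: "ideal2 s t M \<subseteq> M"
  shows "\<exists>c. (\<forall>i. c i \<in> ideal2 s t M) \<and> (\<Sum>i<n. c i * z ^ i) = 1"
proof -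
  define v where "v = inverse (1 - b 0)"
  have "(\<Sum>i\<le>k. b i * inverse z ^ i) = (\<Sum>i\<le>n. b i * inverse z ^ i)"
    by (rule sum.mono_neutral_left) (use b(3) k in auto)
  \<comment> \<open>Since k \<le> n, multiplication by z^n clears the powers of
    \<open>inverse z\<close>; solving for z^n then uses that 1 - b 0 is a unit.\<close>
  then have "z ^ n = z ^ n * (\<Sum>i\<le>n. b i * inverse z ^ i)" using b(2) by simp
  also have "\<dots> = (\<Sum>i\<le>n. b i * z ^ (n - i))"
    unfolding sum_distrib_left using z
    by (intro sum.cong) (auto simp: power_diff power_inverse field_simps)
  also have "\<dots> = (\<Sum>i\<le>n. b (n - i) * z ^ i)"
    by (rule sum.reindex_bij_witness[of _ "\<lambda>i. n - i" "\<lambda>i. n - i"]) auto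
  also have "\<dots> = b 0 * z ^ n + (\<Sum>i<n. b (n - i) * z ^ i)"
    by (simp add: lessThan_Suc_atMost[symmetric] add.commute)
  finally have "(1 - b 0) * z ^ n = (\<Sum>i<n. b (n - i) * z ^ i)" by (simp add: algebra_simps)
  then have zn: "z ^ n = v * (\<Sum>i<n. b (n - i) * z ^ i)"
    unfolding v_def using u by (simp add: field_simps)
  define c where "c i = a i + a n * v * b (n - i)" for i
  have "1 = a n * z ^ n + (\<Sum>i<n. a i * z ^ i)"
    unfolding a(2)[symmetric] by (simp add: lessThan_Suc_atMost[symmetric] add.commute)
  also have "\<dots> = (\<Sum>i<n. c i * z ^ i)"
    unfolding zn c_def sum_distrib_left by (simp add: sum.distrib[symmetric] algebra_simps)
  finally have "(\<Sum>i<n. c i * z ^ i) = 1" by simp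
  moreover have "c i \<in> ideal2 s t M" for i
    unfolding c_def
    by (intro ideal2_add[OF M] ideal2_mult[OF M] a b is_subring_mult[OF M])
       (use a sub u v_def in auto)
  ultimately show ?thesis by blast
qed

text \<open>Chevalley's extension theorem. Zorn's lemma gives a ring M maximal among the subrings of
  F over A in which s and t do not generate the unit ideal. If M contained neither z nor its
  inverse, adjoining either one would make the ideal trivial, and of the two resulting relations of
  minimal length one would shorten the other. As s is a nonzero non-unit of M, the ring M differs
  from both F and K.\<close>

theorem place_extension:
  fixes F :: "'a::field set"
  assumes F: "is_subfield F" and K: "is_subfield K" "K \<subseteq> A"
    and A: "is_subring A" "A \<subseteq> F" and s: "s \<in> A" "s \<noteq> 0" and t: "t \<in> A"
    and proper: "1 \<notin> ideal2 s t A"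
  obtains P where "P \<in> places K F" "A \<subseteq> ring_at F P" "s \<in> P" "t \<in> P"
proof -
  let ?J = "ideal2 s t"
  define \<S> where "\<S> = {B. is_subring B \<and> A \<subseteq> B \<and> B \<subseteq> F \<and> 1 \<notin> ?J B}"
  have "\<S> \<noteq> {}" using A proper unfolding \<S>_def by blast
  moreover have "\<Union>\<C> \<in> \<S>" if C: "\<C> \<noteq> {}" "subset.chain \<S> \<C>" for \<C>
  proof -
    have sub: "\<And>B. B \<in> \<C> \<Longrightarrow> is_subring B \<and> A \<subseteq> B \<and> B \<subseteq> F \<and> 1 \<notin> ?J B"
      using C(2) unfolding subset_chain_def \<S>_def by blast
    have pair: "\<exists>B\<in>\<C>. a \<in> B \<and> b \<in> B" if "a \<in> \<Union>\<C>" "b \<in> \<Union>\<C>" for a b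
      using that C(2) unfolding subset_chain_def by blast
    have "is_subring (\<Union>\<C>)"
      unfolding is_subring_def
    proof (intro conjI ballI)
      show "1 \<in> \<Union>\<C>" using C(1) sub is_subring_one by blast
      fix a b assume "a \<in> \<Union>\<C>" "b \<in> \<Union>\<C>"
      then obtain B where "B \<in> \<C>" "a \<in> B" "b \<in> B" using pair by blast
      then show "a - b \<in> \<Union>\<C>" "a * b \<in> \<Union>\<C>"
        using sub is_subring_diff is_subring_mult by blast+
    qed
    moreover have "1 \<notin> ?J (\<Union>\<C>)"
    proof
      assume "1 \<in> ?J (\<Union>\<C>)"
      then obtain a b where "1 = s * a + t * b" "a \<in> \<Union>\<C>" "b \<in> \<Union>\<C>"
        unfolding ideal2_def by blast
      then obtain B where "B \<in> \<C>" "1 \<in> ?J B" using pair[of a b] unfolding ideal2_def by blast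
      then show False using sub by blast
    qed
    ultimately show ?thesis unfolding \<S>_def using C(1) sub by blast
  qed
  ultimately obtain M where M: "M \<in> \<S>" "\<forall>N\<in>\<S>. M \<subseteq> N \<longrightarrow> N = M"
    using subset_Zorn_nonempty[of \<S>] by blast
  have sub: "is_subring M" and AM: "A \<subseteq> M" and MF: "M \<subseteq> F" and 1: "1 \<notin> ?J M"
    using M(1) unfolding \<S>_def by auto
  have JM: "?J M \<subseteq> M" using sub s(1) t AM by (intro ideal2_subset) auto

  \<comment> \<open>Localizing at the elements 1 - d with d in the ideal keeps the ideal proper, so
    by maximality the localization N is M itself.\<close>
  have unit: "1 - c \<noteq> 0 \<and> inverse (1 - c) \<in> M" if c: "c \<in> ?J M" for c
  proof -
    have nz: "1 - d \<noteq> 0" if "d \<in> ?J M" for d using 1 that by auto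
    define N where "N = {b / (1 - d) | b d. b \<in> M \<and> d \<in> ?J M}"
    have prod: "\<exists>e\<in>?J M. (1 - d) * (1 - d') = 1 - e" if "d \<in> ?J M" "d' \<in> ?J M" for d d'
    proof
      show "d + d' - d * d' \<in> ?J M"
        using that JM by (intro ideal2_add ideal2_diff ideal2_mult sub) auto
    qed (simp add: algebra_simps)
    have MN: "M \<subseteq> N"
    proof
      fix b assume "b \<in> M"
      then show "b \<in> N" unfolding N_def using ideal2_zero[OF sub]
        by (intro CollectI exI[of _ b] exI[of _ 0]) auto
    qed
    have "is_subring N"
      unfolding is_subring_def
    proof (intro conjI ballI)
      show "1 \<in> N" using MN sub is_subring_one by blast
      fix x y assume "x \<in> N" "y \<in> N"
      then obtain b d b' d' where x: "x = b / (1 - d)" "b \<in> M" "d \<in> ?J M"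
        and y: "y = b' / (1 - d')" "b' \<in> M" "d' \<in> ?J M" unfolding N_def by blast
      obtain e where e: "e \<in> ?J M" "(1 - d) * (1 - d') = 1 - e" using prod x y by blast
      have M1: "1 - d \<in> M" "1 - d' \<in> M" using x y sub JM by (auto intro: is_subring_diff is_subring_one)
      have "x - y = (b * (1 - d') - b' * (1 - d)) / (1 - e)"
        unfolding e(2)[symmetric] x(1) y(1) using nz[OF x(3)] nz[OF y(3)] by (simp add: field_simps)
      moreover have "b * (1 - d') - b' * (1 - d) \<in> M"
        using x y M1 sub by (auto intro!: is_subring_diff is_subring_mult)
      ultimately show "x - y \<in> N" unfolding N_def using e(1) by blast
      have "x * y = b * b' / (1 - e)"
        unfolding e(2)[symmetric] x(1) y(1) by simp
      then show "x * y \<in> N" unfolding N_def using e(1) x y sub is_subring_mult by blast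
    qed
    moreover have "N \<subseteq> F"
      unfolding N_def using MF JM F
      by (auto intro!: is_subfield_divide is_subring_diff is_subring_one is_subfield_is_subring)
    moreover have "1 \<notin> ?J N"
    proof
      assume "1 \<in> ?J N"
      then obtain b d b' d' where eq: "1 = s * (b / (1 - d)) + t * (b' / (1 - d'))"
        and bd: "b \<in> M" "d \<in> ?J M" "b' \<in> M" "d' \<in> ?J M" unfolding ideal2_def[of s t N] unfolding N_def by blast
      obtain e where e: "e \<in> ?J M" "(1 - d) * (1 - d') = 1 - e" using prod bd by blast
      have M1: "1 - d \<in> M" "1 - d' \<in> M" using bd sub JM by (auto intro: is_subring_diff is_subring_one)
      have "(1 - d) * (1 - d') = s * (b * (1 - d')) + t * (b' * (1 - d))"
        using eq nz[OF bd(2)] nz[OF bd(4)] by (simp add: field_simps)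
      then have "1 = e + (s * (b * (1 - d')) + t * (b' * (1 - d)))"
        unfolding e(2) by (simp add: algebra_simps)
      moreover have "s * (b * (1 - d')) + t * (b' * (1 - d)) \<in> ?J M"
        unfolding ideal2_def using bd M1 sub is_subring_mult by blast
      ultimately have "1 \<in> ?J M" using e(1) ideal2_add[OF sub] by metis
      then show False using 1 by simp
    qed
    ultimately have "N = M" using M(2) MN AM unfolding \<S>_def by blast
    moreover have "1 / (1 - c) \<in> N"
      unfolding N_def using c sub is_subring_one by blast
    ultimately show ?thesis using nz[OF c] by (simp add: inverse_eq_divide)
  qed

  \<comment> \<open>M[z] is strictly larger than M, so by maximality its ideal contains 1; this is a
    relation for z with coefficients in the ideal of M.\<close>
  have rel: "\<exists>n a. (\<forall>i. a i \<in> ?J M) \<and> (\<forall>i>n. a i = 0) \<and> (\<Sum>i\<le>n. a i * z ^ i) = 1"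
    if z: "z \<in> F" "z \<notin> M" for z
  proof -
    have "M \<subseteq> poly_values M z" "poly_values M z \<noteq> M"
      using poly_values_superset[OF sub] poly_values_self[OF sub, of z] z(2) by auto
    then have "poly_values M z \<notin> \<S>" using M(2) by metis
    moreover have "poly_values M z \<subseteq> F"
      unfolding poly_values_def using z MF F is_subfield_is_subring
      by (auto intro!: is_subring_poly)
    ultimately have "1 \<in> ?J (poly_values M z)"
      unfolding \<S>_def using is_subring_poly_values[OF sub, of z] \<open>M \<subseteq> poly_values M z\<close> AM
      by simp
    then have "1 \<in> poly_values (?J M) z" using poly_values_ideal2[OF sub] by blast
    then obtain p where "poly p z = 1" "\<forall>i. Polynomial.coeff p i \<in> ?J M"
      unfolding poly_values_def by force
    then show ?thesis
      by (intro exI[of _ "Polynomial.degree p"] exI[of _ "Polynomial.coeff p"])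
         (auto simp: poly_altdef coeff_eq_0)
  qed
  let ?W = "\<lambda>z n. \<exists>a. (\<forall>i. a i \<in> ?J M) \<and> (\<forall>i>n. a i = 0) \<and> (\<Sum>i\<le>n. a i * z ^ i) = 1"
  have W0: "\<not> ?W z 0" for z
  proof
    assume "?W z 0"
    then obtain a where a: "\<forall>i. a i \<in> ?J M" "(\<Sum>i\<le>0. a i * z ^ i) = 1" by blast
    then have "a 0 = 1" by simp
    then show False using 1 a(1) by metis
  qed
  have step: "?W z (n - 1)" if W: "?W z n" "?W (inverse z) k" "k \<le> n" and z: "z \<noteq> 0" for z n k
  proof -
    have n: "n > 0" using W0[of z] W(1) by (cases n) auto
    obtain a where a: "\<And>i. a i \<in> ?J M" "(\<Sum>i\<le>n. a i * z ^ i) = 1" using W(1) by blast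
    obtain b where b: "\<And>i. b i \<in> ?J M" "\<And>i. i > k \<Longrightarrow> b i = 0" "(\<Sum>i\<le>k. b i * inverse z ^ i) = 1"
      using W(2) by blast
    obtain c where c: "\<forall>i. c i \<in> ?J M" "(\<Sum>i<n. c i * z ^ i) = 1"
      using ideal_relation_shorten[OF sub z n a b(1) b(3) b(2) W(3)] unit[OF b(1)[of 0]] JM by blast
    have "(\<Sum>i\<le>n - 1. (if i < n then c i else 0) * z ^ i) = 1"
      unfolding c(2)[symmetric] using n by (intro sum.cong) auto
    then show ?thesis
      using c(1) n ideal2_zero[OF sub] by (intro exI[of _ "\<lambda>i. if i < n then c i else 0"]) auto
  qed
  have dich: "z \<in> M \<or> inverse z \<in> M" if z: "z \<in> F" for z
  proof (rule ccontr)
    assume "\<not> (z \<in> M \<or> inverse z \<in> M)"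
    then have zM: "z \<notin> M" "inverse z \<notin> M" by auto
    then have z0: "z \<noteq> 0" "inverse z \<noteq> 0" using sub is_subring_zero by auto
    \<comment> \<open>Degrees of the shortest relations for z and for \<open>inverse z\<close>;
      whichever is at least as long as the other can be shortened.\<close>
    define n where "n = (LEAST n. ?W z n)"
    define k where "k = (LEAST n. ?W (inverse z) n)"
    have n: "?W z n" unfolding n_def using rel[OF z zM(1)] by (rule LeastI_ex)
    have k: "?W (inverse z) k" unfolding k_def
      using rel[OF is_subfield_inverse[OF F z] zM(2)] by (rule LeastI_ex)
    have pos: "n > 0" "k > 0" using W0 n k by (metis gr0I)+
    show False
    proof (cases "k \<le> n")
      case True
      then show False using not_less_Least[of "n - 1" "?W z"] step[OF n k] z0 pos
        unfolding n_def[symmetric] by auto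
    next
      case False
      then show False using not_less_Least[of "k - 1" "?W (inverse z)"] step[OF k, of n] n z0 pos
        unfolding k_def[symmetric] by auto
    qed
  qed
  have inv: "b = 0 \<or> inverse b \<notin> M" if b: "b \<in> {s, t}" for b
  proof (rule ccontr)
    assume "\<not> (b = 0 \<or> inverse b \<notin> M)"
    then have b0: "b \<noteq> 0" "inverse b \<in> M" by auto
    have "1 = s * (if b = s then inverse b else 0) + t * (if b = s then 0 else inverse b)"
      using b b0(1) by auto
    moreover have "(if b = s then inverse b else 0) \<in> M" "(if b = s then 0 else inverse b) \<in> M"
      using b0 sub is_subring_zero by auto
    ultimately have "1 \<in> ?J M" unfolding ideal2_def by blast
    then show False using 1 by simp
  qed
  have "inverse s \<notin> M" using inv[of s] s(2) by simp
  then have "M \<in> valuation_rings K F"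
    unfolding valuation_rings_def using sub dich MF AM K A s(1)
      is_subfield_inverse[OF F, of s] is_subfield_inverse[OF K(1), of s] by blast
  then have P: "{z \<in> M. z = 0 \<or> inverse z \<notin> M} \<in> places K F" unfolding places_def by blast
  interpret ff_place K F "{z \<in> M. z = 0 \<or> inverse z \<notin> M}"
    using F P by unfold_locales
  have "M \<subseteq> ring_at F {z \<in> M. z = 0 \<or> inverse z \<notin> M}"
    unfolding ring_at_def using MF by auto
  then show ?thesis
    using that[OF P] inv[of s] inv[of t] AM s(1) t by auto
qed

section \<open>Field embeddings\<close>

locale field_emb =
  fixes \<iota> :: "'k::field \<Rightarrow> 'a::field"
  assumes embedding: "field_embedding \<iota>"
begin

lemma emb_1 [simp]: "\<iota> 1 = 1" and emb_add: "\<iota> (a + b) = \<iota> a + \<iota> b"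
  and emb_mult: "\<iota> (a * b) = \<iota> a * \<iota> b"
  using embedding unfolding field_embedding_def by auto

lemma emb_0 [simp]: "\<iota> 0 = 0"
  using emb_add[of 0 0] by (metis add.right_neutral add_left_cancel)

lemma emb_uminus: "\<iota> (- a) = - \<iota> a"
  using emb_add[of a "- a"] by (simp add: eq_neg_iff_add_eq_0 add.commute)

lemma emb_diff: "\<iota> (a - b) = \<iota> a - \<iota> b"
  using emb_add[of a "- b"] by (simp add: emb_uminus)

lemma emb_power: "\<iota> (a ^ n) = \<iota> a ^ n"
  by (induction n) (auto simp: emb_mult)

lemma emb_sum: "\<iota> (sum g I) = (\<Sum>i\<in>I. \<iota> (g i))"
  by (induction I rule: infinite_finite_induct) (auto simp: emb_add)

lemma emb_eq_0_iff [simp]: "\<iota> a = 0 \<longleftrightarrow> a = 0"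
proof
  assume "\<iota> a = 0"
  then show "a = 0" using emb_mult[of a "inverse a"] by (cases "a = 0") auto
qed simp

lemma emb_inverse: "\<iota> (inverse a) = inverse (\<iota> a)"
  using emb_mult[of a "inverse a"] by (cases "a = 0") (auto simp: inverse_unique)

lemma map_poly_emb_mult: "map_poly \<iota> (p * q) = map_poly \<iota> p * map_poly \<iota> q"
  by (rule poly_eqI) (simp add: coeff_map_poly coeff_mult emb_sum emb_mult)

lemma map_poly_emb_diff: "map_poly \<iota> (p - q) = map_poly \<iota> p - map_poly \<iota> q"
  by (rule poly_eqI) (simp add: coeff_map_poly emb_diff)

lemma is_subfield_range: "is_subfield (range \<iota>)"
  unfolding is_subfield_def is_subring_def
proof (intro conjI ballI)
  show "1 \<in> range \<iota>" using emb_1 by (metis rangeI)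
  fix a b assume "a \<in> range \<iota>" "b \<in> range \<iota>"
  then show "a - b \<in> range \<iota>" "a * b \<in> range \<iota>"
    by (auto simp flip: emb_diff emb_mult)
next
  fix a assume "a \<in> range \<iota>"
  then show "inverse a \<in> range \<iota>" by (auto simp flip: emb_inverse)
qed

sublocale vs: vector_space "\<lambda>c z. \<iota> c * z"
  by unfold_locales (auto simp: algebra_simps emb_add emb_mult)

lemma independent_imageI:
  assumes "finite I" "inj_on g I"
    "\<And>c. (\<Sum>i\<in>I. \<iota> (c i) * g i) = 0 \<Longrightarrow> \<forall>i\<in>I. c i = 0"
  shows "vs.independent (g ` I)"
proof (rule vs.independent_if_scalars_zero)
  fix c b assume *: "(\<Sum>b\<in>g ` I. \<iota> (c b) * b) = 0" "b \<in> g ` I"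
  have "(\<Sum>i\<in>I. \<iota> (c (g i)) * g i) = 0"
    using *(1) by (simp add: sum.reindex[OF assms(2)])
  then show "c b = 0" using assms(3)[of "\<lambda>i. c (g i)"] *(2) by auto
qed (use assms in auto)

text \<open>A basis of V extends to a basis of W, which by the equality of the dimensions has no
  further elements; the finite spanning set T makes the cardinalities finite.\<close>

lemma subspace_eqI:
  assumes "vs.subspace V" "vs.subspace W" "V \<subseteq> W" "W \<subseteq> vs.span T" "finite T"
    and dim: "vs.dim V = vs.dim W"
  shows "V = W"
proof -
  obtain B where B: "B \<subseteq> V" "vs.independent B" "V \<subseteq> vs.span B" "card B = vs.dim V"
    using vs.basis_exists .
  obtain C where C: "B \<subseteq> C" "C \<subseteq> W" "vs.independent C" "W \<subseteq> vs.span C"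
    using vs.maximal_independent_subset_extend[OF _ B(2), of W] B(1) assms(3) by blast
  have "finite C" using vs.independent_span_bound[OF assms(5) C(3)] C(2) assms(4) by auto
  moreover have "card C = vs.dim W" using vs.basis_card_eq_dim C by blast
  ultimately have "B = C" using C(1) B(4) dim by (intro card_subset_eq) auto
  then have "W \<subseteq> V" using C(4) vs.span_minimal[OF B(1) assms(1)] by auto
  then show ?thesis using assms(3) by auto
qed

text \<open>
  Multiplication by \<open>z \<noteq> 0\<close> maps \<open>B\<close> to an independent set of the same size, so that \<open>1\<close> is in
  the span of the image.
\<close>

lemma inverse_in_span:
  assumes B: "finite B" "vs.independent B"
    and mult: "\<And>a b. a \<in> vs.span B \<Longrightarrow> b \<in> vs.span B \<Longrightarrow> a * b \<in> vs.span B"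
    and one: "1 \<in> vs.span B" and z: "z \<in> vs.span B"
  shows "inverse z \<in> vs.span B"
proof (cases "z = 0")
  case False
  define T where "T = (\<lambda>b. z * b) ` B"
  have inj: "inj_on (\<lambda>b. z * b) B" using False by (auto intro: inj_onI)
  have T: "vs.independent T"
    unfolding T_def
  proof (rule independent_imageI[OF B(1) inj])
    fix c assume "(\<Sum>b\<in>B. \<iota> (c b) * (z * b)) = 0"
    moreover have "(\<Sum>b\<in>B. \<iota> (c b) * (z * b)) = z * (\<Sum>b\<in>B. \<iota> (c b) * b)"
      by (simp add: sum_distrib_left algebra_simps)
    ultimately have "(\<Sum>b\<in>B. \<iota> (c b) * b) = 0" using False by simp
    then show "\<forall>b\<in>B. c b = 0" using vs.independentD[OF B(2) B(1)] by blast
  qed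
  have TB: "T \<subseteq> vs.span B" unfolding T_def using z mult vs.span_base by blast
  have card: "card T = card B" unfolding T_def by (rule card_image[OF inj])
  have "1 \<in> vs.span T"
  proof (rule ccontr)
    assume 1: "1 \<notin> vs.span T"
    then have "vs.independent (insert 1 T)" using T by (rule vs.independent_insertI)
    then have "card (insert 1 T) \<le> card B"
      using vs.independent_span_bound[OF B(1)] TB one by blast
    moreover have "1 \<notin> T" using 1 vs.span_base by blast
    ultimately show False using card B(1) unfolding T_def by simp
  qed
  moreover have "vs.span T \<subseteq> (\<lambda>b. z * b) ` vs.span B"
  proof (rule vs.span_minimal)
    show "T \<subseteq> (\<lambda>b. z * b) ` vs.span B" unfolding T_def using vs.span_base by blast
    show "vs.subspace ((\<lambda>b. z * b) ` vs.span B)"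
    proof (rule vs.subspaceI)
      show "0 \<in> (\<lambda>b. z * b) ` vs.span B" using vs.span_zero by force
    next
      fix a b assume "a \<in> (\<lambda>b. z * b) ` vs.span B" "b \<in> (\<lambda>b. z * b) ` vs.span B"
      then show "a + b \<in> (\<lambda>b. z * b) ` vs.span B"
        using vs.span_add by (auto simp flip: distrib_left)
    next
      fix c a assume "a \<in> (\<lambda>b. z * b) ` vs.span B"
      then obtain b where "b \<in> vs.span B" "a = z * b" by blast
      then have "\<iota> c * a = z * (\<iota> c * b)" "\<iota> c * b \<in> vs.span B"
        using vs.span_scale by auto
      then show "\<iota> c * a \<in> (\<lambda>b. z * b) ` vs.span B" by blast
    qed
  qed
  ultimately obtain b where "b \<in> vs.span B" "1 = z * b" by blast
  then show ?thesis by (metis inverse_unique)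
qed (simp add: vs.span_zero)

lemma is_subfield_span:
  assumes "finite B" "vs.independent B" "1 \<in> vs.span B"
    and "\<And>a b. a \<in> vs.span B \<Longrightarrow> b \<in> vs.span B \<Longrightarrow> a * b \<in> vs.span B"
  shows "is_subfield (vs.span B)"
  unfolding is_subfield_def is_subring_def
proof (intro conjI ballI)
  show "inverse a \<in> vs.span B" if "a \<in> vs.span B" for a
    by (rule inverse_in_span) (fact assms that)+
qed (fact assms vs.span_diff)+

text \<open>The definite description asks for uniqueness too: any finite C with unique coordinates
  is a basis of the same space, hence has the size of B.\<close>

lemma extension_degree_eq:
  assumes B: "finite B" "vs.independent B"
  shows "extension_degree (range \<iota>) (vs.span B) = card B"
proof -
  have unique: "card C = card B"
    if C: "C \<subseteq> vs.span B" "finite C"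
      "\<forall>z\<in>vs.span B. \<exists>!c. c \<in> (\<Pi>\<^sub>E b\<in>C. range \<iota>) \<and> z = (\<Sum>b\<in>C. c b * b)" for C
  proof -
    have "vs.independent C"
    proof (rule vs.independent_if_scalars_zero[OF C(2)])
      fix u b assume u: "(\<Sum>b\<in>C. \<iota> (u b) * b) = 0" "b \<in> C"
      \<comment> \<open>Two coefficient families for 0, which the uniqueness of coordinates
        identifies.\<close>
      let ?c = "\<lambda>b\<in>C. \<iota> (u b)" and ?d = "\<lambda>b\<in>C. 0"
      have "?c \<in> (\<Pi>\<^sub>E b\<in>C. range \<iota>)" by auto
      moreover have "?d \<in> (\<Pi>\<^sub>E b\<in>C. range \<iota>)" using emb_0 by (auto simp: image_iff)
      moreover have "0 = (\<Sum>b\<in>C. ?c b * b)" "0 = (\<Sum>b\<in>C. ?d b * b)" using u(1) by auto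
      ultimately have "?c = ?d" using C(3) vs.span_zero[of B] by blast
      then show "u b = 0" using u(2) by (metis emb_eq_0_iff restrict_apply')
    qed
    moreover have "vs.span B \<subseteq> vs.span C"
    proof
      fix z assume "z \<in> vs.span B"
      then obtain c where c: "c \<in> (\<Pi>\<^sub>E b\<in>C. range \<iota>)" "z = (\<Sum>b\<in>C. c b * b)" using C(3) by blast
      show "z \<in> vs.span C"
        unfolding c(2)
      proof (rule vs.span_sum)
        fix b assume b: "b \<in> C"
        then obtain a where "c b = \<iota> a" using c(1) by (auto simp: PiE_iff)
        then show "c b * b \<in> vs.span C" using b vs.span_scale vs.span_base by metis
      qed
    qed
    ultimately show ?thesis
      using vs.basis_card_eq_dim[OF C(1)] vs.dim_span_eq_card_independent[OF B(2)] by simp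
  qed
  have basis: "\<exists>!c. c \<in> (\<Pi>\<^sub>E b\<in>B. range \<iota>) \<and> z = (\<Sum>b\<in>B. c b * b)" if z: "z \<in> vs.span B" for z
  proof -
    obtain u where u: "z = (\<Sum>b\<in>B. \<iota> (u b) * b)"
      using z vs.span_finite[OF B(1)] by auto
    show ?thesis
    proof (rule ex1I[of _ "\<lambda>b\<in>B. \<iota> (u b)"])
      show "(\<lambda>b\<in>B. \<iota> (u b)) \<in> (\<Pi>\<^sub>E b\<in>B. range \<iota>) \<and> z = (\<Sum>b\<in>B. (\<lambda>b\<in>B. \<iota> (u b)) b * b)"
        using u by auto
      fix c assume c: "c \<in> (\<Pi>\<^sub>E b\<in>B. range \<iota>) \<and> z = (\<Sum>b\<in>B. c b * b)"
      then have "\<forall>b\<in>B. \<exists>v. c b = \<iota> v" by (auto simp: PiE_iff)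
      then obtain v where v: "\<forall>b\<in>B. c b = \<iota> (v b)" by metis
      have "(\<Sum>b\<in>B. \<iota> (v b - u b) * b) = z - z"
        using c u v by (simp add: emb_diff left_diff_distrib sum_subtractf)
      then have "(\<Sum>b\<in>B. \<iota> (v b - u b) * b) = 0" by simp
      from vs.independentD[OF B(2) B(1) order_refl this]
      have "v b - u b = 0" if "b \<in> B" for b using that by blast
      then show "c = (\<lambda>b\<in>B. \<iota> (u b))"
        using c v by (auto simp: PiE_iff extensional_def fun_eq_iff)
    qed
  qed
  show ?thesis
    unfolding extension_degree_def
  proof (rule the_equality)
    show "\<exists>C\<subseteq>vs.span B. finite C \<and> card C = card B \<and>
      (\<forall>z\<in>vs.span B. \<exists>!c. c \<in> (\<Pi>\<^sub>E b\<in>C. range \<iota>) \<and> z = (\<Sum>b\<in>C. c b * b))"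
      using B(1) vs.span_superset[of B] basis by (intro exI[of _ B]) simp
  qed (use unique in auto)
qed

end


section \<open>Rational functions\<close>

locale ratfun = field_emb \<iota> for \<iota> :: "'k::field \<Rightarrow> 'a::field" +
  fixes x :: 'a
  assumes trans: "transcendental_over \<iota> x"
begin

definition E :: "'k poly \<Rightarrow> 'a" where "E p = poly (map_poly \<iota> p) x"

lemma E_0 [simp]: "E 0 = 0" and E_1 [simp]: "E 1 = 1"
  unfolding E_def by auto

lemma E_pCons: "E (pCons c p) = \<iota> c + x * E p"
  unfolding E_def by (simp add: map_poly_pCons)

lemma E_const [simp]: "E [:c:] = \<iota> c"
  by (simp add: E_pCons)

lemma E_linear: "E [:- c, 1:] = x - \<iota> c"
  by (simp add: E_pCons emb_uminus)

lemma E_add: "E (p + q) = E p + E q"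
proof -
  have "map_poly \<iota> (p + q) = map_poly \<iota> p + map_poly \<iota> q"
    by (rule poly_eqI) (simp add: coeff_map_poly emb_add)
  then show ?thesis by (simp add: E_def)
qed

lemma E_smult: "E (Polynomial.smult c p) = \<iota> c * E p"
  unfolding E_def by (simp add: map_poly_smult emb_mult)

lemma E_mult: "E (p * q) = E p * E q"
proof (induction p)
  case (pCons a p)
  then show ?case
    by (simp only: mult_pCons_left E_add E_smult E_pCons emb_0) (simp add: algebra_simps)
qed simp

lemma E_uminus: "E (- p) = - E p"
  using E_add[of p "- p"] by (simp add: eq_neg_iff_add_eq_0 add.commute)

lemma E_diff: "E (p - q) = E p - E q"
  using E_add[of p "- q"] by (simp add: E_uminus)

lemma E_power: "E (p ^ n) = E p ^ n"
  by (induction n) (auto simp: E_mult)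

lemma E_eq_0_iff [simp]: "E p = 0 \<longleftrightarrow> p = 0"
  using trans unfolding transcendental_over_def E_def by auto

lemma E_eq_iff [simp]: "E p = E q \<longleftrightarrow> p = q"
  using E_eq_0_iff[of "p - q"] by (simp add: E_diff)

lemma E_in_subring:
  assumes "is_subring R" "range \<iota> \<subseteq> R" "x \<in> R"
  shows "E p \<in> R"
  by (induction p) (use assms in \<open>auto simp: E_pCons intro!: is_subring_intros\<close>)

lemma is_subring_range_E: "is_subring (range E)"
  unfolding is_subring_def
proof (intro conjI ballI)
  show "1 \<in> range E" using E_1 by (metis rangeI)
  fix a b assume "a \<in> range E" "b \<in> range E"
  then show "a - b \<in> range E" "a * b \<in> range E"
    by (auto simp flip: E_diff E_mult)
qed

lemma range_emb_subset_range_E: "range \<iota> \<subseteq> range E"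
  using E_const by (metis image_subsetI rangeI)

definition Kx :: "'a set" where "Kx = adjoin \<iota> {x}"

lemma is_subfield_quotients: "is_subfield {E a / E b | a b. b \<noteq> 0}" (is "is_subfield ?Q")
  unfolding is_subfield_def is_subring_def
proof (intro conjI ballI)
  show "1 \<in> ?Q" by (intro CollectI exI[of _ 1]) auto
  fix u v assume "u \<in> ?Q" "v \<in> ?Q"
  then obtain a b c d where u: "u = E a / E b" "b \<noteq> 0" and v: "v = E c / E d" "d \<noteq> 0" by blast
  have "u - v = E (a * d - c * b) / E (b * d)" "b * d \<noteq> 0"
    using u v by (auto simp: E_diff E_mult diff_frac_eq)
  then show "u - v \<in> ?Q" by blast
  have "u * v = E (a * c) / E (b * d)" using u v by (auto simp: E_mult)
  then show "u * v \<in> ?Q" using \<open>b * d \<noteq> 0\<close> by blast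
next
  fix u assume "u \<in> ?Q"
  then obtain a b where u: "u = E a / E b" "b \<noteq> 0" by blast
  show "inverse u \<in> ?Q"
  proof (cases "a = 0")
    case True
    then show ?thesis using u by (intro CollectI exI[of _ 0] exI[of _ 1]) auto
  next
    case False
    then show ?thesis using u by (intro CollectI exI[of _ b] exI[of _ a]) auto
  qed
qed

lemma Kx_eq: "Kx = {E a / E b | a b. b \<noteq> 0}"
proof
  have "x = E [:0, 1:] / E 1" by (simp add: E_pCons)
  moreover have "\<iota> c = E [:c:] / E 1" for c by simp
  ultimately have "range \<iota> \<union> {x} \<subseteq> {E a / E b | a b. b \<noteq> 0}" using one_neq_zero by blast
  then show "Kx \<subseteq> {E a / E b | a b. b \<noteq> 0}"
    unfolding Kx_def using is_subfield_quotients by (rule adjoin_minimal[rotated])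
next
  have sub: "is_subring Kx" "is_subfield Kx" "range \<iota> \<union> {x} \<subseteq> Kx"
    unfolding Kx_def by (auto intro: is_subfield_adjoin is_subfield_is_subring
      adjoin_superset[THEN subsetD])
  then have "E p \<in> Kx" for p by (intro E_in_subring) auto
  then show "{E a / E b | a b. b \<noteq> 0} \<subseteq> Kx" using is_subfield_divide[OF sub(2)] by auto
qed

text \<open>
  The library's vector spaces need a type of scalars; the field \<open>K(x)\<close>, a set, is therefore replaced
  by the type of fractions of polynomials.
\<close>

definition frac_emb :: "'k poly fract \<Rightarrow> 'a" where
  "frac_emb c = (THE v. \<forall>a b. b \<noteq> 0 \<longrightarrow> c = Fract a b \<longrightarrow> v = E a / E b)"

lemma frac_emb_Fract: "b \<noteq> 0 \<Longrightarrow> frac_emb (Fract a b) = E a / E b"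
  unfolding frac_emb_def
proof (rule the_equality)
  assume b: "b \<noteq> 0"
  show "\<forall>a' b'. b' \<noteq> 0 \<longrightarrow> Fract a b = Fract a' b' \<longrightarrow> E a / E b = E a' / E b'"
  proof (intro allI impI)
    fix a' b' assume b': "b' \<noteq> 0" and "Fract a b = Fract a' b'"
    then have "E (a * b') = E (a' * b)" using b by (simp add: eq_fract)
    then show "E a / E b = E a' / E b'" using b b' by (simp add: E_mult frac_eq_eq)
  qed
qed auto

lemma field_embedding_frac_emb: "field_embedding frac_emb"
  unfolding field_embedding_def
proof (intro conjI allI)
  show "frac_emb 1 = 1" by (simp add: One_fract_def frac_emb_Fract)
  fix c d :: "'k poly fract"
  obtain a b where c: "c = Fract a b" "b \<noteq> 0" by (cases c) auto
  obtain a' b' where d: "d = Fract a' b'" "b' \<noteq> 0" by (cases d) auto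
  show "frac_emb (c + d) = frac_emb c + frac_emb d"
    using c d by (simp add: frac_emb_Fract E_add E_mult field_simps)
  show "frac_emb (c * d) = frac_emb c * frac_emb d"
    using c d by (simp add: frac_emb_Fract E_mult)
qed

lemma range_frac_emb: "range frac_emb = Kx"
proof -
  have "frac_emb c \<in> Kx" for c
    by (cases c) (auto simp: Kx_eq frac_emb_Fract)
  moreover have "v \<in> range frac_emb" if "v \<in> Kx" for v
    using that unfolding Kx_eq by (auto simp flip: frac_emb_Fract)
  ultimately show ?thesis by blast
qed

sublocale fr: field_emb frac_emb
  by unfold_locales (rule field_embedding_frac_emb)

end

section \<open>The Kummer extension\<close>

locale kummer = ratfun \<iota> x for \<iota> :: "'k::alg_closed_field \<Rightarrow> 'a::field" and x :: 'a +
  fixes f :: "'k poly" and m :: nat and w :: 'a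
  assumes m_ge_2: "m \<ge> 2" and coprime_m: "coprime m (Polynomial.degree f)"
    and char_m: "of_nat m \<noteq> (0 :: 'k)" and sqfree: "rsquarefree f"
    and deg_f: "Polynomial.degree f > 0" and w_pow: "w ^ m = E f"
begin

abbreviation F :: "'a set" where "F \<equiv> adjoin \<iota> {x, w}"

text \<open>\<open>range ev\<close> is the coordinate ring K[x, w] of the affine curve; the entries
  of p from index m on are ignored.\<close>

definition ev :: "(nat \<Rightarrow> 'k poly) \<Rightarrow> 'a" where "ev p = (\<Sum>i<m. E (p i) * w ^ i)"

lemma m_pos: "m > 0"
  using m_ge_2 by simp

lemma f_nz: "f \<noteq> 0"
  using sqfree unfolding rsquarefree_def by blast

lemma w_nz: "w \<noteq> 0"
  using w_pow f_nz m_pos E_eq_0_iff[of f] by (metis zero_power)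

lemma F_subfield: "is_subfield F"
  by (rule is_subfield_adjoin)

lemma F_subring: "is_subring F"
  using F_subfield by (rule is_subfield_is_subring)

lemma emb_subset_F: "range \<iota> \<subseteq> F" and x_in_F: "x \<in> F" and w_in_F: "w \<in> F"
  using adjoin_superset[of \<iota> "{x, w}"] by auto

lemma E_in_F: "E p \<in> F"
  using F_subring emb_subset_F x_in_F by (rule E_in_subring)

lemma ev_in_subring:
  assumes "is_subring R" "range \<iota> \<subseteq> R" "x \<in> R" "w \<in> R"
  shows "ev p \<in> R"
  unfolding ev_def using assms
  by (intro is_subring_sum is_subring_mult is_subring_power E_in_subring) auto

lemma ev_in_F: "ev p \<in> F"
  by (intro ev_in_subring F_subring emb_subset_F x_in_F w_in_F)

lemma ev_cong: "(\<And>i. i < m \<Longrightarrow> p i = q i) \<Longrightarrow> ev p = ev q"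
  unfolding ev_def by (intro sum.cong) auto

lemma ev_add: "ev (\<lambda>i. p i + q i) = ev p + ev q"
  unfolding ev_def by (simp add: E_add distrib_right sum.distrib)

lemma ev_diff: "ev (\<lambda>i. p i - q i) = ev p - ev q"
  unfolding ev_def by (simp add: E_diff left_diff_distrib sum_subtractf)

lemma ev_smult: "ev (\<lambda>i. q * p i) = E q * ev p"
  unfolding ev_def by (simp add: E_mult sum_distrib_left mult.assoc)

lemma ev_single: "i < m \<Longrightarrow> ev (\<lambda>j. if j = i then q else 0) = E q * w ^ i"
  unfolding ev_def by (simp add: if_distrib[where f = E] if_distrib[where f = "\<lambda>z. z * _"] sum.delta cong: if_cong)

lemma E_w_pow_in_range_ev: "E q * w ^ n \<in> range ev"
proof -
  have "w ^ n = w ^ (m * (n div m) + n mod m)" by simp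
  also have "\<dots> = E (f ^ (n div m)) * w ^ (n mod m)"
    by (simp only: power_add power_mult w_pow E_power)
  finally have "E q * w ^ n = E (q * f ^ (n div m)) * w ^ (n mod m)" by (simp add: E_mult)
  also have "\<dots> \<in> range ev" using ev_single[of "n mod m"] m_pos by (metis mod_less_divisor rangeI)
  finally show ?thesis .
qed

lemma E_in_range_ev: "E q \<in> range ev"
  using E_w_pow_in_range_ev[of q 0] by simp

lemma w_pow_in_range_ev: "w ^ n \<in> range ev"
  using E_w_pow_in_range_ev[of 1 n] by simp

lemma is_subring_range_ev: "is_subring (range ev)"
proof -
  have diff: "a - b \<in> range ev" if "a \<in> range ev" "b \<in> range ev" for a b
    using that by (auto simp flip: ev_diff)
  have 0: "0 \<in> range ev" using E_in_range_ev[of 0] by simp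
  have add: "a + b \<in> range ev" if "a \<in> range ev" "b \<in> range ev" for a b
    using that by (auto simp flip: ev_add)
  have sum: "sum g I \<in> range ev" if "\<And>i. i \<in> I \<Longrightarrow> g i \<in> range ev" for g and I :: "nat set"
    using that by (induction I rule: infinite_finite_induct) (auto intro: 0 add)
  have "ev p * ev q \<in> range ev" for p q
  proof -
    have "ev p * ev q = (\<Sum>i<m. \<Sum>j<m. E (p i * q j) * w ^ (i + j))"
      unfolding ev_def sum_product by (intro sum.cong) (auto simp: E_mult power_add)
    then show ?thesis using E_w_pow_in_range_ev by (simp add: sum)
  qed
  then show ?thesis
    unfolding is_subring_def using diff E_in_range_ev[of 1] by auto
qed

lemma emb_in_range_ev: "\<iota> c \<in> range ev"
  using E_in_range_ev[of "[:c:]"] by simp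

end

section \<open>Residues and orders at a place of the Kummer extension\<close>

locale kummer_place = kummer \<iota> x f m w + ff_place "range \<iota>" "adjoin \<iota> {x, w}" P
  for \<iota> :: "'k::alg_closed_field \<Rightarrow> 'a::field" and x f m w P
begin

lemma emb_in_R: "\<iota> c \<in> R"
  using K_subset_R by blast

lemma emb_in_U: "c \<noteq> 0 \<Longrightarrow> \<iota> c \<in> U"
  unfolding mem_U_iff using emb_in_R[of c] emb_in_R[of "inverse c"] by (simp add: emb_inverse)

lemma emb_in_P_iff: "\<iota> c \<in> P \<longleftrightarrow> c = 0"
  using emb_in_U[of c] zero_in_P by auto

lemma E_in_R: "x \<in> R \<Longrightarrow> E p \<in> R"
  using R_subring K_subset_R by (rule E_in_subring)

lemma w_in_R: "x \<in> R \<Longrightarrow> w \<in> R"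
  using R_of_power[OF w_in_F, of m] E_in_R m_pos w_pow by simp

lemma ev_in_R: "x \<in> R \<Longrightarrow> ev p \<in> R"
  using ev_in_subring[OF R_subring K_subset_R] w_in_R by blast

text \<open>P is prime and p splits into linear factors, one of which must have its value in P.
  Applied to x and to w, this provides their residues in K.\<close>

lemma poly_root_in_place:
  assumes "z \<in> R" "p \<noteq> 0" "poly (map_poly \<iota> p) z \<in> P"
  shows "\<exists>b. poly p b = 0 \<and> z - \<iota> b \<in> P"
  using assms(2,3)
proof (induction "Polynomial.degree p" arbitrary: p)
  case 0
  then obtain c where "p = [:c:]" "c \<noteq> 0"
    by (metis degree_0_id degree_pCons_0 pCons_0_0)
  then show ?case using 0 emb_in_P_iff by (simp add: map_poly_pCons)
next
  case (Suc n)
  then obtain b where b: "poly p b = 0" using alg_closed_imp_poly_has_root[of p] by auto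
  then obtain q where q: "p = [:- b, 1:] * q" by (auto simp: poly_eq_0_iff_dvd)
  have "q \<noteq> 0" using q Suc.prems by auto
  then have "Polynomial.degree p = Suc (Polynomial.degree q)"
    unfolding q by (subst degree_mult_eq) auto
  then have deg: "n = Polynomial.degree q" using Suc by simp
  have "poly (map_poly \<iota> p) z = (z - \<iota> b) * poly (map_poly \<iota> q) z"
    unfolding q map_poly_emb_mult by (simp add: map_poly_pCons emb_uminus algebra_simps)
  moreover have "poly (map_poly \<iota> q) z \<in> R" "z - \<iota> b \<in> R"
    using assms(1) R_subring emb_in_R
    by (auto intro!: is_subring_poly is_subring_diff simp: coeff_map_poly)
  ultimately consider "z - \<iota> b \<in> P" | "poly (map_poly \<iota> q) z \<in> P"
    using P_prime Suc.prems by metis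
  then show ?case
  proof cases
    case 2
    then show ?thesis using Suc.hyps(1)[OF deg \<open>q \<noteq> 0\<close>] q by auto
  qed (use b in auto)
qed

lemma x_in_R: "x - \<iota> \<beta> \<in> P \<Longrightarrow> x \<in> R"
  using is_subring_add[OF R_subring _ emb_in_R[of \<beta>], of "x - \<iota> \<beta>"] P_subset_R by auto

lemma E_residue:
  assumes "x - \<iota> \<beta> \<in> P"
  shows "E p - \<iota> (poly p \<beta>) \<in> P"
proof (induction p)
  case (pCons c p)
  have "E (pCons c p) - \<iota> (poly (pCons c p) \<beta>) = (x - \<iota> \<beta>) * E p + \<iota> \<beta> * (E p - \<iota> (poly p \<beta>))"
    by (simp add: E_pCons emb_add emb_mult algebra_simps)
  then show ?case
    using P_add[OF P_mult[OF assms] P_mult'[OF emb_in_R pCons(2)]] E_in_R x_in_R[OF assms] by simp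
qed (simp add: zero_in_P)

lemma E_in_P_iff:
  assumes "x - \<iota> \<beta> \<in> P"
  shows "E p \<in> P \<longleftrightarrow> poly p \<beta> = 0"
proof -
  have "E p \<in> P \<longleftrightarrow> \<iota> (poly p \<beta>) \<in> P"
    using P_diff[of "E p" "E p - \<iota> (poly p \<beta>)"] P_add[of "E p - \<iota> (poly p \<beta>)" "\<iota> (poly p \<beta>)"]
      E_residue[OF assms, of p] by auto
  then show ?thesis by (simp add: emb_in_P_iff)
qed

lemma E_in_U:
  assumes "x - \<iota> \<beta> \<in> P" "poly p \<beta> \<noteq> 0"
  shows "E p \<in> U"
  using assms E_in_R x_in_R E_in_P_iff by blast

text \<open>Once the power of X - \<beta> is split off, the remaining factor has a nonzero residue
  and is a unit.\<close>

lemma hv_E: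
  assumes x: "x - \<iota> \<beta> \<in> P" and t: "t \<in> P" "t \<noteq> 0" and n: "has_val t (x - \<iota> \<beta>) n" and p: "p \<noteq> 0"
  shows "has_val t (E p) (n * int (Polynomial.order \<beta> p))"
proof -
  interpret ff_place_elt "range \<iota>" "adjoin \<iota> {x, w}" P t
    using t by unfold_locales
  obtain q where q: "p = [:- \<beta>, 1:] ^ Polynomial.order \<beta> p * q" "\<not> [:- \<beta>, 1:] dvd q"
    using order_decomp[OF p] by blast
  have "has_val t (E q) 0" using q(2) E_in_U[OF x] by (simp add: hv_0_iff poly_eq_0_iff_dvd)
  then have "has_val t ((x - \<iota> \<beta>) ^ Polynomial.order \<beta> p * E q) (int (Polynomial.order \<beta> p) * n + 0)"
    by (intro hv_mult hv_power n)
  moreover have "E p = (x - \<iota> \<beta>) ^ Polynomial.order \<beta> p * E q"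
    by (subst q(1)) (simp only: E_mult E_power E_linear)
  ultimately show ?thesis by (simp add: mult.commute)
qed

text \<open>
  Data of a totally ramified place: \<open>c\<close> is the value of \<open>w\<close>, and \<open>e\<close> the valuation of the place
  below on polynomials. The terms of \<open>ev p\<close> then have pairwise distinct valuations.
\<close>

definition totram :: "'a \<Rightarrow> int \<Rightarrow> ('k poly \<Rightarrow> int) \<Rightarrow> bool" where
  "totram t c e \<longleftrightarrow> t \<in> P \<and> t \<noteq> 0 \<and> has_val t w c \<and> coprime c (int m) \<and>
     (\<forall>p. p \<noteq> 0 \<longrightarrow> has_val t (E p) (int m * e p))"

lemma totram_hv_ev:
  assumes "totram t c e" and p: "i\<^sub>0 < m" "p i\<^sub>0 \<noteq> 0"
  obtains n where "has_val t (ev p) n" "\<And>i. i < m \<Longrightarrow> p i \<noteq> 0 \<Longrightarrow> n \<le> int m * e (p i) + c * int i"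
    "\<exists>i<m. p i \<noteq> 0 \<and> n = int m * e (p i) + c * int i"
proof -
  have t: "t \<in> P" "t \<noteq> 0" and c: "has_val t w c" "coprime c (int m)"
    and e: "\<And>p. p \<noteq> 0 \<Longrightarrow> has_val t (E p) (int m * e p)"
    using assms(1) unfolding totram_def by auto
  interpret ff_place_elt "range \<iota>" "adjoin \<iota> {x, w}" P t
    using t by unfold_locales
  define I where "I = {i. i < m \<and> p i \<noteq> 0}"
  define v where "v i = int m * e (p i) + c * int i" for i
  have I: "finite I" "I \<noteq> {}" unfolding I_def using p by auto
  have ev: "ev p = (\<Sum>i\<in>I. E (p i) * w ^ i)"
    unfolding ev_def I_def by (rule sum.mono_neutral_right) auto
  have "inj_on v I"
  proof (rule inj_onI)
    fix i j assume ij: "i \<in> I" "j \<in> I" "v i = v j"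
    then have "c * (int i - int j) = int m * (e (p j) - e (p i))"
      unfolding v_def by (simp add: algebra_simps)
    then have "int m dvd c * (int i - int j)" by simp
    then have "int m dvd int i - int j"
      using c(2) by (simp add: coprime_dvd_mult_right_iff coprime_commute)
    moreover have "\<bar>int i - int j\<bar> < int m" using ij unfolding I_def by auto
    ultimately show "i = j" using zdvd_imp_le[of "int m" "\<bar>int i - int j\<bar>"] by force
  qed
  moreover have "has_val t (E (p i) * w ^ i) (v i)" if "i \<in> I" for i
    using hv_mult[OF e hv_power[OF c(1)], of "p i" i] that
    unfolding I_def v_def by (simp add: mult.commute)
  ultimately have "has_val t (ev p) (Min (v ` I))" unfolding ev by (intro hv_sum I)
  moreover have "Min (v ` I) \<in> v ` I" using I by (intro Min_in) auto
  moreover have "Min (v ` I) \<le> v i" if "i \<in> I" for i using that I by (intro Min_le) auto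
  ultimately show ?thesis using that[of "Min (v ` I)"] unfolding I_def v_def by auto
qed

text \<open>The root \<gamma> is simple, so x - \<gamma> is w^m divided by a unit and has order m
  with respect to w.\<close>

lemma root_place_totram:
  assumes x: "x - \<iota> \<gamma> \<in> P" and root: "poly f \<gamma> = 0"
  shows "totram w 1 (\<lambda>p. int (Polynomial.order \<gamma> p))"
proof -
  have "w ^ m \<in> P" unfolding w_pow using E_in_P_iff[OF x] root by simp
  then have w: "w \<in> P" using P_power w_in_R x_in_R[OF x] by blast
  interpret ff_place_elt "range \<iota>" "adjoin \<iota> {x, w}" P w
    using w w_nz by unfold_locales
  obtain g where g: "f = [:- \<gamma>, 1:] ^ Polynomial.order \<gamma> f * g" "\<not> [:- \<gamma>, 1:] dvd g"
    using order_decomp[OF f_nz] by blast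
  have "Polynomial.order \<gamma> f = 1"
    using sqfree root f_nz order_root[of f \<gamma>] unfolding rsquarefree_def by metis
  then have "w ^ m = (x - \<iota> \<gamma>) * E g"
    unfolding w_pow by (subst g(1)) (simp only: E_mult E_linear power_one_right)
  moreover have Eg: "E g \<in> U" using E_in_U[OF x] g(2) by (simp add: poly_eq_0_iff_dvd)
  ultimately have "x - \<iota> \<gamma> = w ^ m / E g" unfolding mem_U_iff by simp
  then have "has_val w (x - \<iota> \<gamma>) (int m)"
    using hv_divide[OF hv_power[OF hv_self, of m] hv_unit[OF Eg]] by simp
  then show ?thesis
    unfolding totram_def using hv_self w w_nz hv_E[OF x w w_nz] by simp
qed

end

section \<open>The power basis over K(x) and places over points of the affine curve\<close>

context kummer
begin

text \<open>Independence of the powers of w over K[x]. At a place over a root of f the nonzero terms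
  have distinct orders, so the sum has an order and is not 0. The place is obtained by extension
  from K[x], because reading off coordinates in K[x, w] already presupposes this
  independence.\<close>

lemma ev_eq_0:
  assumes "ev p = 0" "i < m"
  shows "p i = 0"
proof (rule ccontr)
  assume pi: "p i \<noteq> 0"
  obtain \<gamma> where \<gamma>: "poly f \<gamma> = 0" using alg_closed_imp_poly_has_root deg_f by blast
  have "1 \<notin> ideal2 (E [:- \<gamma>, 1:]) (E [:- \<gamma>, 1:]) (range E)"
  proof
    assume "1 \<in> ideal2 (E [:- \<gamma>, 1:]) (E [:- \<gamma>, 1:]) (range E)"
    then obtain a b where "E 1 = E ([:- \<gamma>, 1:] * (a + b))"
      unfolding ideal2_def E_mult E_add distrib_left E_1 by blast
    then have "1 = [:- \<gamma>, 1:] * (a + b)" by (simp only: E_eq_iff)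
    then have "poly 1 \<gamma> = poly ([:- \<gamma>, 1:] * (a + b)) \<gamma>" by (simp only:)
    then show False by simp
  qed
  moreover have "range E \<subseteq> F" using E_in_F by auto
  ultimately obtain P where P: "P \<in> places (range \<iota>) F" "E [:- \<gamma>, 1:] \<in> P"
    using place_extension[OF F_subfield is_subfield_range range_emb_subset_range_E
      is_subring_range_E _ rangeI _ rangeI, of "[:- \<gamma>, 1:]" "[:- \<gamma>, 1:]"]
      E_eq_0_iff[of "[:- \<gamma>, 1:]"] by (metis pCons_eq_0_iff one_neq_zero)
  interpret kummer_place \<iota> x f m w P
    by unfold_locales (use F_subfield P in auto)
  have x: "x - \<iota> \<gamma> \<in> P" using P(2) by (simp only: E_linear)
  note t = root_place_totram[OF x \<gamma>]
  interpret ff_place_elt "range \<iota>" "adjoin \<iota> {x, w}" P w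
    using t unfolding totram_def by unfold_locales auto
  obtain n where "has_val w (ev p) n"
    using totram_hv_ev[where p = p, OF t assms(2) pi] by blast
  then show False using hv_nz assms(1) by blast
qed

lemma ev_inj: "ev p = ev q \<Longrightarrow> i < m \<Longrightarrow> p i = q i"
  using ev_eq_0[of "\<lambda>i. p i - q i"] by (simp add: ev_diff)

lemma common_denominator:
  fixes c :: "nat \<Rightarrow> 'k poly fract"
  obtains p q where "q \<noteq> 0" "\<forall>i<m. c i = Fract (p i) q"
    "(\<Sum>i<m. frac_emb (c i) * w ^ i) = ev p / E q"
proof -
  have "\<forall>i. \<exists>a b. b \<noteq> 0 \<and> c i = Fract a b" by (metis Fract_cases)
  then obtain a b where ab: "\<And>i. b i \<noteq> 0" "\<And>i. c i = Fract (a i) (b i)" by metis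
  define q where "q = (\<Prod>i<m. b i)"
  define p where "p i = a i * (\<Prod>j\<in>{..<m} - {i}. b j)" for i
  have q: "q \<noteq> 0" unfolding q_def using ab(1) by simp
  have c: "c i = Fract (p i) q" if "i < m" for i
  proof -
    have "q = b i * (\<Prod>j\<in>{..<m} - {i}. b j)"
      unfolding q_def using that by (intro prod.remove) auto
    then show ?thesis unfolding ab(2) p_def using ab(1) q by (subst eq_fract) auto
  qed
  have "(\<Sum>i<m. frac_emb (c i) * w ^ i) = (\<Sum>i<m. E (p i) * w ^ i / E q)"
    by (intro sum.cong) (auto simp: c frac_emb_Fract q)
  also have "\<dots> = ev p / E q" unfolding ev_def by (simp add: sum_divide_distrib)
  finally show ?thesis using that q c by blast
qed

lemma Kx_basis:
  defines "W \<equiv> (\<lambda>i. w ^ i) ` {..<m}"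
  shows card_basis: "card W = m" and independent_basis: "fr.vs.independent W"
    and span_basis: "fr.vs.span W = {ev p / E q | p q. q \<noteq> 0}"
proof -
  have inj: "inj_on (\<lambda>i. w ^ i) {..<m}"
  proof (rule inj_onI, rule ccontr)
    fix i j assume ij: "i \<in> {..<m}" "j \<in> {..<m}" "w ^ i = w ^ j" "i \<noteq> j"
    have "ev (\<lambda>k. if k = i then 1 else 0) = ev (\<lambda>k. if k = j then 1 else 0)"
      using ij by (simp add: ev_single)
    from ev_inj[OF this, of i] ij show False by simp
  qed
  then show "card W = m" unfolding W_def by (simp add: card_image)
  show "fr.vs.independent W"
    unfolding W_def
  proof (rule fr.independent_imageI[OF _ inj])
    fix c assume 0: "(\<Sum>i<m. frac_emb (c i) * w ^ i) = 0"
    obtain p q where pq: "q \<noteq> 0" "\<forall>i<m. c i = Fract (p i) q"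
      "(\<Sum>i<m. frac_emb (c i) * w ^ i) = ev p / E q" using common_denominator[of c] by blast
    then have "ev p = 0" using 0 by simp
    then show "\<forall>i\<in>{..<m}. c i = 0"
      using pq(1,2) ev_eq_0[of p] by (auto simp: fract_collapse)
  qed auto
  show "fr.vs.span W = {ev p / E q | p q. q \<noteq> 0}"
  proof (intro equalityI subsetI)
    fix z assume "z \<in> fr.vs.span W"
    then obtain c where "z = (\<Sum>b\<in>W. frac_emb (c b) * b)"
      using fr.vs.span_finite[of W] unfolding W_def by auto
    then have z: "z = (\<Sum>i<m. frac_emb (c (w ^ i)) * w ^ i)"
      unfolding W_def by (simp add: sum.reindex[OF inj])
    obtain p q where "q \<noteq> 0" "z = ev p / E q"
      unfolding z by (rule common_denominator[of "\<lambda>i. c (w ^ i)"])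
    then show "z \<in> {ev p / E q | p q. q \<noteq> 0}" by blast
  next
    fix z assume "z \<in> {ev p / E q | p q. q \<noteq> 0}"
    then obtain p q where z: "z = ev p / E q" "q \<noteq> 0" by blast
    have "z = (\<Sum>i<m. frac_emb (Fract (p i) q) * w ^ i)"
      unfolding z(1) ev_def by (simp add: frac_emb_Fract z(2) sum_divide_distrib)
    also have "\<dots> \<in> fr.vs.span W"
      unfolding W_def by (intro fr.vs.span_sum fr.vs.span_scale fr.vs.span_base) auto
    finally show "z \<in> fr.vs.span W" .
  qed
qed

text \<open>The span is a ring of finite dimension over the field K(x) and without zero divisors,
  hence a field containing the generators of F.\<close>

lemma F_eq_span: "F = fr.vs.span ((\<lambda>i. w ^ i) ` {..<m})"
proof
  let ?S = "{ev p / E q | p q. q \<noteq> 0}"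
  have sub: "range ev \<subseteq> ?S" using E_1 by (force intro: exI[of _ 1])
  have mult: "a * b \<in> ?S" if "a \<in> ?S" "b \<in> ?S" for a b
  proof -
    obtain p q p' q' where a: "a = ev p / E q" "q \<noteq> 0" and b: "b = ev p' / E q'" "q' \<noteq> 0"
      using \<open>a \<in> ?S\<close> \<open>b \<in> ?S\<close> by auto
    obtain p'' where "ev p * ev p' = ev p''" using is_subring_mult[OF is_subring_range_ev] by blast
    then have "a * b = ev p'' / E (q * q')" "q * q' \<noteq> 0" using a b by (auto simp: E_mult)
    then show ?thesis by blast
  qed
  have "1 \<in> ?S" using sub is_subring_one[OF is_subring_range_ev] by blast
  then have "is_subfield ?S"
    using fr.is_subfield_span[of "(\<lambda>i. w ^ i) ` {..<m}"] independent_basis mult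
    unfolding span_basis by blast
  moreover have "range \<iota> \<union> {x, w} \<subseteq> range ev"
    using emb_in_range_ev E_in_range_ev[of "[:0, 1:]"] w_pow_in_range_ev[of 1]
    by (auto simp: E_pCons)
  then have "range \<iota> \<union> {x, w} \<subseteq> ?S" using sub by (rule subset_trans)
  ultimately show "F \<subseteq> fr.vs.span ((\<lambda>i. w ^ i) ` {..<m})"
    unfolding span_basis by (rule adjoin_minimal)
  show "fr.vs.span ((\<lambda>i. w ^ i) ` {..<m}) \<subseteq> F"
    unfolding span_basis using is_subfield_divide[OF F_subfield ev_in_F E_in_F] by blast
qed

lemma F_eq: "F = {ev p / E q | p q. q \<noteq> 0}"
  using F_eq_span span_basis by simp

lemma extension_degree_F: "extension_degree Kx F = m"
  using fr.extension_degree_eq[OF _ independent_basis] card_basis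
  unfolding F_eq_span range_frac_emb by simp

text \<open>The residue of \<open>ev p\<close> when \<open>x\<close> and \<open>w\<close> have residues \<open>\<beta>\<close> and \<open>b\<close>.\<close>

definition res :: "'k \<Rightarrow> 'k \<Rightarrow> (nat \<Rightarrow> 'k poly) \<Rightarrow> 'k" where
  "res \<beta> b p = (\<Sum>i<m. poly (p i) \<beta> * b ^ i)"

text \<open>Taking residues of coordinates maps the ideal of the point (\<beta>, b) to 0 but 1 to 1,
  so this ideal is proper and extends to a place.\<close>

lemma place_over_exists:
  assumes b: "b ^ m = poly f \<beta>"
  obtains P where "P \<in> places (range \<iota>) F" "x - \<iota> \<beta> \<in> P" "w - \<iota> b \<in> P"
proof -
  let ?res = "res \<beta> b"
  have "1 \<notin> ideal2 (x - \<iota> \<beta>) (w - \<iota> b) (range ev)"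
  proof
    assume "1 \<in> ideal2 (x - \<iota> \<beta>) (w - \<iota> b) (range ev)"
    then obtain p q where 1: "1 = (x - \<iota> \<beta>) * ev p + (w - \<iota> b) * ev q"
      unfolding ideal2_def by blast
    \<comment> \<open>Coordinates of (x - \<beta>) * ev p, w * ev q and b * ev q. Multiplication by
      w shifts the coordinates of q, and the top one returns to position 0 with a factor f. On
      residues this is multiplication by b, since b^m = f(\<beta>).\<close>
    define p' where "p' i = [:- \<beta>, 1:] * p i" for i
    define q\<^sub>1 where "q\<^sub>1 i = (if i = 0 then f * q (m - 1) else q (i - 1))" for i
    define q\<^sub>2 where "q\<^sub>2 i = [:b:] * q i" for i
    obtain n where n: "m = Suc n" using m_pos by (cases m) auto
    have "w * ev q = (\<Sum>i<n. E (q i) * w ^ Suc i) + E (q n) * E f"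
      unfolding ev_def unfolding n
      by (simp add: distrib_left sum_distrib_left algebra_simps flip: w_pow[unfolded n])
    also have "\<dots> = ev q\<^sub>1"
      unfolding ev_def unfolding n sum.lessThan_Suc_shift q\<^sub>1_def by (simp add: E_mult algebra_simps)
    finally have "1 = ev p' + (ev q\<^sub>1 - ev q\<^sub>2)"
      unfolding 1 p'_def q\<^sub>2_def ev_smult E_linear E_const by (simp add: algebra_simps)
    then have "ev (\<lambda>i. if i = 0 then 1 else 0) = ev (\<lambda>i. p' i + (q\<^sub>1 i - q\<^sub>2 i))"
      by (simp add: ev_single m_pos ev_add ev_diff)
    from ev_inj[OF this]
    have "?res (\<lambda>i. if i = 0 then 1 else 0) = ?res (\<lambda>i. p' i + (q\<^sub>1 i - q\<^sub>2 i))"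
      unfolding res_def by (intro sum.cong) auto
    moreover have "?res (\<lambda>i. if i = 0 then 1 else 0) = 1"
      unfolding res_def unfolding n sum.lessThan_Suc_shift by simp
    moreover have "?res (\<lambda>i. p' i + (q\<^sub>1 i - q\<^sub>2 i)) = ?res p' + (?res q\<^sub>1 - ?res q\<^sub>2)"
      unfolding res_def by (simp add: sum.distrib sum_subtractf algebra_simps)
    moreover have "?res p' = 0" unfolding res_def p'_def by simp
    moreover have "?res q\<^sub>1 = ?res q\<^sub>2"
    proof -
      have "?res q\<^sub>1 = b ^ m * poly (q n) \<beta> + (\<Sum>i<n. poly (q i) \<beta> * b ^ Suc i)"
        unfolding res_def unfolding n sum.lessThan_Suc_shift q\<^sub>1_def by (simp add: b[symmetric, unfolded n])
      also have "\<dots> = ?res q\<^sub>2"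
        unfolding res_def unfolding q\<^sub>2_def n by (simp add: algebra_simps)
      finally show ?thesis .
    qed
    ultimately show False by simp
  qed
  moreover have "range ev \<subseteq> F" using ev_in_F by auto
  moreover have "range \<iota> \<subseteq> range ev" using emb_in_range_ev by auto
  moreover have "x - \<iota> \<beta> \<in> range ev" "w - \<iota> b \<in> range ev"
    using E_in_range_ev[of "[:- \<beta>, 1:]"] w_pow_in_range_ev[of 1] emb_in_range_ev[of b]
      is_subring_diff[OF is_subring_range_ev] by (auto simp: E_linear)
  moreover have "x - \<iota> \<beta> \<noteq> 0" unfolding E_linear[symmetric] E_eq_0_iff by simp
  ultimately show ?thesis
    using place_extension[OF F_subfield is_subfield_range _ is_subring_range_ev,
        of "x - \<iota> \<beta>" "w - \<iota> b"] that by blast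
qed

end

section \<open>Classification of the places and their uniformizers\<close>

context kummer_place
begin

lemma totram_divide:
  assumes t: "totram t c e" and z: "ev p / E q \<noteq> 0"
  obtains n where "has_val t (ev p / E q) n"
    "\<And>i. i < m \<Longrightarrow> p i \<noteq> 0 \<Longrightarrow> n \<le> int m * (e (p i) - e q) + c * int i"
    "\<exists>i<m. p i \<noteq> 0 \<and> n = int m * (e (p i) - e q) + c * int i"
proof -
  interpret ff_place_elt "range \<iota>" "adjoin \<iota> {x, w}" P t
    using t unfolding totram_def by unfold_locales auto
  have q: "q \<noteq> 0" using z by auto
  obtain i where i: "i < m" "p i \<noteq> 0"
    using z unfolding ev_def by (metis (no_types, lifting) E_0 div_0 lessThan_iff mult_zero_left sum.neutral)
  obtain n where n: "has_val t (ev p) n" "\<And>i. i < m \<Longrightarrow> p i \<noteq> 0 \<Longrightarrow> n \<le> int m * e (p i) + c * int i"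
    "\<exists>i<m. p i \<noteq> 0 \<and> n = int m * e (p i) + c * int i"
    using totram_hv_ev[where p = p, OF t i] by blast
  have "has_val t (E q) (int m * e q)" using t q unfolding totram_def by blast
  then have "has_val t (ev p / E q) (n - int m * e q)" using n(1) by (intro hv_divide)
  then show ?thesis
    by (rule that) (use n(2,3) in \<open>auto simp: algebra_simps\<close>)
qed

lemma totram_discrete:
  assumes "totram t c e"
  shows "discrete_at t"
  unfolding discrete_at_def
proof (intro conjI ballI)
  fix z assume "z \<in> F - {0}"
  then obtain p q where "z = ev p / E q" "z \<noteq> 0" unfolding F_eq by blast
  then show "\<exists>n. has_val t z n" using totram_divide[OF assms] by metis
qed (use assms in \<open>auto simp: totram_def\<close>)

lemma totram_val:
  assumes t: "totram t c e" and z: "ev p / E q \<noteq> 0"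
  shows totram_val_le: "i < m \<Longrightarrow> p i \<noteq> 0 \<Longrightarrow>
      val F P (ev p / E q) \<le> int m * (e (p i) - e q) + c * int i"
    and totram_val_attained: "\<exists>i<m. p i \<noteq> 0 \<and>
      val F P (ev p / E q) = int m * (e (p i) - e q) + c * int i"
proof -
  interpret ff_place_elt "range \<iota>" "adjoin \<iota> {x, w}" P t
    using t unfolding totram_def by unfold_locales auto
  obtain n where n: "has_val t (ev p / E q) n"
    "\<And>i. i < m \<Longrightarrow> p i \<noteq> 0 \<Longrightarrow> n \<le> int m * (e (p i) - e q) + c * int i"
    "\<exists>i<m. p i \<noteq> 0 \<and> n = int m * (e (p i) - e q) + c * int i"
    using totram_divide[OF t z] by blast
  have "val F P (ev p / E q) = n" using val_eq[OF totram_discrete[OF t] n(1)] .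
  then show "i < m \<Longrightarrow> p i \<noteq> 0 \<Longrightarrow>
      val F P (ev p / E q) \<le> int m * (e (p i) - e q) + c * int i"
    "\<exists>i<m. p i \<noteq> 0 \<and> val F P (ev p / E q) = int m * (e (p i) - e q) + c * int i"
    using n by auto
qed

lemma totram_mem_R:
  assumes t: "totram t c e" and q: "q \<noteq> 0"
  shows "ev p / E q \<in> R \<longleftrightarrow> (\<forall>i<m. p i \<noteq> 0 \<longrightarrow> int m * (e (p i) - e q) + c * int i \<ge> 0)"
proof (cases "ev p / E q = 0")
  case True
  then have "p i = 0" if "i < m" for i using ev_eq_0[of p i] q that by simp
  then show ?thesis using True R_subring is_subring_zero by auto
next
  case False
  interpret ff_place_elt "range \<iota>" "adjoin \<iota> {x, w}" P t
    using t unfolding totram_def by unfold_locales auto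
  have "ev p / E q \<in> F" using q unfolding F_eq by blast
  then have iff: "ev p / E q \<in> R \<longleftrightarrow> val F P (ev p / E q) \<ge> 0"
    using val_nonneg_iff[OF totram_discrete[OF t]] False by simp
  show ?thesis
  proof
    assume "ev p / E q \<in> R"
    then show "\<forall>i<m. p i \<noteq> 0 \<longrightarrow> int m * (e (p i) - e q) + c * int i \<ge> 0"
      using totram_val_le[OF t False] iff by (meson order_trans)
  next
    assume "\<forall>i<m. p i \<noteq> 0 \<longrightarrow> int m * (e (p i) - e q) + c * int i \<ge> 0"
    then show "ev p / E q \<in> R" using totram_val_attained[OF t False] iff by auto
  qed
qed

text \<open>\<open>totram_mem_R\<close> describes the ring in terms of c and e alone, whatever t is,
  and a place is determined by its ring.\<close>

lemma totram_unique:
  assumes t: "totram t c e" and P': "kummer_place \<iota> x f m w P'" "kummer_place.totram \<iota> x m w P' t' c e"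
  shows "P' = P"
proof -
  interpret P': kummer_place \<iota> x f m w P' by fact
  have "z \<in> R \<longleftrightarrow> z \<in> P'.R" if zF: "z \<in> F" for z
  proof -
    obtain p q where "z = ev p / E q" "q \<noteq> 0" using zF unfolding F_eq by blast
    then show ?thesis using totram_mem_R[OF t] P'.totram_mem_R[OF P'(2)] by simp
  qed
  then have eq: "R = P'.R" using R_subset_F P'.R_subset_F by blast
  have "z \<in> P' \<longleftrightarrow> z \<in> P" for z
    unfolding mem_P_iff[of z] P'.mem_P_iff[of z] eq ..
  then show ?thesis by blast
qed

lemma finite_place:
  assumes x: "x \<in> R"
  obtains \<beta> b where "x - \<iota> \<beta> \<in> P" "w - \<iota> b \<in> P" "b ^ m = poly f \<beta>"
proof -
  \<comment> \<open>Otherwise all denominators would be units at P and R would be the whole of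
    F.\<close>
  have "\<exists>q. q \<noteq> 0 \<and> E q \<in> P"
  proof (rule ccontr)
    assume *: "\<not> (\<exists>q. q \<noteq> 0 \<and> E q \<in> P)"
    have "F \<subseteq> R"
    proof
      fix z assume "z \<in> F"
      then obtain p q where z: "z = ev p / E q" "q \<noteq> 0" unfolding F_eq by blast
      then have "E q \<in> U" using * E_in_R[OF x] by blast
      then have "inverse (E q) \<in> R" using mem_U_iff by blast
      then show "z \<in> R"
        unfolding z divide_inverse using ev_in_R[OF x] R_subring by (intro is_subring_mult)
    qed
    then show False using R_subset_F R_neq_F by blast
  qed
  then obtain \<beta> where \<beta>: "x - \<iota> \<beta> \<in> P" using poly_root_in_place[OF x] unfolding E_def by blast
  \<comment> \<open>Modulo P the element w is a root of X^m - f(\<beta>), so its residue is one of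
    the m-th roots of f(\<beta>).\<close>
  define g where "g = Polynomial.monom 1 m - [:poly f \<beta>:]"
  have "Polynomial.coeff g m = 1"
    unfolding g_def using m_pos by (simp add: coeff_pCons split: nat.split)
  then have "g \<noteq> 0" by auto
  moreover have "poly (map_poly \<iota> g) w = E f - \<iota> (poly f \<beta>)"
    unfolding g_def map_poly_emb_diff using w_pow
    by (simp add: map_poly_monom poly_monom map_poly_pCons)
  ultimately obtain b where "poly g b = 0" "w - \<iota> b \<in> P"
    using poly_root_in_place[OF w_in_R[OF x], of g] E_residue[OF \<beta>, of f] by auto
  then show ?thesis using that[OF \<beta>] by (simp add: g_def poly_monom)
qed

lemma ev_diff_res:
  "ev p - \<iota> (res \<beta> b p) \<in> ideal2 (x - \<iota> \<beta>) (w - \<iota> b) (range ev)" (is "_ \<in> ?J")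
proof -
  note A = is_subring_range_ev
  have mem: "x - \<iota> \<beta> \<in> ?J" "w - \<iota> b \<in> ?J"
    using ideal2_generators[OF A] by auto
  have 1: "E p - \<iota> (poly p \<beta>) \<in> ?J" for p
  proof (induction p)
    case (pCons c p)
    have "E (pCons c p) - \<iota> (poly (pCons c p) \<beta>) = E p * (x - \<iota> \<beta>) + \<iota> \<beta> * (E p - \<iota> (poly p \<beta>))"
      by (simp add: E_pCons emb_add emb_mult algebra_simps)
    then show ?case
      using ideal2_add[OF A ideal2_mult[OF A mem(1) E_in_range_ev]
        ideal2_mult[OF A pCons(2) emb_in_range_ev]] by simp
  qed (simp add: ideal2_zero[OF A])
  have 2: "w ^ i - \<iota> (b ^ i) \<in> ?J" for i
  proof (induction i)
    case (Suc i)
    have "w ^ Suc i - \<iota> (b ^ Suc i) = w ^ 1 * (w ^ i - \<iota> (b ^ i)) + \<iota> (b ^ i) * (w - \<iota> b)" (is "_ = ?s")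
      by (simp add: emb_mult algebra_simps)
    moreover have "?s \<in> ?J"
      by (intro ideal2_add[OF A] ideal2_mult[OF A] Suc mem(2) w_pow_in_range_ev emb_in_range_ev)
    ultimately show ?case by (simp only:)
  qed (simp add: ideal2_zero[OF A])
  have "E (p i) * w ^ i - \<iota> (poly (p i) \<beta> * b ^ i) \<in> ?J" for i
  proof -
    have "E (p i) * w ^ i - \<iota> (poly (p i) \<beta> * b ^ i) =
      w ^ i * (E (p i) - \<iota> (poly (p i) \<beta>)) + \<iota> (poly (p i) \<beta>) * (w ^ i - \<iota> (b ^ i))"
      by (simp add: emb_mult algebra_simps)
    then show ?thesis
      using ideal2_add[OF A ideal2_mult[OF A 1 w_pow_in_range_ev]
        ideal2_mult[OF A 2 emb_in_range_ev]] by simp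
  qed
  then have "(\<Sum>i\<in>I. E (p i) * w ^ i - \<iota> (poly (p i) \<beta> * b ^ i)) \<in> ?J" for I
    by (induction I rule: infinite_finite_induct) (auto intro: ideal2_zero[OF A] ideal2_add[OF A])
  then show ?thesis unfolding ev_def res_def emb_sum sum_subtractf[symmetric] .
qed

lemma ev_in_P_iff:
  assumes "x - \<iota> \<beta> \<in> P" "w - \<iota> b \<in> P"
  shows "ev p \<in> P \<longleftrightarrow> res \<beta> b p = 0"
proof -
  have "range ev \<subseteq> R" using ev_in_R x_in_R[OF assms(1)] by blast
  then have "ideal2 (x - \<iota> \<beta>) (w - \<iota> b) (range ev) \<subseteq> P"
    unfolding ideal2_def using assms by (auto intro!: P_add P_mult)
  then have *: "ev p - \<iota> (res \<beta> b p) \<in> P" using ev_diff_res by blast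
  then have "ev p \<in> P \<longleftrightarrow> \<iota> (res \<beta> b p) \<in> P"
    using P_diff[of "ev p" "ev p - \<iota> (res \<beta> b p)"] P_add[OF *, of "\<iota> (res \<beta> b p)"] by auto
  then show ?thesis by (simp add: emb_in_P_iff)
qed

text \<open>
  In the local ring of the curve at \<open>(\<beta>, b)\<close> the maximal ideal is generated by \<open>x - \<iota> \<beta>\<close>, because
  \<open>(w - \<iota> b) * (w\<^sup>m\<^sup>-\<^sup>1 + \<dots> + \<iota> b\<^sup>m\<^sup>-\<^sup>1) = f(x) - f(\<beta>)\<close>, where the second factor is a unit.
\<close>

lemma unramified_divide:
  assumes x: "x - \<iota> \<beta> \<in> P" and w: "w - \<iota> b \<in> P" and b: "b ^ m = poly f \<beta>" "b \<noteq> 0"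
    and a: "a \<in> range ev" "a \<in> P"
  shows "\<exists>a'\<in>range ev. \<exists>s\<in>range ev. s \<notin> P \<and> a = (x - \<iota> \<beta>) * (a' / s)"
proof -
  note A = is_subring_range_ev
  obtain p where p: "a = ev p" using a(1) by blast
  have "a \<in> ideal2 (x - \<iota> \<beta>) (w - \<iota> b) (range ev)"
    using ev_diff_res[of p \<beta> b] ev_in_P_iff[OF x w] a(2) p by simp
  then obtain c d where cd: "a = (x - \<iota> \<beta>) * c + (w - \<iota> b) * d" "c \<in> range ev" "d \<in> range ev"
    unfolding ideal2_def by blast
  \<comment> \<open>The cofactor of w - b in w^m - b^m. Its residue is m b^(m-1), which is nonzero
    because the characteristic does not divide m.\<close>
  define s where "s = ev (\<lambda>i. [:b ^ (m - Suc i):])"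
  have "res \<beta> b (\<lambda>i. [:b ^ (m - Suc i):]) = (\<Sum>i<m. b ^ (m - 1))"
    unfolding res_def by (intro sum.cong) (auto simp flip: power_add)
  also have "\<dots> \<noteq> 0" using b(2) char_m by simp
  finally have s: "s \<notin> P" unfolding s_def using ev_in_P_iff[OF x w] by simp
  then have "s \<noteq> 0" using zero_in_P by metis
  have "s = (\<Sum>i<m. \<iota> b ^ (m - Suc i) * w ^ i)" unfolding s_def ev_def by (simp add: emb_power)
  then have "(w - \<iota> b) * s = E (f - [:poly f \<beta>:])"
    using power_diff_sumr2[of w m "\<iota> b"] w_pow b(1) by (simp add: E_diff emb_power[symmetric])
  moreover obtain g where "f - [:poly f \<beta>:] = [:- \<beta>, 1:] * g"
    using poly_eq_0_iff_dvd[of "f - [:poly f \<beta>:]" \<beta>] by auto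
  ultimately have ws: "(w - \<iota> b) * s = (x - \<iota> \<beta>) * E g" by (simp only: E_mult E_linear)
  have "a * s = (x - \<iota> \<beta>) * (c * s) + ((w - \<iota> b) * s) * d" unfolding cd(1) by (simp add: algebra_simps)
  then have "a * s = (x - \<iota> \<beta>) * (c * s + E g * d)" unfolding ws by (simp add: algebra_simps)
  then have "a = (x - \<iota> \<beta>) * ((c * s + E g * d) / s)" using \<open>s \<noteq> 0\<close> by (simp add: field_simps)
  moreover have "s \<in> range ev" unfolding s_def by blast
  moreover from this have "c * s + E g * d \<in> range ev"
    using cd(2,3) E_in_range_ev by (intro is_subring_add[OF A] is_subring_mult[OF A])
  ultimately show ?thesis using s by blast
qed

text \<open>The order of an element is found by splitting off factors x - \<beta> with
  \<open>unramified_divide\<close> until a unit remains. What needs an argument is that this process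
  stops.\<close>

lemma unramified_discrete:
  assumes x: "x - \<iota> \<beta> \<in> P" and w: "w - \<iota> b \<in> P" and b: "b ^ m = poly f \<beta>" "b \<noteq> 0"
  shows "discrete_at (x - \<iota> \<beta>)"
proof -
  note A = is_subring_range_ev
  let ?t = "x - \<iota> \<beta>"
  have t: "?t \<in> P" "?t \<noteq> 0" using x unfolding E_linear[symmetric] E_eq_0_iff by auto
  interpret ff_place_elt "range \<iota>" "adjoin \<iota> {x, w}" P ?t
    using t by unfold_locales
  note evR = ev_in_R[OF x_in_R[OF x]]
  \<comment> \<open>The last assumption says that a / s has order at most j, which bounds the number
    of factors x - \<beta> that can be split off.\<close>
  have *: "\<exists>n. has_val ?t (a / s) n"
    if "a \<in> range ev" "s \<in> range ev" "s \<notin> P" "a \<noteq> 0" "?t ^ j * (s / a) \<in> R" for a s j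
    using that
  proof (induction j arbitrary: a s)
    case (0 a s)
    have "a \<in> R" "s \<in> U" using 0 evR by auto
    have "(s / a) * a \<in> P" if "a \<in> P" using that 0 by (intro P_mult') auto
    then have "a \<in> U" using \<open>a \<in> R\<close> \<open>s \<in> U\<close> 0 by auto
    then show ?case using U_divide \<open>s \<in> U\<close> hv_unit by blast
  next
    case (Suc j a s)
    have "a \<in> R" "s \<in> U" using Suc.prems evR by auto
    show ?case
    proof (cases "a \<in> P")
      case False
      then have "a \<in> U" using \<open>a \<in> R\<close> by auto
      then show ?thesis using U_divide \<open>s \<in> U\<close> hv_unit by blast
    next
      case True
      then obtain a' s' where a': "a' \<in> range ev" "s' \<in> range ev" "s' \<notin> P" "a = ?t * (a' / s')"
        using unramified_divide[OF x w b Suc.prems(1)] by blast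
      have nz: "s' \<noteq> 0" "a' \<noteq> 0" "s \<noteq> 0" using a' Suc.prems zero_in_P by auto
      have "s * s' \<in> range ev" using Suc.prems a' by (intro is_subring_mult[OF A])
      moreover have "s * s' \<notin> P" using U_mult[of s s'] a' evR \<open>s \<in> U\<close> by auto
      moreover have "?t ^ j * (s * s' / a') \<in> R"
        using Suc.prems(5) a'(4) nz t(2) by simp
      ultimately have "\<exists>n. has_val ?t (a' / (s * s')) n"
        using Suc.IH[of a' "s * s'"] a' nz by blast
      moreover have "a / s = ?t * (a' / (s * s'))" using a'(4) nz by simp
      ultimately show ?thesis using hv_mult[OF hv_self] by metis
    qed
  qed
  \<comment> \<open>The reciprocal of \<open>ev p\<close> has a denominator \<open>E q\<close>, and
    the multiplicity of \<beta> in q bounds the order of \<open>ev p\<close>.\<close>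
  have ev: "\<exists>n. has_val ?t (ev p) n" if "ev p \<noteq> 0" for p
  proof -
    have "inverse (ev p) \<in> F" using ev_in_F F_subfield is_subfield_inverse by blast
    then obtain p' q where p': "inverse (ev p) = ev p' / E q" "q \<noteq> 0" unfolding F_eq by blast
    define j where "j = Polynomial.order \<beta> q"
    have "has_val ?t (E q) (int j)" unfolding j_def using hv_E[OF x t hv_self p'(2)] by simp
    then have "inverse (E q / ?t ^ j) \<in> R" unfolding has_val_def using mem_U_iff by simp
    then have "inverse (E q / ?t ^ j) * ev p' \<in> R" using evR R_subring by (intro is_subring_mult)
    moreover have "?t ^ j * (1 / ev p) = inverse (E q / ?t ^ j) * ev p'"
      using p' by (simp add: inverse_eq_divide)
    ultimately have "\<exists>n. has_val ?t (ev p / 1) n"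
      using that one_notin_P by (intro *[of _ 1 j]) (auto intro: is_subring_one[OF A])
    then show ?thesis by simp
  qed
  show ?thesis
    unfolding discrete_at_def
  proof (intro conjI ballI t)
    fix z assume "z \<in> F - {0}"
    then obtain p q where z: "z = ev p / E q" "q \<noteq> 0" "ev p \<noteq> 0" unfolding F_eq by auto
    then show "\<exists>n. has_val ?t z n"
      using ev[of p] hv_divide hv_E[OF x t hv_self z(2)] by blast
  qed
qed

text \<open>x has a pole, so after division by the leading power of x all lower terms are in
  P.\<close>

lemma hv_E_infinity:
  assumes x: "x \<notin> R" and p: "p \<noteq> 0"
  shows "E p / x ^ Polynomial.degree p \<in> U"
  using p
proof (induction p)
  case (pCons c p)
  have x': "inverse x \<in> P" using not_R_imp[OF x_in_F x] .
  have "x \<noteq> 0" using x R_subring is_subring_zero by metis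
  show ?case
  proof (cases "p = 0")
    case True
    then show ?thesis using pCons emb_in_U by simp
  next
    case False
    have "inverse x ^ Suc (Polynomial.degree p) * \<iota> c \<in> P"
      using x' emb_in_R by (intro P_mult P_power_pos) auto
    then have "E p / x ^ Polynomial.degree p + inverse x ^ Suc (Polynomial.degree p) * \<iota> c \<in> U"
      using pCons False by (intro U_add_P) auto
    moreover have "inverse x ^ Suc (Polynomial.degree p) * \<iota> c = \<iota> c / x ^ Suc (Polynomial.degree p)"
      by (simp only: power_inverse divide_inverse mult.commute)
    then have "E (pCons c p) / x ^ Polynomial.degree (pCons c p) =
      E p / x ^ Polynomial.degree p + inverse x ^ Suc (Polynomial.degree p) * \<iota> c"
      using False \<open>x \<noteq> 0\<close> by (simp add: E_pCons add_divide_distrib)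
    ultimately show ?thesis by simp
  qed
qed simp

lemma infinite_place_totram:
  assumes x: "x \<notin> R"
  obtains t where "totram t (- int (Polynomial.degree f)) (\<lambda>p. - int (Polynomial.degree p))"
proof -
  let ?r = "Polynomial.degree f"
  have x': "inverse x \<in> P" using not_R_imp[OF x_in_F x] .
  have "x \<noteq> 0" using x R_subring is_subring_zero by metis
  obtain u v where uv: "u * int m + v * int ?r = 1"
    using bezout_int[of "int m" "int ?r"] coprime_m by (auto simp: coprime_iff_gcd_eq_1)
  define t where "t = x powi (- u) * w powi (- v)"
  have "t \<noteq> 0" unfolding t_def using \<open>x \<noteq> 0\<close> w_nz by simp
  have tF: "t \<in> F"
    unfolding t_def by (intro is_subring_mult F_subring is_subfield_powi F_subfield x_in_F w_in_F)
  define \<epsilon> where "\<epsilon> = (E f / x ^ ?r) powi (- v)"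
  have \<epsilon>: "\<epsilon> \<in> U" unfolding \<epsilon>_def using hv_E_infinity[OF x f_nz] by (rule U_powi)
  have pow: "(a ^ k) powi i = a powi (i * int k)" "(a powi i) ^ k = a powi (i * int k)" for a :: 'a and i k
    using power_int_mult[of a "int k" i] power_int_mult[of a i "int k"]
    by (simp_all add: mult.commute)
  have "t ^ m = x powi (- u * int m) * (w ^ m) powi (- v)"
    unfolding t_def power_mult_distrib pow ..
  also have "(w ^ m) powi (- v) = (x ^ ?r * (E f / x ^ ?r)) powi (- v)"
    unfolding w_pow using \<open>x \<noteq> 0\<close> by simp
  also have "\<dots> = x powi (- v * int ?r) * \<epsilon>"
    unfolding \<epsilon>_def power_int_mult_distrib pow ..
  finally have "t ^ m = x powi (- u * int m) * x powi (- v * int ?r) * \<epsilon>"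
    by (simp only: mult.assoc)
  also have "x powi (- u * int m) * x powi (- v * int ?r) = x powi (- (u * int m + v * int ?r))"
    using \<open>x \<noteq> 0\<close> by (simp add: power_int_add[symmetric])
  also have "\<dots> = inverse x" unfolding uv by simp
  finally have tm: "t ^ m = inverse x * \<epsilon>" .
  then have "t ^ m \<in> P" using P_mult[OF x'] \<epsilon> by simp
  moreover from this have "t \<in> R" using R_of_power[OF tF _ m_pos] P_subset_R by blast
  ultimately have tP: "t \<in> P" using P_power by blast
  interpret ff_place_elt "range \<iota>" "adjoin \<iota> {x, w}" P t
    using tP \<open>t \<noteq> 0\<close> by unfold_locales
  have "x / t powi (- int m) = \<epsilon>"
    using tm \<open>x \<noteq> 0\<close> \<open>t \<noteq> 0\<close> by (simp add: power_int_minus field_simps)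
  then have hx: "has_val t x (- int m)" unfolding has_val_def using \<epsilon> by simp
  have hE: "has_val t (E p) (int m * - int (Polynomial.degree p))" if "p \<noteq> 0" for p
    using hv_mult[OF hv_unit[OF hv_E_infinity[OF x that]] hv_power[OF hx, of "Polynomial.degree p"]]
      \<open>x \<noteq> 0\<close> by (simp add: mult.commute)
  have "w * t ^ ?r \<in> U"
  proof (rule U_of_power[OF _ _ m_pos])
    show "w * t ^ ?r \<in> F"
      using F_subring w_in_F tF by (intro is_subring_mult is_subring_power)
    have "has_val t ((w * t ^ ?r) ^ m) (int m * - int ?r + int m * (int ?r * 1))"
      unfolding power_mult_distrib w_pow by (intro hv_mult hE f_nz hv_power hv_self)
    then show "(w * t ^ ?r) ^ m \<in> U" by (simp add: hv_0_iff)
  qed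
  then have "has_val t w (- int ?r)" unfolding has_val_def by (simp add: power_int_minus field_simps)
  moreover have "coprime (- int ?r) (int m)" using coprime_m by (simp add: coprime_commute)
  ultimately have "totram t (- int ?r) (\<lambda>p. - int (Polynomial.degree p))"
    unfolding totram_def using hE tP \<open>t \<noteq> 0\<close> by blast
  then show ?thesis by (rule that)
qed

end

section \<open>Numbers of roots of separable polynomials\<close>

lemma order_linear: "Polynomial.order a [:- b, 1 :: 'a::field:] = (if a = b then 1 else 0)"
  using order_power_n_n[of a 1] by (auto intro: order_0I)

lemma rsquarefree_card_roots:
  fixes p :: "'a::alg_closed_field poly"
  assumes "rsquarefree p"
  shows "card {a. poly p a = 0} = Polynomial.degree p"
  using assms
proof (induction "Polynomial.degree p" arbitrary: p)
  case 0
  then obtain c where "p = [:c:]" "c \<noteq> 0"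
    unfolding rsquarefree_def by (metis degree_0_id degree_pCons_0 pCons_0_0)
  then show ?case by simp
next
  case (Suc n)
  then obtain a where a: "poly p a = 0" using alg_closed_imp_poly_has_root[of p] by auto
  then obtain q where q: "p = [:- a, 1:] * q" by (auto simp: poly_eq_0_iff_dvd)
  have "p \<noteq> 0" using Suc.prems unfolding rsquarefree_def by blast
  have "q \<noteq> 0" using q \<open>p \<noteq> 0\<close> by auto
  have ord: "Polynomial.order b p = (if b = a then 1 else 0) + Polynomial.order b q" for b
    using \<open>p \<noteq> 0\<close> unfolding q by (subst order_mult) (auto simp: order_linear)
  have *: "Polynomial.order b p = 0 \<or> Polynomial.order b p = 1" for b
    using Suc.prems unfolding rsquarefree_def by blast
  have "Polynomial.order b q = 0 \<or> Polynomial.order b q = 1" for b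
    using *[of b] ord[of b] by linarith
  then have "rsquarefree q" unfolding rsquarefree_def using \<open>q \<noteq> 0\<close> by blast
  moreover have deg: "Polynomial.degree p = Suc (Polynomial.degree q)"
    unfolding q using \<open>q \<noteq> 0\<close> by (subst degree_mult_eq) auto
  ultimately have "card {a. poly q a = 0} = Polynomial.degree q" using Suc by simp
  moreover have "poly q a \<noteq> 0"
    using *[of a] ord[of a] \<open>q \<noteq> 0\<close> by (simp add: order_root)
  moreover have "{b. poly p b = 0} = insert a {b. poly q b = 0}" unfolding q by auto
  ultimately show ?case using deg poly_roots_finite[OF \<open>q \<noteq> 0\<close>] by simp
qed

text \<open>A multiple root of X^m - c would be a root of m X^(m-1), hence 0, but 0 is not a
  root.\<close>

lemma card_nth_roots:
  fixes c :: "'a::alg_closed_field"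
  assumes m: "m > 0" "of_nat m \<noteq> (0 :: 'a)" and c: "c \<noteq> 0"
  shows "card {b. b ^ m = c} = m"
proof -
  define h where "h = Polynomial.monom 1 m - [:c:]"
  have coeff: "Polynomial.coeff h m = 1"
    unfolding h_def using m by (simp add: coeff_pCons split: nat.split)
  then have "h \<noteq> 0" by auto
  have "Polynomial.degree h \<le> m"
    unfolding h_def by (intro degree_diff_le) (auto simp: degree_monom_eq)
  moreover have "m \<le> Polynomial.degree h" using coeff by (intro le_degree) simp
  ultimately have deg: "Polynomial.degree h = m" by simp
  have h: "poly h a = a ^ m - c" for a unfolding h_def by (simp add: poly_monom)
  have "Polynomial.order a h < 2" for a
  proof (rule ccontr)
    assume "\<not> Polynomial.order a h < 2"
    then have "[:- a, 1:] ^ 2 dvd h" using order_divides[of a 2 h] by auto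
    then obtain g where g: "h = [:- a, 1:] ^ 2 * g" by blast
    then have "poly h a = 0" "poly (pderiv h) a = 0"
      unfolding g power2_eq_square pderiv_mult poly_add poly_mult by auto
    moreover have "pderiv h = Polynomial.monom (of_nat m) (m - 1)"
      unfolding h_def by (simp add: pderiv_diff pderiv_monom pderiv_pCons)
    ultimately show False using m c h[of a] by (auto simp: poly_monom)
  qed
  then have "rsquarefree h"
    unfolding rsquarefree_def using \<open>h \<noteq> 0\<close> by (metis less_2_cases One_nat_def)
  then have "card {a. poly h a = 0} = m" using rsquarefree_card_roots deg by blast
  then show ?thesis by (simp add: h)
qed

section \<open>Well-defined valuations, ramification, and uniqueness of the places\<close>

context ff_place_elt
begin

text \<open>In terms of membership in the ring, a lower bound on the order is visibly preserved by
  sums and scalar multiples.\<close>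

lemma val_ge_iff:
  assumes "discrete_at t" "z \<in> F"
  shows "(z = 0 \<or> val F P z \<ge> k) \<longleftrightarrow> z / t powi k \<in> R"
proof (cases "z = 0")
  case True
  then show ?thesis using R_subring is_subring_zero by simp
next
  case False
  have "has_val t (z / t powi k) (val F P z - k * 1)"
    by (intro hv_divide hv_powi hv_self hv_val assms False)
  then show ?thesis using hv_in_R_iff False by fastforce
qed

end

context kummer_place
begin

lemma all_places_discrete: "\<exists>t. discrete_at t"
proof (cases "x \<in> R")
  case True
  then obtain \<beta> b where P: "x - \<iota> \<beta> \<in> P" "w - \<iota> b \<in> P" "b ^ m = poly f \<beta>"
    by (rule finite_place)
  show ?thesis
  proof (cases "b = 0")
    case True
    then have "poly f \<beta> = 0" using P(3) m_pos by (simp add: zero_power)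
    then show ?thesis using totram_discrete[OF root_place_totram[OF P(1)]] by blast
  next
    case False
    then show ?thesis using unramified_discrete[OF P] by blast
  qed
next
  case False
  then show ?thesis by (rule infinite_place_totram) (blast dest: totram_discrete)
qed

lemma val_ge_closed:
  fixes k :: int
  defines "V \<equiv> {z \<in> F. z = 0 \<or> val F P z \<ge> k}"
  shows val_ge_add: "a \<in> V \<Longrightarrow> b \<in> V \<Longrightarrow> a + b \<in> V"
    and val_ge_scale: "a \<in> V \<Longrightarrow> \<iota> c * a \<in> V"
proof -
  obtain t where t: "discrete_at t" using all_places_discrete by blast
  interpret ff_place_elt "range \<iota>" "adjoin \<iota> {x, w}" P t
    using t unfolding discrete_at_def by unfold_locales auto
  have V: "z \<in> V \<longleftrightarrow> z \<in> F \<and> z / t powi k \<in> R" for z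
    unfolding V_def using val_ge_iff[OF t, of z k] by blast
  show "a + b \<in> V" if "a \<in> V" "b \<in> V"
    using that unfolding V add_divide_distrib
    by (intro conjI is_subring_add[OF F_subring] is_subring_add[OF R_subring]) auto
  show "\<iota> c * a \<in> V" if a: "a \<in> V"
  proof -
    have "\<iota> c * (a / t powi k) \<in> R" "\<iota> c * a \<in> F"
      using a emb_in_R[of c] R_subset_F unfolding V
      by (blast intro: is_subring_mult[OF F_subring] is_subring_mult[OF R_subring])+
    then show ?thesis unfolding V by simp
  qed
qed

lemma val_nonneg: "z \<in> F \<Longrightarrow> z \<noteq> 0 \<Longrightarrow> val F P z \<ge> 0 \<longleftrightarrow> z \<in> R"
proof -
  obtain t where t: "discrete_at t" using all_places_discrete by blast
  interpret ff_place_elt "range \<iota>" "adjoin \<iota> {x, w}" P t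
    using t unfolding discrete_at_def by unfold_locales auto
  show "z \<in> F \<Longrightarrow> z \<noteq> 0 \<Longrightarrow> val F P z \<ge> 0 \<longleftrightarrow> z \<in> R" using val_nonneg_iff[OF t] .
qed

lemma val_mult:
  assumes "a \<in> F" "b \<in> F" "a \<noteq> 0" "b \<noteq> 0"
  shows "val F P (a * b) = val F P a + val F P b"
proof -
  obtain t where t: "discrete_at t" using all_places_discrete by blast
  interpret ff_place_elt "range \<iota>" "adjoin \<iota> {x, w}" P t
    using t unfolding discrete_at_def by unfold_locales auto
  show ?thesis using val_eq[OF t hv_mult[OF hv_val[OF t] hv_val[OF t]]] assms by blast
qed

text \<open>The uniformizer x - \<beta> lies in K(x), so it is also a uniformizer of the place
  below, and the two valuations agree on K(x).\<close>

lemma unramified_index: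
  assumes x: "x - \<iota> \<beta> \<in> P" and w: "w - \<iota> b \<in> P" and b: "b ^ m = poly f \<beta>" "b \<noteq> 0"
  shows "ramification_index Kx F P = 1"
proof -
  let ?t = "x - \<iota> \<beta>" and ?P = "P \<inter> Kx"
  have t: "?t \<in> P" "?t \<noteq> 0" using x unfolding E_linear[symmetric] E_eq_0_iff by auto
  have disc: "discrete_at ?t" by (rule unramified_discrete[OF assms])
  interpret ff_place_elt "range \<iota>" "adjoin \<iota> {x, w}" P ?t
    using t by unfold_locales
  have Kx: "is_subfield Kx" unfolding Kx_def by (rule is_subfield_adjoin)
  have KxF: "Kx \<subseteq> F" unfolding Kx_def
    using emb_subset_F x_in_F by (intro adjoin_minimal F_subfield) auto
  have tKx: "?t \<in> Kx" and emb: "range \<iota> \<subseteq> Kx"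
    using is_subring_diff[OF is_subfield_is_subring[OF Kx], of x "\<iota> \<beta>"]
      adjoin_superset[of \<iota> "{x}"] unfolding Kx_def by auto
  have ring: "ring_at Kx ?P = R \<inter> Kx"
    unfolding ring_at_def using KxF is_subfield_inverse[OF Kx] by blast
  have "R \<inter> Kx \<in> valuation_rings (range \<iota>) Kx"
  proof -
    have "inverse ?t \<notin> R" using t mem_P_iff[of ?t] by blast
    then have "R \<inter> Kx \<noteq> Kx" using is_subfield_inverse[OF Kx tKx] by blast
    moreover have "?t \<notin> range \<iota>" using t emb_in_P_iff by auto
    then have "range \<iota> \<noteq> R \<inter> Kx" using t P_subset_R tKx by blast
    moreover have "is_subring (R \<inter> Kx)"
      using R_subring is_subfield_is_subring[OF Kx] unfolding is_subring_def by blast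
    ultimately show ?thesis
      unfolding valuation_rings_def
      using K_subset_R emb KxF R_dichotomy is_subfield_inverse[OF Kx] by blast
  qed
  moreover have "?P = {z \<in> R \<inter> Kx. z = 0 \<or> inverse z \<notin> R \<inter> Kx}"
  proof -
    have "z \<in> ?P \<longleftrightarrow> z \<in> R \<inter> Kx \<and> (z = 0 \<or> inverse z \<notin> R \<inter> Kx)" for z
      using mem_P_iff[of z] is_subfield_inverse[OF Kx, of z] by blast
    then show ?thesis by blast
  qed
  ultimately have "?P \<in> places (range \<iota>) Kx" unfolding places_def by blast
  then interpret Q: ff_place_elt "range \<iota>" Kx ?P ?t
    using Kx t tKx by unfold_locales auto
  have has_val: "Q.has_val ?t z n" if "z \<in> Kx" "has_val ?t z n" for z n
    using that is_subfield_divide[OF Kx] is_subfield_powi[OF Kx tKx]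
    unfolding has_val_def Q.has_val_def ring by blast
  then have "Q.discrete_at ?t"
    using disc KxF tKx unfolding discrete_at_def Q.discrete_at_def by blast
  then have val: "val Kx ?P z = val F P z" if "z \<in> Kx" "z \<noteq> 0" for z
    using Q.val_eq[OF _ has_val[OF _ hv_val[OF disc]], of z] that KxF by blast
  have "val F P ?t = 1" by (rule val_eq[OF disc hv_self])
  show ?thesis
    unfolding ramification_index_def
  proof (rule the_equality)
    show "\<forall>z\<in>Kx - {0}. val F P z = int 1 * val Kx ?P z" using val by simp
    fix e assume "\<forall>z\<in>Kx - {0}. val F P z = int e * val Kx ?P z"
    then have "val F P ?t = int e * val Kx ?P ?t" using t(2) tKx by blast
    then show "e = 1" using val[OF tKx t(2)] \<open>val F P ?t = 1\<close> by simp
  qed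
qed

lemma totally_ramified_finite:
  assumes "totally_ramified Kx F P" "x \<in> R"
  obtains \<gamma> where "x - \<iota> \<gamma> \<in> P" "poly f \<gamma> = 0"
proof -
  obtain \<beta> b where P: "x - \<iota> \<beta> \<in> P" "w - \<iota> b \<in> P" "b ^ m = poly f \<beta>"
    using assms(2) by (rule finite_place)
  have "b = 0"
    using unramified_index[OF P] assms(1) extension_degree_F m_ge_2
    unfolding totally_ramified_def by fastforce
  then have "poly f \<beta> = 0" using P(3) m_pos by (simp add: zero_power)
  then show ?thesis using that P(1) by blast
qed

lemma val_x_neg: "val F P x < 0 \<Longrightarrow> x \<notin> R"
  using val_nonneg[OF x_in_F] E_eq_0_iff[of "[:0, 1:]"] by (auto simp: E_pCons)

lemma root_place_unique:
  assumes "x - \<iota> \<gamma> \<in> P" "poly f \<gamma> = 0"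
    and P': "P' \<in> places (range \<iota>) F" "x - \<iota> \<gamma> \<in> P'"
  shows "P' = P"
proof -
  interpret P': kummer_place \<iota> x f m w P'
    using P' F_subfield by unfold_locales
  show ?thesis
    using totram_unique[OF root_place_totram[OF assms(1,2)] _ P'.root_place_totram[OF P'(2) assms(2)]]
      P'.kummer_place_axioms by blast
qed

lemma infinite_place_unique:
  assumes "x \<notin> R" and P': "P' \<in> places (range \<iota>) F" "x \<notin> ring_at F P'"
  shows "P' = P"
proof -
  interpret P': kummer_place \<iota> x f m w P'
    using P' F_subfield by unfold_locales
  obtain t t' where "totram t (- int (Polynomial.degree f)) (\<lambda>p. - int (Polynomial.degree p))"
    "P'.totram t' (- int (Polynomial.degree f)) (\<lambda>p. - int (Polynomial.degree p))"
    using infinite_place_totram[OF assms(1)] P'.infinite_place_totram[OF P'(2)] by metis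
  then show ?thesis using totram_unique P'.kummer_place_axioms by blast
qed

end

section \<open>Functions regular on the affine curve\<close>

context kummer
begin

lemma kummer_placeI: "P \<in> places (range \<iota>) F \<Longrightarrow> kummer_place \<iota> x f m w P"
  using F_subfield by unfold_locales

text \<open>
  The affine curve is smooth: the function is written as \<open>ev p / E q\<close> with \<open>q\<close> of minimal degree;
  at a root \<open>\<beta>\<close> of \<open>q\<close>, regularity at all places over \<open>\<beta>\<close> makes \<open>\<beta>\<close> a common root of the \<open>p i\<close>.
\<close>

lemma regular_imp_range_ev:
  assumes z: "z \<in> F"
    and reg: "\<And>P. P \<in> places (range \<iota>) F \<Longrightarrow> x \<in> ring_at F P \<Longrightarrow> z \<in> ring_at F P"
  shows "z \<in> range ev"
proof -
  define S where "S = {(p, q). q \<noteq> 0 \<and> z = ev p / E q}"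
  have "S \<noteq> {}" using z unfolding F_eq S_def by blast
  then obtain pq where pq: "pq \<in> S"
    "\<And>pq'. pq' \<in> S \<Longrightarrow> Polynomial.degree (snd pq) \<le> Polynomial.degree (snd pq')"
    using ex_has_least_nat[of "\<lambda>s. s \<in> S" _ "\<lambda>s. Polynomial.degree (snd s)"] by blast
  obtain p q where q: "q \<noteq> 0" "z = ev p / E q"
    and min: "\<And>p' q'. q' \<noteq> 0 \<Longrightarrow> z = ev p' / E q' \<Longrightarrow> Polynomial.degree q \<le> Polynomial.degree q'"
    using pq unfolding S_def by (cases pq) auto
  have "Polynomial.degree q = 0"
  proof (rule ccontr)
    assume "Polynomial.degree q \<noteq> 0"
    then obtain \<beta> where \<beta>: "poly q \<beta> = 0" using alg_closed_imp_poly_has_root[of q] by auto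
    have "poly (p i) \<beta> = 0" if i: "i < m" for i
    proof (cases "poly f \<beta> = 0")
      case True
      then obtain P where P: "P \<in> places (range \<iota>) F" "x - \<iota> \<beta> \<in> P"
        using place_over_exists[of 0 \<beta>] m_pos by (metis zero_power)
      interpret kummer_place \<iota> x f m w P using P(1) by (rule kummer_placeI)
      have "ev p / E q \<in> R" using reg[OF P(1) x_in_R[OF P(2)]] q(2) by simp
      then have *: "p i \<noteq> 0 \<longrightarrow>
        int m * (int (Polynomial.order \<beta> (p i)) - int (Polynomial.order \<beta> q)) + 1 * int i \<ge> 0"
        using totram_mem_R[OF root_place_totram[OF P(2) True] q(1)] i by blast
      show ?thesis
      proof (rule ccontr)
        \<comment> \<open>The i-th term would then have order i minus m times the multiplicity of
          \<beta> in q, which is negative because i < m.\<close>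
        assume nz: "poly (p i) \<beta> \<noteq> 0"
        then have "Polynomial.order \<beta> (p i) = 0" "p i \<noteq> 0" by (auto intro: order_0I)
        moreover have "int (Polynomial.order \<beta> q) \<ge> 1" using \<beta> q(1) order_root[of q \<beta>] by simp
        then have "int m * int (Polynomial.order \<beta> q) \<ge> int m * 1" by (intro mult_left_mono) auto
        moreover have "int m * int (Polynomial.order \<beta> q) \<le> int i" using * calculation by simp
        ultimately show False using i by linarith
      qed
    next
      case False
      \<comment> \<open>The values of all coordinates at \<beta>, as one polynomial of degree less
        than m. Regularity at the places over (\<beta>, b) makes it vanish at each of the m distinct
        roots b of X^m - f(\<beta>), so it is 0.\<close>
      define g where "g = (\<Sum>i<m. Polynomial.monom (poly (p i) \<beta>) i)"
      have coeff: "Polynomial.coeff g j = (if j < m then poly (p j) \<beta> else 0)" for j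
        unfolding g_def by (simp add: coeff_sum)
      have "poly g b = 0" if b: "b ^ m = poly f \<beta>" for b
      proof -
        obtain P where P: "P \<in> places (range \<iota>) F" "x - \<iota> \<beta> \<in> P" "w - \<iota> b \<in> P"
          using place_over_exists[OF b] .
        interpret kummer_place \<iota> x f m w P using P(1) by (rule kummer_placeI)
        have "z \<in> R" using reg[OF P(1) x_in_R[OF P(2)]] .
        moreover have "E q \<in> P" using E_in_P_iff[OF P(2)] \<beta> by simp
        ultimately have "z * E q \<in> P" by (rule P_mult')
        then have "ev p \<in> P" using q by simp
        then have "res \<beta> b p = 0" using ev_in_P_iff[OF P(2,3)] by simp
        then show ?thesis unfolding res_def g_def by (simp add: poly_sum poly_monom)
      qed
      then have sub: "{b. b ^ m = poly f \<beta>} \<subseteq> {b. poly g b = 0}" by blast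
      have "g = 0"
      proof (rule ccontr)
        assume "g \<noteq> 0"
        then have "m \<le> card {b. poly g b = 0}"
          using card_mono[OF poly_roots_finite sub] card_nth_roots[OF m_pos char_m False] by simp
        also have "\<dots> \<le> Polynomial.degree g" using card_poly_roots_bound \<open>g \<noteq> 0\<close> .
        finally have "Polynomial.coeff g (Polynomial.degree g) = 0" unfolding coeff by simp
        then show False using \<open>g \<noteq> 0\<close> by simp
      qed
      then show ?thesis using coeff[of i] i by simp
    qed
    then have "\<forall>i. \<exists>g. i < m \<longrightarrow> p i = [:- \<beta>, 1:] * g"
      by (metis dvd_def poly_eq_0_iff_dvd)
    then obtain p' where p': "\<And>i. i < m \<Longrightarrow> p i = [:- \<beta>, 1:] * p' i" by metis
    obtain q' where q': "q = [:- \<beta>, 1:] * q'" using \<beta> by (auto simp: poly_eq_0_iff_dvd)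
    have "q' \<noteq> 0" using q(1) q' by auto
    have "E [:- \<beta>, 1:] \<noteq> 0" by (subst E_eq_0_iff) simp
    moreover have "ev p = E [:- \<beta>, 1:] * ev p'"
      unfolding ev_smult[symmetric] using p' by (rule ev_cong)
    moreover have "E q = E [:- \<beta>, 1:] * E q'" unfolding q' by (rule E_mult)
    ultimately have "z = ev p' / E q'" unfolding q(2) by simp
    then have "Polynomial.degree q \<le> Polynomial.degree q'" by (rule min[OF \<open>q' \<noteq> 0\<close>])
    moreover have "Polynomial.degree q = Suc (Polynomial.degree q')"
      unfolding q' using \<open>q' \<noteq> 0\<close> by (subst degree_mult_eq) auto
    ultimately show False by simp
  qed
  then obtain c where c: "q = [:c:]" using degree_0_id by metis
  then have "z = ev p * \<iota> (inverse c)" using q by (simp add: emb_inverse divide_inverse)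
  then show ?thesis
    using is_subring_mult[OF is_subring_range_ev] emb_in_range_ev by blast
qed

end

section \<open>Riemann-Roch spaces and gaps\<close>

lemma le_div_iff:
  fixes a b d :: int
  assumes "d > 0"
  shows "a \<le> b div d \<longleftrightarrow> d * a \<le> b"
proof
  assume "d * a \<le> b"
  then have "(d * a) div d \<le> b div d" using assms by (intro zdiv_mono1)
  then show "a \<le> b div d" using assms by simp
next
  assume "a \<le> b div d"
  then have "d * a \<le> d * (b div d)" using assms by (intro mult_left_mono) auto
  also have "\<dots> = b - b mod d" by (simp add: minus_mod_eq_mult_div)
  also have "\<dots> \<le> b" using assms by simp
  finally show "d * a \<le> b" .
qed

lemma div_less_iff:
  fixes a b d :: int
  shows "d > 0 \<Longrightarrow> b div d < a \<longleftrightarrow> b < a * d"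
  using le_div_iff[of d a b] by (simp add: linorder_not_le[symmetric] mult.commute)

text \<open>
  The condition that no function in \<open>L(s P + s' P')\<close> has a pole of order exactly \<open>s\<close> at \<open>P\<close>. Here
  \<open>i\<close> is the exponent of the only power of \<open>w\<close> whose multiples by rational functions of \<open>x\<close> can
  have order \<open>- s\<close> at \<open>P\<close>.
\<close>

definition gap_cond :: "nat \<Rightarrow> nat \<Rightarrow> int \<Rightarrow> int \<Rightarrow> bool" where
  "gap_cond m r s s' \<longleftrightarrow>
     (let i = (- s) mod int m in s + i + int m * ((s' + i) div int m) < i * int r)"

context kummer
begin

lemma subspace_riemann_roch: "vs.subspace (riemann_roch_space \<iota> F D)"
proof -
  have eq: "riemann_roch_space \<iota> F D =
    {z \<in> F. \<forall>P\<in>places (range \<iota>) F. z \<in> {z \<in> F. z = 0 \<or> val F P z \<ge> - Poly_Mapping.lookup D P}}"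
    unfolding riemann_roch_space_def by auto
  show ?thesis
  proof (rule vs.subspaceI)
    show "0 \<in> riemann_roch_space \<iota> F D"
      unfolding eq using is_subring_zero[OF F_subring] by auto
    show "a + b \<in> riemann_roch_space \<iota> F D"
      if "a \<in> riemann_roch_space \<iota> F D" "b \<in> riemann_roch_space \<iota> F D" for a b
      using that is_subring_add[OF F_subring]
        kummer_place.val_ge_add[OF kummer_placeI, of _ a _ b]
      unfolding eq by blast
    show "\<iota> c * a \<in> riemann_roch_space \<iota> F D" if a: "a \<in> riemann_roch_space \<iota> F D" for c a
    proof -
      have "\<iota> c * a \<in> F"
        using a is_subring_mult[OF F_subring] emb_subset_F unfolding eq by blast
      then show ?thesis
        using a kummer_place.val_ge_scale[OF kummer_placeI, of _ a]
        unfolding eq by blast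
    qed
  qed
qed

end

locale kummer_gaps = kummer \<iota> x f m w
  for \<iota> :: "'k::alg_closed_field \<Rightarrow> 'a::field" and x f m w +
  fixes \<gamma>1 \<gamma>2 :: 'k and P1 P2 Pinf :: "'a set"
  assumes P1: "P1 \<in> places (range \<iota>) F" "x - \<iota> \<gamma>1 \<in> P1" and root1: "poly f \<gamma>1 = 0"
    and P2: "P2 \<in> places (range \<iota>) F" "x - \<iota> \<gamma>2 \<in> P2" and root2: "poly f \<gamma>2 = 0"
    and roots_distinct: "\<gamma>1 \<noteq> \<gamma>2"
    and Pinf: "Pinf \<in> places (range \<iota>) F" "x \<notin> ring_at F Pinf"
begin

sublocale Q1: kummer_place \<iota> x f m w P1 using P1(1) by (rule kummer_placeI)
sublocale Q2: kummer_place \<iota> x f m w P2 using P2(1) by (rule kummer_placeI)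
sublocale Qinf: kummer_place \<iota> x f m w Pinf using Pinf(1) by (rule kummer_placeI)

lemma places_distinct: "P1 \<noteq> P2" "Pinf \<noteq> P1" "Pinf \<noteq> P2"
proof
  assume "P1 = P2"
  then have "E [:- \<gamma>2, 1:] \<in> P1" using P2 by (simp only: E_linear)
  then have "\<gamma>1 = \<gamma>2" using Q1.E_in_P_iff[OF P1(2), of "[:- \<gamma>2, 1:]"] by simp
  then show False using roots_distinct by simp
qed (use Q1.x_in_R[OF P1(2)] Q2.x_in_R[OF P2(2)] Pinf in auto)

lemmas tr1 = Q1.root_place_totram[OF P1(2) root1]
lemmas tr2 = Q2.root_place_totram[OF P2(2) root2]

definition L :: "int \<Rightarrow> int \<Rightarrow> 'a set" where
  "L s1 s2 = riemann_roch_space \<iota> F (Poly_Mapping.single P1 s1 + Poly_Mapping.single P2 s2)"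

lemma mem_L_iff:
  assumes "z \<in> F" "z \<noteq> 0"
  shows "z \<in> L s1 s2 \<longleftrightarrow> val F P1 z \<ge> - s1 \<and> val F P2 z \<ge> - s2 \<and>
    (\<forall>P\<in>places (range \<iota>) F - {P1, P2}. z \<in> ring_at F P)"
proof -
  have "z \<in> L s1 s2 \<longleftrightarrow> (\<forall>P\<in>places (range \<iota>) F.
    val F P z \<ge> - ((if P1 = P then s1 else 0) + (if P2 = P then s2 else 0)))"
    unfolding L_def riemann_roch_space_def using assms
    by (simp add: lookup_add lookup_single when_def)
  also have "\<dots> \<longleftrightarrow> val F P1 z \<ge> - s1 \<and> val F P2 z \<ge> - s2 \<and>
    (\<forall>P\<in>places (range \<iota>) F - {P1, P2}. val F P z \<ge> 0)"
    (is "?lhs \<longleftrightarrow> ?rhs")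
  proof
    assume l: ?lhs
    show ?rhs
    proof (intro conjI ballI)
      show "val F P1 z \<ge> - s1" using bspec[OF l P1(1)] places_distinct(1) by simp
      show "val F P2 z \<ge> - s2" using bspec[OF l P2(1)] places_distinct(1) by simp
      show "val F P z \<ge> 0" if "P \<in> places (range \<iota>) F - {P1, P2}" for P
        using bspec[OF l, of P] that by (auto split: if_splits)
    qed
  next
    assume ?rhs
    then show ?lhs using places_distinct(1) by auto
  qed
  also have "(\<forall>P\<in>places (range \<iota>) F - {P1, P2}. val F P z \<ge> 0) \<longleftrightarrow>
    (\<forall>P\<in>places (range \<iota>) F - {P1, P2}. z \<in> ring_at F P)"
    using kummer_place.val_nonneg[OF kummer_placeI assms] by simp
  finally show ?thesis .
qed

text \<open>A common denominator for \<open>L s1 s2\<close> once N bounds s1 and s2: its order at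
  each of the two places is m N. Its degree 2 N gives the bound that regularity at infinity puts on
  the numerators.\<close>

definition denom :: "nat \<Rightarrow> 'k poly" where
  "denom N = [:- \<gamma>1, 1:] ^ N * [:- \<gamma>2, 1:] ^ N"

lemma order_prod:
  "Polynomial.order \<gamma>1 ([:- \<gamma>1, 1:] ^ k * [:- \<gamma>2, 1:] ^ l) = k"
  "Polynomial.order \<gamma>2 ([:- \<gamma>1, 1:] ^ k * [:- \<gamma>2, 1:] ^ l) = l"
  "Polynomial.degree ([:- \<gamma>1, 1:] ^ k * [:- \<gamma>2, 1:] ^ l) = k + l"
proof -
  have nz: "[:- \<gamma>1, 1:] ^ k \<noteq> 0" "[:- \<gamma>2, 1:] ^ l \<noteq> 0" by (auto simp: power_eq_0_iff)
  have 0: "Polynomial.order \<gamma>1 ([:- \<gamma>2, 1:] ^ l) = 0" "Polynomial.order \<gamma>2 ([:- \<gamma>1, 1:] ^ k) = 0"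
    using roots_distinct by (auto intro!: order_0I simp: poly_power)
  have nz': "[:- \<gamma>1, 1:] ^ k * [:- \<gamma>2, 1:] ^ l \<noteq> 0" using nz by simp
  show "Polynomial.order \<gamma>1 ([:- \<gamma>1, 1:] ^ k * [:- \<gamma>2, 1:] ^ l) = k"
    "Polynomial.order \<gamma>2 ([:- \<gamma>1, 1:] ^ k * [:- \<gamma>2, 1:] ^ l) = l"
    unfolding order_mult[OF nz'] 0 order_power_n_n by simp_all
  show "Polynomial.degree ([:- \<gamma>1, 1:] ^ k * [:- \<gamma>2, 1:] ^ l) = k + l"
    using nz by (simp add: degree_mult_eq degree_linear_power)
qed

lemma order_add_le_degree:
  assumes "p \<noteq> 0"
  shows "Polynomial.order \<gamma>1 p + Polynomial.order \<gamma>2 p \<le> Polynomial.degree p"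
proof -
  obtain q where q: "p = [:- \<gamma>1, 1:] ^ Polynomial.order \<gamma>1 p * q" "\<not> [:- \<gamma>1, 1:] dvd q"
    using order_decomp[OF assms] by blast
  have "q \<noteq> 0" using q(2) by auto
  have "[:- \<gamma>1, 1:] ^ Polynomial.order \<gamma>1 p \<noteq> 0" by (auto simp: power_eq_0_iff)
  then have "Polynomial.degree p = Polynomial.order \<gamma>1 p + Polynomial.degree q"
    using \<open>q \<noteq> 0\<close> by (subst q(1)) (simp add: degree_mult_eq degree_linear_power)
  moreover have "Polynomial.order \<gamma>2 ([:- \<gamma>1, 1:] ^ Polynomial.order \<gamma>1 p) = 0"
    using roots_distinct by (intro order_0I) (simp add: poly_power)
  then have "Polynomial.order \<gamma>2 p = Polynomial.order \<gamma>2 q"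
    using order_mult[of "[:- \<gamma>1, 1:] ^ Polynomial.order \<gamma>1 p" q \<gamma>2] assms q(1) by simp
  ultimately show ?thesis using order_degree[OF \<open>q \<noteq> 0\<close>, of \<gamma>2] by simp
qed

lemma denom_nz: "denom N \<noteq> 0"
  unfolding denom_def by (auto simp: power_eq_0_iff)

text \<open>
  The term \<open>E p * w ^ i / E (denom N)\<close> has poles of order at most \<open>s1\<close> and \<open>s2\<close> at the two places
  and is regular at infinity.
\<close>

definition admissible :: "nat \<Rightarrow> int \<Rightarrow> int \<Rightarrow> nat \<Rightarrow> 'k poly \<Rightarrow> bool" where
  "admissible N s1 s2 i p \<longleftrightarrow>
     int m * (int (Polynomial.order \<gamma>1 p) - int N) + int i \<ge> - s1 \<and>
     int m * (int (Polynomial.order \<gamma>2 p) - int N) + int i \<ge> - s2 \<and>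
     m * Polynomial.degree p + Polynomial.degree f * i \<le> m * (2 * N)"

text \<open>Multiplication by \<open>E (denom N)\<close> removes the poles at the two places because
  m N \<ge> N, so that the product is regular on the affine curve and has polynomial coordinates.
  The conditions at the two places and at infinity can then be tested on single terms.\<close>

lemma mem_L_iff_admissible:
  assumes N: "s1 \<le> int N" "s2 \<le> int N" and z: "z \<noteq> 0"
  shows "z \<in> L s1 s2 \<longleftrightarrow>
    (\<exists>p. z = ev p / E (denom N) \<and> (\<forall>i<m. p i \<noteq> 0 \<longrightarrow> admissible N s1 s2 i (p i)))"
proof
  obtain t where t: "Qinf.totram t (- int (Polynomial.degree f)) (\<lambda>p. - int (Polynomial.degree p))"
    by (rule Qinf.infinite_place_totram[OF Pinf(2)])
  have inf: "ev p / E (denom N) \<in> Qinf.R \<longleftrightarrow>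
    (\<forall>i<m. p i \<noteq> 0 \<longrightarrow> m * Polynomial.degree (p i) + Polynomial.degree f * i \<le> m * (2 * N))" for p
  proof -
    have "int m * (- int k - - int (N + N)) + - int (Polynomial.degree f) * int i \<ge> 0 \<longleftrightarrow>
      m * k + Polynomial.degree f * i \<le> m * (2 * N)" for k i
    proof -
      have "int m * (- int k - - int (N + N)) + - int (Polynomial.degree f) * int i =
        int (m * (2 * N)) - int (m * k + Polynomial.degree f * i)" by (simp add: algebra_simps)
      then show ?thesis by linarith
    qed
    then show ?thesis
      unfolding Qinf.totram_mem_R[OF t denom_nz] by (simp add: denom_def order_prod(3))
  qed
  note o1 = order_prod(1)[of N N, folded denom_def] and o2 = order_prod(2)[of N N, folded denom_def]
  {
    assume zL: "z \<in> L s1 s2"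
    then have zF: "z \<in> F" unfolding L_def riemann_roch_space_def by blast
    note L = zL[unfolded mem_L_iff[OF zF z]]
    have Ed: "E (denom N) \<in> F" "E (denom N) \<noteq> 0" using E_in_F denom_nz by auto
    have zd: "z * E (denom N) \<in> F" "z * E (denom N) \<noteq> 0"
      using is_subring_mult[OF F_subring zF E_in_F] z denom_nz by auto
    have mN: "int m * int N \<ge> int N" using m_pos by (simp add: mult_le_cancel_right1)
    have "z * E (denom N) \<in> range ev"
    proof (rule regular_imp_range_ev[OF zd(1)])
      fix P assume P: "P \<in> places (range \<iota>) F" "x \<in> ring_at F P"
      then interpret kummer_place \<iota> x f m w P by (intro kummer_placeI)
      consider "P = P1" | "P = P2" | "P \<in> places (range \<iota>) F - {P1, P2}" using P(1) by blast
      then show "z * E (denom N) \<in> R"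
      proof cases
        case 1
        interpret T: ff_place_elt "range \<iota>" "adjoin \<iota> {x, w}" P1 w
          using tr1 unfolding Q1.totram_def by unfold_locales auto
        have "Q1.has_val w (E (denom N)) (int m * int (Polynomial.order \<gamma>1 (denom N)))"
          using tr1 denom_nz unfolding Q1.totram_def by blast
        then have "val F P1 (E (denom N)) = int m * int N"
          unfolding o1 by (rule T.val_eq[OF Q1.totram_discrete[OF tr1]])
        then have "val F P1 (z * E (denom N)) \<ge> 0"
          using Q1.val_mult[OF zF Ed(1) z Ed(2)] L N mN by linarith
        then show ?thesis using Q1.val_nonneg[OF zd] 1 by simp
      next
        case 2
        interpret T: ff_place_elt "range \<iota>" "adjoin \<iota> {x, w}" P2 w
          using tr2 unfolding Q2.totram_def by unfold_locales auto
        have "Q2.has_val w (E (denom N)) (int m * int (Polynomial.order \<gamma>2 (denom N)))"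
          using tr2 denom_nz unfolding Q2.totram_def by blast
        then have "val F P2 (E (denom N)) = int m * int N"
          unfolding o2 by (rule T.val_eq[OF Q2.totram_discrete[OF tr2]])
        then have "val F P2 (z * E (denom N)) \<ge> 0"
          using Q2.val_mult[OF zF Ed(1) z Ed(2)] L N mN by linarith
        then show ?thesis using Q2.val_nonneg[OF zd] 2 by simp
      next
        case 3
        then have "z \<in> R" using L by blast
        then show ?thesis using is_subring_mult[OF R_subring] E_in_R[OF P(2)] by blast
      qed
    qed
    then obtain p where "z * E (denom N) = ev p" by blast
    then have p: "z = ev p / E (denom N)" using Ed(2) by (simp add: field_simps)
    have "z \<in> Qinf.R" using L Pinf(1) places_distinct by blast
    then have deg: "\<forall>i<m. p i \<noteq> 0 \<longrightarrow> m * Polynomial.degree (p i) + Polynomial.degree f * i \<le> m * (2 * N)"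
      using inf p by simp
    have "admissible N s1 s2 i (p i)" if i: "i < m" "p i \<noteq> 0" for i
      unfolding admissible_def
      using Q1.totram_val_le[OF tr1 z[unfolded p] i] Q2.totram_val_le[OF tr2 z[unfolded p] i]
        L deg i unfolding o1 o2 p[symmetric] by auto
    then show "\<exists>p. z = ev p / E (denom N) \<and> (\<forall>i<m. p i \<noteq> 0 \<longrightarrow> admissible N s1 s2 i (p i))"
      using p by blast
  }
  assume "\<exists>p. z = ev p / E (denom N) \<and> (\<forall>i<m. p i \<noteq> 0 \<longrightarrow> admissible N s1 s2 i (p i))"
  then obtain p where p: "z = ev p / E (denom N)"
    and adm: "\<And>i. i < m \<Longrightarrow> p i \<noteq> 0 \<Longrightarrow> admissible N s1 s2 i (p i)" by blast
  have zF: "z \<in> F" unfolding p F_eq using denom_nz by blast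
  have "z \<in> ring_at F P" if P: "P \<in> places (range \<iota>) F" "P \<noteq> P1" "P \<noteq> P2" for P
  proof -
    interpret kummer_place \<iota> x f m w P using P(1) by (rule kummer_placeI)
    show ?thesis
    proof (cases "x \<in> R")
      case True
      then obtain \<beta> where \<beta>: "x - \<iota> \<beta> \<in> P" using finite_place by metis
      \<comment> \<open>Only one place lies over each of \<gamma>1 and \<gamma>2, so the denominator
        is a unit at P.\<close>
      have "\<beta> \<noteq> \<gamma>1" "\<beta> \<noteq> \<gamma>2"
        using root_place_unique[OF _ root1 P1] root_place_unique[OF _ root2 P2] \<beta> P by auto
      then have "poly (denom N) \<beta> \<noteq> 0" unfolding denom_def by (simp add: poly_power)
      then have "E (denom N) \<in> U" by (rule E_in_U[OF \<beta>])
      then have "inverse (E (denom N)) \<in> R" using mem_U_iff by blast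
      then show ?thesis
        unfolding p divide_inverse using is_subring_mult[OF R_subring] ev_in_R[OF True] by blast
    next
      case False
      then have "Pinf = P" using infinite_place_unique Pinf by blast
      moreover have "z \<in> Qinf.R" unfolding p inf using adm unfolding admissible_def by blast
      ultimately show ?thesis by simp
    qed
  qed
  moreover have "val F P1 z \<ge> - s1"
  proof -
    obtain i where "i < m" "p i \<noteq> 0"
      "val F P1 z = int m * (int (Polynomial.order \<gamma>1 (p i)) - int N) + 1 * int i"
      using Q1.totram_val_attained[OF tr1 z[unfolded p]] unfolding o1 p[symmetric] by blast
    then show ?thesis using adm[of i] unfolding admissible_def by linarith
  qed
  moreover have "val F P2 z \<ge> - s2"
  proof -
    obtain i where "i < m" "p i \<noteq> 0"
      "val F P2 z = int m * (int (Polynomial.order \<gamma>2 (p i)) - int N) + 1 * int i"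
      using Q2.totram_val_attained[OF tr2 z[unfolded p]] unfolding o2 p[symmetric] by blast
    then show ?thesis using adm[of i] unfolding admissible_def by linarith
  qed
  ultimately show "z \<in> L s1 s2" unfolding mem_L_iff[OF zF z] by blast
qed

text \<open>Regularity at infinity bounds the degrees of the coordinates, which leaves finitely many
  monomials in x and w over a common denominator.\<close>

lemma L_finite_dimensional:
  obtains T where "finite T" "L s1 s2 \<subseteq> vs.span T"
proof -
  define N where "N = nat (max s1 s2)"
  have N: "s1 \<le> int N" "s2 \<le> int N" unfolding N_def by auto
  define T where "T = (\<lambda>(i, j). x ^ j * w ^ i / E (denom N)) ` ({..<m} \<times> {..2 * N})"
  have "z \<in> vs.span T" if zL: "z \<in> L s1 s2" for z
  proof (cases "z = 0")
    case False
    then obtain p where p: "z = ev p / E (denom N)"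
      "\<And>i. i < m \<Longrightarrow> p i \<noteq> 0 \<Longrightarrow> admissible N s1 s2 i (p i)"
      using zL mem_L_iff_admissible[OF N] by blast
    have "E (p i) * w ^ i / E (denom N) \<in> vs.span T" if i: "i < m" for i
    proof (cases "p i = 0")
      case False
      then have "m * Polynomial.degree (p i) \<le> m * (2 * N)"
        using p(2)[OF i] unfolding admissible_def by linarith
      then have deg: "Polynomial.degree (p i) \<le> 2 * N" using m_pos by simp
      have "E (p i) = (\<Sum>j\<le>Polynomial.degree (p i). \<iota> (Polynomial.coeff (p i) j) * x ^ j)"
        unfolding E_def poly_altdef by (simp add: coeff_map_poly degree_map_poly)
      then have "E (p i) * w ^ i / E (denom N) =
        (\<Sum>j\<le>Polynomial.degree (p i). \<iota> (Polynomial.coeff (p i) j) * (x ^ j * w ^ i / E (denom N)))"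
        by (simp add: sum_distrib_right sum_divide_distrib mult.assoc)
      also have "\<dots> \<in> vs.span T"
        using i deg by (intro vs.span_sum vs.span_scale vs.span_base) (auto simp: T_def)
      finally show ?thesis .
    qed (simp add: vs.span_zero)
    then show ?thesis
      unfolding p(1) ev_def sum_divide_distrib by (intro vs.span_sum) auto
  qed (simp add: vs.span_zero)
  moreover have "finite T" unfolding T_def by auto
  ultimately show ?thesis using that by blast
qed

text \<open>The exact order - s1 at P1 determines the exponent i of w and the pole order a in x -
  \<gamma>1, while at \<gamma>2 the pole order is at most c = (s2 + i) div m. The bound at infinity
  is easiest to satisfy when these poles are as large as possible and the numerator has no further
  zeros, and then it reads i r \<le> m (a + c).\<close>

lemma exists_value_iff:
  assumes s: "s1 \<ge> 0" "s2 \<ge> 0"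
  shows "(\<exists>z\<in>L s1 s2. z \<noteq> 0 \<and> val F P1 z = - s1) \<longleftrightarrow> \<not> gap_cond m (Polynomial.degree f) s1 s2"
proof -
  let ?r = "Polynomial.degree f" and ?i = "(- s1) mod int m"
  \<comment> \<open>Large enough that the subtractions in \<open>N - nat a\<close> and
    \<open>N - nat c\<close> below are not truncated: both pole orders are at most s1 + s2 +
    1.\<close>
  define N where "N = nat (s1 + s2 + 1)"
  have N: "s1 \<le> int N" "s2 \<le> int N" and intN: "int N = s1 + s2 + 1" unfolding N_def using s by auto
  note o1 = order_prod(1)[of N N, folded denom_def] and o2 = order_prod(2)[of N N, folded denom_def]
  have mult_iff: "int m * a \<le> b \<longleftrightarrow> a \<le> b div int m" for a b :: int
    using le_div_iff[of "int m" a b] m_pos by simp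
  have dvd: "int m * ((s1 + ?i) div int m) = s1 + ?i"
  proof -
    have "(s1 + ?i) mod int m = 0" by (simp add: mod_add_right_eq)
    then show ?thesis by (simp add: mod_eq_0_iff_dvd)
  qed
  have i: "0 \<le> ?i" "?i < int m" using m_pos by auto
  show ?thesis
  proof
    assume "\<exists>z\<in>L s1 s2. z \<noteq> 0 \<and> val F P1 z = - s1"
    then obtain z where z: "z \<in> L s1 s2" "z \<noteq> 0" "val F P1 z = - s1" by blast
    obtain p where p: "z = ev p / E (denom N)"
      and adm: "\<And>i. i < m \<Longrightarrow> p i \<noteq> 0 \<Longrightarrow> admissible N s1 s2 i (p i)"
      using z mem_L_iff_admissible[OF N] by blast
    obtain j where j: "j < m" "p j \<noteq> 0"
      "- s1 = int m * (int (Polynomial.order \<gamma>1 (p j)) - int N) + 1 * int j"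
      using Q1.totram_val_attained[OF tr1 z(2)[unfolded p]] z(3) unfolding o1 p[symmetric] by auto
    have ij: "?i = int j" unfolding j(3) using j(1) by simp
    define a where "a = int N - int (Polynomial.order \<gamma>1 (p j))"
    define c where "c = int N - int (Polynomial.order \<gamma>2 (p j))"
    have a: "s1 + ?i = int m * a" unfolding ij a_def using j(3) by (simp add: algebra_simps)
    have "int m * c \<le> s2 + ?i"
      using adm[OF j(1,2)] unfolding admissible_def ij c_def by (simp add: algebra_simps)
    then have "c \<le> (s2 + ?i) div int m" by (simp only: mult_iff)
    then have c: "int m * c \<le> int m * ((s2 + ?i) div int m)" by (intro mult_left_mono) auto
    have "m * Polynomial.degree (p j) + ?r * j \<le> m * (2 * N)"
      using adm[OF j(1,2)] unfolding admissible_def by blast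
    moreover have "m * (Polynomial.order \<gamma>1 (p j) + Polynomial.order \<gamma>2 (p j)) \<le> m * Polynomial.degree (p j)"
      using order_add_le_degree[OF j(2)] by simp
    ultimately have "m * (Polynomial.order \<gamma>1 (p j) + Polynomial.order \<gamma>2 (p j)) + ?r * j \<le> m * (2 * N)"
      by linarith
    then have "int (m * (Polynomial.order \<gamma>1 (p j) + Polynomial.order \<gamma>2 (p j)) + ?r * j) \<le> int (m * (2 * N))"
      by (simp only: of_nat_le_iff)
    then have "?i * int ?r \<le> int m * a + int m * c"
      unfolding ij a_def c_def by (simp add: algebra_simps)
    then show "\<not> gap_cond m ?r s1 s2" unfolding gap_cond_def Let_def using a c by linarith
  next
    assume "\<not> gap_cond m ?r s1 s2"
    then have le: "?i * int ?r \<le> s1 + ?i + int m * ((s2 + ?i) div int m)"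
      unfolding gap_cond_def Let_def by simp
    define a where "a = (s1 + ?i) div int m"
    define c where "c = (s2 + ?i) div int m"
    have bound: "0 \<le> (s + ?i) div int m \<and> (s + ?i) div int m \<le> s + 1" if "s \<ge> 0" for s
    proof -
      have "s \<le> s * int m" using that m_pos by (simp add: mult_le_cancel_left1)
      then have "s + ?i \<le> (s + 1) * int m" using i(2) by (simp add: distrib_right)
      then have "(s + ?i) div int m \<le> ((s + 1) * int m) div int m"
        using m_pos by (intro zdiv_mono1) auto
      then show ?thesis using that i m_pos by (simp add: pos_imp_zdiv_nonneg_iff)
    qed
    have ac: "0 \<le> a" "a \<le> int N" "0 \<le> c" "c \<le> int N"
      unfolding a_def c_def intN using bound[OF s(1)] bound[OF s(2)] s by auto
    define k where "k = N - nat a"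
    define l where "l = N - nat c"
    have kl: "int k = int N - a" "int l = int N - c" unfolding k_def l_def using ac by auto
    \<comment> \<open>The numerator of least degree: over the denominator it leaves (x -
      \<gamma>1)^(-a) (x - \<gamma>2)^(-c).\<close>
    define q where "q = [:- \<gamma>1, 1:] ^ k * [:- \<gamma>2, 1:] ^ l"
    have oq: "Polynomial.order \<gamma>1 q = k" "Polynomial.order \<gamma>2 q = l" "Polynomial.degree q = k + l"
      unfolding q_def by (rule order_prod)+
    have "q \<noteq> 0" unfolding q_def by (auto simp: power_eq_0_iff)
    define j where "j = nat ?i"
    have j: "j < m" "int j = ?i" unfolding j_def using i by auto
    define p where "p i = (if i = j then q else 0)" for i
    have pj: "p j = q" and pi: "\<And>i. p i \<noteq> 0 \<Longrightarrow> i = j" unfolding p_def by (auto split: if_splits)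
    have "ev p \<noteq> 0" using ev_eq_0[OF _ j(1)] pj \<open>q \<noteq> 0\<close> by blast
    then have z: "ev p / E (denom N) \<noteq> 0" using denom_nz by simp
    have a: "int m * a = s1 + ?i" unfolding a_def by (rule dvd)
    have c: "int m * c \<le> s2 + ?i" unfolding mult_iff c_def ..
    have "int (m * (k + l) + ?r * j) \<le> int (m * (2 * N))"
      using le a unfolding c_def[symmetric] by (simp add: kl j(2) algebra_simps)
    then have "m * (k + l) + ?r * j \<le> m * (2 * N)" by (simp only: of_nat_le_iff)
    moreover have "int m * (int k - int N) + ?i = - s1" "int m * (int l - int N) + ?i \<ge> - s2"
      using a c unfolding kl by (simp_all add: algebra_simps)
    ultimately have "admissible N s1 s2 j q" unfolding admissible_def oq j(2) by simp
    then have "ev p / E (denom N) \<in> L s1 s2"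
      using mem_L_iff_admissible[OF N z] pi pj by blast
    moreover have "val F P1 (ev p / E (denom N)) = - s1"
    proof -
      obtain i' where "i' < m" "p i' \<noteq> 0" "val F P1 (ev p / E (denom N)) =
        int m * (int (Polynomial.order \<gamma>1 (p i')) - int N) + 1 * int i'"
        using Q1.totram_val_attained[OF tr1 z] unfolding o1 by blast
      then show ?thesis
        using pi[of i'] pj oq \<open>int m * (int k - int N) + ?i = - s1\<close> j(2) by simp
    qed
    ultimately show "\<exists>z\<in>L s1 s2. z \<noteq> 0 \<and> val F P1 z = - s1" using z by blast
  qed
qed

lemma ell_eq_iff:
  assumes s: "s1 \<ge> 0" "s2 \<ge> 0"
  defines "D \<equiv> Poly_Mapping.single P1 s1 + Poly_Mapping.single P2 s2"
  shows "ell \<iota> F D = ell \<iota> F (D - Poly_Mapping.single P1 1) \<longleftrightarrow> gap_cond m (Polynomial.degree f) s1 s2"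
proof -
  have D': "D - Poly_Mapping.single P1 1 = Poly_Mapping.single P1 (s1 - 1) + Poly_Mapping.single P2 s2"
    unfolding D_def by (simp add: single_diff algebra_simps)
  have ell: "ell \<iota> F D = vs.dim (L s1 s2)"
    unfolding ell_def L_def D_def ..
  have ell': "ell \<iota> F (D - Poly_Mapping.single P1 1) = vs.dim (L (s1 - 1) s2)"
    unfolding ell_def L_def D' ..
  have FL: "L a b \<subseteq> F" for a b unfolding L_def riemann_roch_space_def by auto
  have mem: "z \<in> L (s1 - 1) s2 \<longleftrightarrow> z \<in> L s1 s2 \<and> \<not> (z \<noteq> 0 \<and> val F P1 z = - s1)" for z
  proof (cases "z \<in> F \<and> z \<noteq> 0")
    case True
    then show ?thesis by (auto simp: mem_L_iff)
  next
    case False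
    then show ?thesis using FL is_subring_zero[OF F_subring]
      unfolding L_def riemann_roch_space_def by auto
  qed
  have sub: "L (s1 - 1) s2 \<subseteq> L s1 s2" using mem by blast
  obtain T where T: "finite T" "L s1 s2 \<subseteq> vs.span T" by (rule L_finite_dimensional)
  have "vs.dim (L s1 s2) = vs.dim (L (s1 - 1) s2) \<longleftrightarrow> L (s1 - 1) s2 = L s1 s2"
    using subspace_eqI[OF _ _ sub T(2,1)] subspace_riemann_roch unfolding L_def by metis
  also have "\<dots> \<longleftrightarrow> \<not> (\<exists>z\<in>L s1 s2. z \<noteq> 0 \<and> val F P1 z = - s1)"
    using mem by blast
  also have "\<dots> \<longleftrightarrow> gap_cond m (Polynomial.degree f) s1 s2" using exists_value_iff[OF s] by simp
  finally show ?thesis unfolding ell ell' .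
qed

end

lemma (in kummer_gaps) pure_gaps_eq:
  "pure_gaps \<iota> F P1 P2 = {(s1, s2). s1 \<ge> 0 \<and> s2 \<ge> 0 \<and>
     gap_cond m (Polynomial.degree f) s1 s2 \<and> gap_cond m (Polynomial.degree f) s2 s1}"
proof -
  \<comment> \<open>The condition at P2 is the one at P1 with the two places exchanged.\<close>
  interpret swap: kummer_gaps \<iota> x f m w \<gamma>2 \<gamma>1 P2 P1 Pinf
    using P1 P2 Pinf root1 root2 roots_distinct by unfold_locales auto
  show ?thesis
    unfolding pure_gaps_def Let_def
    using ell_eq_iff swap.ell_eq_iff by (auto simp: add.commute)
qed

section \<open>Counting\<close>

context
  fixes m r :: nat
  assumes m2: "m \<ge> 2" and r2: "r \<ge> 2"
begin

text \<open>
  A coordinate of a pure gap is written as \<open>m * q + j\<close> with \<open>1 \<le> j \<le> m\<close>; then \<open>k\<close> is the sum of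
  the two quotients, and the residues \<open>j\<close> range over \<open>block k\<close>.
\<close>

definition small :: "int \<Rightarrow> int" where "small k = int m - 1 - (int m * (k + 2)) div int r"
definition large :: "int \<Rightarrow> int" where "large k = int m - 1 - (int m * (k + 1)) div int r"

definition block :: "int \<Rightarrow> (int \<times> int) set" where
  "block k = {(a, b). 1 \<le> a \<and> a \<le> large k \<and> 1 \<le> b \<and> b \<le> large k \<and> (a \<le> small k \<or> b \<le> small k)}"

definition shifted :: "int \<Rightarrow> int \<Rightarrow> (int \<times> int) set" where
  "shifted k j = (\<lambda>(a, b). (int m * (k - j) + a, int m * j + b)) ` block k"

lemma small_le_large: "small k \<le> large k"
  unfolding small_def large_def using r2 by (auto intro!: zdiv_mono1 mult_left_mono)

lemma large_less: "k \<ge> 0 \<Longrightarrow> large k < int m"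
proof -
  assume "k \<ge> 0"
  then have "(int m * (k + 1)) div int r \<ge> 0" using r2 by (simp add: pos_imp_zdiv_nonneg_iff)
  then show ?thesis unfolding large_def by linarith
qed

text \<open>The exponent is i = m - a, so s + i = m (q + 1), and (s' + i) div m is q' or q' + 1
  according to whether b < a or not. The left side of the inequality is therefore m times q + q' + 1
  or q + q' + 2, which gives the bounds \<open>large\<close> and \<open>small\<close>.\<close>

lemma gap_cond_iff:
  assumes j: "1 \<le> a" "a \<le> int m" "1 \<le> b" "b \<le> int m"
  shows "gap_cond m r (int m * q + a) (int m * q' + b) \<longleftrightarrow>
    a \<le> (if b < a then large (q + q') else small (q + q'))"
proof -
  have i: "(- (int m * q + a)) mod int m = int m - a"
  proof -
    have eq: "- (int m * q + a) = (int m - a) + int m * (- q - 1)" by (simp add: algebra_simps)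
    show ?thesis unfolding eq mod_mult_self2 using j by (intro mod_pos_pos_trivial) auto
  qed
  have d: "(int m * q' + b + (int m - a)) div int m = q' + (if b < a then 0 else 1)"
  proof (rule int_div_pos_eq)
    show "int m * q' + b + (int m - a) =
      int m * (q' + (if b < a then 0 else 1)) + (if b < a then int m + b - a else b - a)"
      by (simp add: algebra_simps)
  qed (use j in auto)
  have less: "u < (int m - a) * int r \<longleftrightarrow> a \<le> int m - 1 - u div int r" for u
  proof -
    have "u < (int m - a) * int r \<longleftrightarrow> u div int r < int m - a"
      using r2 by (simp add: div_less_iff)
    then show ?thesis by linarith
  qed
  have "gap_cond m r (int m * q + a) (int m * q' + b) \<longleftrightarrow>
    int m * (q + q' + (if b < a then 1 else 2)) < (int m - a) * int r"
    unfolding gap_cond_def Let_def i d by (simp add: algebra_simps)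
  then show ?thesis unfolding less small_def large_def by simp
qed

text \<open>A pair in \<open>block k\<close> has a coordinate between 1 and \<open>small k\<close>;
  so the range of k in the theorem is exactly where blocks are nonempty.\<close>

lemma small_pos_iff: "small k \<ge> 1 \<longleftrightarrow> k \<le> int r - 3 - int (r div m)"
proof -
  have "small k \<ge> 1 \<longleftrightarrow> (int m * (k + 2)) div int r < int m - 1" unfolding small_def by linarith
  also have "\<dots> \<longleftrightarrow> int m * (k + 2) < (int m - 1) * int r"
    using r2 by (simp add: div_less_iff)
  also have "\<dots> \<longleftrightarrow> int r < (int r - k - 2) * int m" by (simp add: algebra_simps)
  also have "\<dots> \<longleftrightarrow> int r div int m < int r - k - 2"
    using m2 by (simp add: div_less_iff)
  also have "\<dots> \<longleftrightarrow> k \<le> int r - 3 - int (r div m)" by (simp add: zdiv_int) linarith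
  finally show ?thesis .
qed

text \<open>Of the two residues the greater one is bounded by \<open>large\<close> and the smaller
  one by \<open>small\<close>, equal ones both by \<open>small\<close>; by
  \<open>small_le_large\<close> these are the conditions of \<open>block\<close>.\<close>

lemma gap_set_eq:
  "{(s1, s2). s1 \<ge> 0 \<and> s2 \<ge> 0 \<and> gap_cond m r s1 s2 \<and> gap_cond m r s2 s1} =
   (\<Union>k\<in>{0..int r - 3 - int (r div m)}. \<Union>j\<in>{0..k}. shifted k j)" (is "?G = ?U")
proof (intro equalityI subsetI)
  fix s assume "s \<in> ?G"
  then obtain s1 s2 where s: "s = (s1, s2)" "s1 \<ge> 0" "s2 \<ge> 0" "gap_cond m r s1 s2" "gap_cond m r s2 s1"
    by blast
  \<comment> \<open>For s = 0 the exponent i is 0; in function field terms, the constants already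
    have order 0 at the place.\<close>
  have "\<not> gap_cond m r 0 u" if "u \<ge> 0" for u
    using that m2 by (simp add: gap_cond_def pos_imp_zdiv_nonneg_iff not_less)
  then have pos: "s1 \<ge> 1" "s2 \<ge> 1" using s by (cases "s1 = 0"; cases "s2 = 0"; force)+
  \<comment> \<open>The shift by 1 puts the residues into 1..m instead of 0..m - 1, as
    \<open>gap_cond_iff\<close> requires.\<close>
  define q1 q2 where "q1 = (s1 - 1) div int m" and "q2 = (s2 - 1) div int m"
  define a b where "a = (s1 - 1) mod int m + 1" and "b = (s2 - 1) mod int m + 1"
  have ab: "1 \<le> a" "a \<le> int m" "1 \<le> b" "b \<le> int m"
    unfolding a_def b_def using m2 by (auto simp: add1_zle_eq)
  have q: "0 \<le> q1" "0 \<le> q2" unfolding q1_def q2_def using pos m2 by (auto simp: pos_imp_zdiv_nonneg_iff)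
  have s12: "s1 = int m * q1 + a" "s2 = int m * q2 + b"
    unfolding q1_def q2_def a_def b_def by simp_all
  have "a \<le> (if b < a then large (q1 + q2) else small (q1 + q2))"
    "b \<le> (if a < b then large (q1 + q2) else small (q1 + q2))"
    using s(4,5) gap_cond_iff[OF ab, of q1 q2] gap_cond_iff[OF ab(3,4,1,2), of q2 q1]
    unfolding s12 add.commute[of q2 q1] by simp_all
  then have blk: "(a, b) \<in> block (q1 + q2)" and "small (q1 + q2) \<ge> 1"
    unfolding block_def using ab small_le_large[of "q1 + q2"] by (auto split: if_splits)
  then have "q1 + q2 \<le> int r - 3 - int (r div m)" using small_pos_iff by blast
  moreover have "s \<in> shifted (q1 + q2) q2"
    unfolding shifted_def s(1) s12 using blk by force
  ultimately show "s \<in> ?U" using q by force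
next
  fix s assume "s \<in> ?U"
  then obtain k j a b where k: "0 \<le> j" "j \<le> k" and ab: "(a, b) \<in> block k"
    and s: "s = (int m * (k - j) + a, int m * j + b)"
    unfolding shifted_def by auto
  have ab': "1 \<le> a" "a \<le> int m" "1 \<le> b" "b \<le> int m"
    using ab large_less[of k] k unfolding block_def by auto
  have "gap_cond m r (int m * (k - j) + a) (int m * j + b)"
    "gap_cond m r (int m * j + b) (int m * (k - j) + a)"
    using ab small_le_large[of k] unfolding gap_cond_iff[OF ab'] gap_cond_iff[OF ab'(3,4,1,2)] block_def
    by auto
  moreover have "int m * (k - j) \<ge> 0" "int m * j \<ge> 0" using k by auto
  ultimately show "s \<in> ?G" unfolding s using ab' by auto
qed

text \<open>The summand c is a real of its own so that the rule matches the numerals 1 and 2 in the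
  definitions of \<open>G1\<close> and \<open>G3\<close>.\<close>

lemma floor_eq: "\<lfloor>real m * (real_of_int k + c) / real r\<rfloor> = (int m * (k + l)) div int r"
  if "c = real_of_int l" for k l :: int
proof -
  have "real m * (real_of_int k + c) / real r = real_of_int (int m * (k + l)) / real_of_int (int r)"
    using that by simp
  then show ?thesis by (simp only: floor_divide_of_int_eq)
qed

text \<open>In \<open>G1\<close> both residues are at most \<open>small k\<close>, in
  \<open>G3\<close> only the first exceeds it, and in \<open>G4\<close> only the second. The
  reflection in \<open>G4\<close> puts the multiple m k into the second coordinate, and subtracting
  \<open>wvec m k\<close> brings it back to the first.\<close>

lemma union_G_eq:
  assumes k: "0 \<le> k"
  shows "(\<lambda>s. s + wvec m j) ` (G1 m r k \<union> G3 m r k \<union> G4 m r k) = shifted k j"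
proof -
  have A: "int m - 1 - \<lfloor>real m * (real_of_int k + 2) / real r\<rfloor> = small k"
    "int m - \<lfloor>real m * (real_of_int k + 2) / real r\<rfloor> = small k + 1"
    "int m - 1 - \<lfloor>real m * (real_of_int k + 1) / real r\<rfloor> = large k"
    unfolding small_def large_def using floor_eq[of 2 2 k] floor_eq[of 1 1 k] by simp_all
  have "(u, v) \<in> G1 m r k \<union> G3 m r k \<union> G4 m r k \<longleftrightarrow> (u - int m * k, v) \<in> block k" for u v
  proof -
    have 1: "(u, v) \<in> G1 m r k \<longleftrightarrow>
      1 \<le> u - int m * k \<and> u - int m * k \<le> small k \<and> 1 \<le> v \<and> v \<le> small k"
      unfolding G1_def using A by (auto intro!: exI[of _ "u - int m * k"])
    have 3: "(u, v) \<in> G3 m r k \<longleftrightarrow>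
      small k + 1 \<le> u - int m * k \<and> u - int m * k \<le> large k \<and> 1 \<le> v \<and> v \<le> small k" for u v
      unfolding G3_def using A by (auto intro!: exI[of _ "u - int m * k"])
    have "(u, v) \<in> G4 m r k \<longleftrightarrow> 1 \<le> u - int m * k \<and> 1 \<le> v + int m * k \<and>
      (v + int m * k, u - int m * k) \<in> G3 m r k"
    proof
      assume "(u, v) \<in> G4 m r k"
      then obtain a b where "1 \<le> b" "1 \<le> a" "(a, b) \<in> G3 m r k" "(u, v) = (b, a) - wvec m k"
        unfolding G4_def by blast
      then show "1 \<le> u - int m * k \<and> 1 \<le> v + int m * k \<and> (v + int m * k, u - int m * k) \<in> G3 m r k"
        by (simp add: wvec_def algebra_simps)
    next
      assume "1 \<le> u - int m * k \<and> 1 \<le> v + int m * k \<and> (v + int m * k, u - int m * k) \<in> G3 m r k"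
      moreover have "(u, v) = (u - int m * k, v + int m * k) - wvec m k" by (simp add: wvec_def algebra_simps)
      ultimately show "(u, v) \<in> G4 m r k" unfolding G4_def by blast
    qed
    moreover have "int m * k \<ge> 0" using k by simp
    ultimately show ?thesis
      unfolding Un_iff 1 3 block_def using small_le_large[of k] by auto
  qed
  then have "G1 m r k \<union> G3 m r k \<union> G4 m r k = (\<lambda>(a, b). (int m * k + a, b)) ` block k"
    by (force simp: image_iff)
  then show ?thesis
    unfolding shifted_def image_image by (simp add: image_image wvec_def case_prod_unfold algebra_simps)
qed

lemma card_block:
  assumes "small k \<ge> 0"
  shows "finite (block k)" "int (card (block k)) = (large k)\<^sup>2 - (large k - small k)\<^sup>2"
proof -
  let ?S = "{1..large k} \<times> {1..large k}" and ?T = "{small k + 1..large k} \<times> {small k + 1..large k}"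
  have eq: "block k = ?S - ?T" unfolding block_def by auto
  then show "finite (block k)" by simp
  have "?T \<subseteq> ?S" using assms by auto
  then have "card (block k) = card ?S - card ?T" "card ?T \<le> card ?S"
    unfolding eq using card_Diff_subset[of ?T ?S] card_mono[of ?S ?T] by blast+
  then have "int (card (block k)) = int (card ?S) - int (card ?T)" by simp
  also have "\<dots> = (large k)\<^sup>2 - (large k - small k)\<^sup>2"
    using assms small_le_large[of k] by (simp add: card_cartesian_product power2_eq_square)
  finally show "int (card (block k)) = (large k)\<^sup>2 - (large k - small k)\<^sup>2" .
qed

text \<open>Residues lie strictly between 0 and m, so division by m recovers both quotients from a
  pair. The translates are therefore disjoint, and each block is counted once for each of the k + 1
  values of j.\<close>

lemma card_union:
  assumes "\<kappa> \<le> int r - 3 - int (r div m)"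
  shows "int (card (\<Union>k\<in>{0..\<kappa>}. \<Union>j\<in>{0..k}. shifted k j)) =
    (\<Sum>k=0..\<kappa>. (k + 1) * ((large k)\<^sup>2 - (large k - small k)\<^sup>2))"
proof -
  define I where "I = (SIGMA k:{0..\<kappa>}. {0..k} \<times> block k)"
  define g where "g = (\<lambda>(k, j, a, b). (int m * (k - j) + a, int m * j + b))"
  have pos: "small k \<ge> 0" if "k \<in> {0..\<kappa>}" for k
    using small_pos_iff[of k] that assms by auto
  have dec: "q = q' \<and> a = a'"
    if "int m * q + a = int m * q' + a'" "1 \<le> a" "a < int m" "1 \<le> a'" "a' < int m" for q q' a a'
  proof -
    have "(int m * q + a) div int m = q" "(int m * q' + a') div int m = q'"
      by (rule int_div_pos_eq[OF refl]; use that in simp)+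
    then show ?thesis using that(1) by simp
  qed
  have inj: "inj_on g I"
  proof (rule inj_onI)
    fix s s' assume s: "s \<in> I" "s' \<in> I" "g s = g s'"
    obtain k j a b where s1: "s = (k, j, a, b)" by (cases s) auto
    obtain k' j' a' b' where s2: "s' = (k', j', a', b')" by (cases s') auto
    have "1 \<le> a" "a < int m" "1 \<le> b" "b < int m" "1 \<le> a'" "a' < int m" "1 \<le> b'" "b' < int m"
      using s(1,2) large_less[of k] large_less[of k'] unfolding I_def s1 s2 block_def by auto
    then show "s = s'"
      using s(3) dec[of "k - j" a "k' - j'" a'] dec[of j b j' b'] unfolding s1 s2 g_def by auto
  qed
  have "(\<Union>k\<in>{0..\<kappa>}. \<Union>j\<in>{0..k}. shifted k j) = g ` I"
    unfolding I_def g_def shifted_def by force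
  then have "card (\<Union>k\<in>{0..\<kappa>}. \<Union>j\<in>{0..k}. shifted k j) = card I"
    using card_image[OF inj] by simp
  also have "\<dots> = (\<Sum>k=0..\<kappa>. card ({0..k} \<times> block k))"
    unfolding I_def using pos card_block(1) by (intro card_SigmaI) auto
  finally have "int (card (\<Union>k\<in>{0..\<kappa>}. \<Union>j\<in>{0..k}. shifted k j)) =
    (\<Sum>k=0..\<kappa>. int (card ({0..k} \<times> block k)))" by simp
  also have "\<dots> = (\<Sum>k=0..\<kappa>. (k + 1) * ((large k)\<^sup>2 - (large k - small k)\<^sup>2))"
    using pos card_block(2) by (intro sum.cong) (auto simp: card_cartesian_product)
  finally show ?thesis .
qed

text \<open>By coprimality r does not divide m k for 0 < k < r, so the quotient is not an integer
  and its ceiling exceeds its floor by 1. This turns the floors in the sets into the ceilings of the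
  cardinality formula.\<close>

lemma ceiling_eq:
  assumes "coprime m r" "0 < k" "k < int r"
  shows "\<lceil>real m * real_of_int k / real r\<rceil> = (int m * k) div int r + 1"
proof -
  have "\<not> int r dvd int m * k"
    using assms zdvd_imp_le[of "int r" k] by (auto simp: coprime_dvd_mult_right_iff coprime_commute)
  then have nz: "(int m * k) mod int r \<noteq> 0" by (simp add: dvd_eq_mod_eq_0)
  have "\<lceil>real m * real_of_int k / real r\<rceil> = \<lceil>real_of_int (int m * k) / real_of_int (int r)\<rceil>" by simp
  also have "\<dots> = - ((- (int m * k)) div int r)" by (rule ceiling_divide_eq_div)
  also have "\<dots> = (int m * k) div int r + 1" using nz r2 by (simp add: zdiv_zminus1_eq_if)
  finally show ?thesis .
qed

lemma gap_count:
  assumes "coprime m r"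
  shows "(\<Sum>k=0..int r - 3 - int (r div m). (k + 1) * ((large k)\<^sup>2 - (large k - small k)\<^sup>2)) =
    (\<Sum>k=1..int r - 2 - int (r div m). k * ((int m - \<lceil>real m * real_of_int k / real r\<rceil>)\<^sup>2 -
      (\<lceil>real m * (real_of_int k + 1) / real r\<rceil> - \<lceil>real m * real_of_int k / real r\<rceil>)\<^sup>2))"
proof (rule sum.reindex_bij_witness[of _ "\<lambda>k. k - 1" "\<lambda>k. k + 1"])
  fix k assume "k \<in> {0..int r - 3 - int (r div m)}"
  \<comment> \<open>The bound on k keeps both k + 1 and k + 2 below r, as \<open>ceiling_eq\<close>
    requires.\<close>
  then have k: "0 \<le> k" "k + 3 \<le> int r" by auto
  have c1: "\<lceil>real m * real_of_int (k + 1) / real r\<rceil> = int m - large k"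
    unfolding large_def using ceiling_eq[OF assms, of "k + 1"] k by simp
  have c2: "\<lceil>real m * (real_of_int (k + 1) + 1) / real r\<rceil> = int m - small k"
    unfolding small_def using ceiling_eq[OF assms, of "k + 2"] k by (simp add: add.commute)
  show "(k + 1) * ((int m - \<lceil>real m * real_of_int (k + 1) / real r\<rceil>)\<^sup>2 -
      (\<lceil>real m * (real_of_int (k + 1) + 1) / real r\<rceil> - \<lceil>real m * real_of_int (k + 1) / real r\<rceil>)\<^sup>2) =
    (k + 1) * ((large k)\<^sup>2 - (large k - small k)\<^sup>2)"
    unfolding c1 c2 by simp
qed auto

end


section \<open>Reduction to exponent one\<close>

text \<open>Algebraic closedness of the constants enters as the hypothesis \<open>split\<close>,
  since the locale has an arbitrary field of constants.\<close>

lemma (in field_emb) poly_root_in_range: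
  fixes p :: "'k poly"
  assumes split: "\<And>p :: 'k poly. Polynomial.degree p > 0 \<Longrightarrow> \<exists>b. poly p b = 0"
    and "p \<noteq> 0" "poly (map_poly \<iota> p) z = 0"
  shows "z \<in> range \<iota>"
  using assms(2,3)
proof (induction "Polynomial.degree p" arbitrary: p)
  case 0
  then obtain c where "p = [:c:]" "c \<noteq> 0" by (metis degree_0_id degree_pCons_0 pCons_0_0)
  then show ?case using 0 by (simp add: map_poly_pCons)
next
  case (Suc n)
  then obtain b where "poly p b = 0" using split[of p] by auto
  then obtain q where q: "p = [:- b, 1:] * q" by (auto simp: poly_eq_0_iff_dvd)
  have "q \<noteq> 0" using q Suc.prems by auto
  then have deg: "n = Polynomial.degree q"
    using Suc.hyps(2) unfolding q by (subst (asm) degree_mult_eq) auto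
  have "poly (map_poly \<iota> p) z = (z - \<iota> b) * poly (map_poly \<iota> q) z"
    unfolding q map_poly_emb_mult by (simp add: map_poly_pCons emb_uminus algebra_simps)
  then consider "z = \<iota> b" | "poly (map_poly \<iota> q) z = 0" using Suc.prems by auto
  then show ?case using Suc.hyps(1)[OF deg \<open>q \<noteq> 0\<close>] by cases auto
qed

text \<open>
  With \<open>u * lam + v * m = 1\<close> the element \<open>y\<^sup>u f\<^sup>v\<close> is an \<open>m\<close>-th root of \<open>f\<close>, and \<open>y\<close> is its \<open>lam\<close>-th
  power up to a root of unity, which is a constant.
\<close>

lemma (in ratfun) kummer_generator:
  fixes f :: "'k poly"
  assumes split: "\<And>p :: 'k poly. Polynomial.degree p > 0 \<Longrightarrow> \<exists>b. poly p b = 0"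
    and m: "m > 0" and cop: "coprime m lam" and f: "f \<noteq> 0" and y: "y ^ m = E f ^ lam"
  obtains w where "w ^ m = E f" "adjoin \<iota> {x, y} = adjoin \<iota> {x, w}"
proof -
  obtain u v where uv: "u * int lam + v * int m = 1"
    using bezout_int[of "int lam" "int m"] cop by (auto simp: coprime_iff_gcd_eq_1 gcd.commute)
  have Ef: "E f \<noteq> 0" using f by simp
  have y0: "y \<noteq> 0" using y Ef m by (metis power_not_zero zero_power)
  have pow: "(a ^ k) powi i = a powi (i * int k)" "(a powi i) ^ k = a powi (i * int k)" for a :: 'a and i k
    using power_int_mult[of a "int k" i] power_int_mult[of a i "int k"]
    by (simp_all add: mult.commute)
  define w where "w = y powi u * E f powi v"
  have "w ^ m = (y ^ m) powi u * E f powi (v * int m)"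
    unfolding w_def power_mult_distrib pow ..
  also have "\<dots> = E f powi (u * int lam) * E f powi (v * int m)" unfolding y pow ..
  also have "\<dots> = E f powi 1" unfolding uv[symmetric] using Ef by (simp add: power_int_add)
  finally have w: "w ^ m = E f" by simp
  have w0: "w \<noteq> 0" using w Ef m by (metis zero_power)
  have E_in: "E p \<in> adjoin \<iota> {x, a}" for p a
    using adjoin_superset[of \<iota> "{x, a}"] is_subfield_adjoin
    by (intro E_in_subring is_subfield_is_subring) auto
  have in_adjoin: "a \<in> adjoin \<iota> {x, a}" for a using adjoin_superset[of \<iota> "{x, a}"] by auto
  have "w \<in> adjoin \<iota> {x, y}"
    unfolding w_def using is_subfield_adjoin
    by (intro is_subring_mult is_subfield_is_subring is_subfield_powi E_in in_adjoin)
  then have 1: "adjoin \<iota> {x, w} \<subseteq> adjoin \<iota> {x, y}"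
    using adjoin_superset[of \<iota> "{x, y}"] by (intro adjoin_minimal is_subfield_adjoin) auto
  define \<zeta> where "\<zeta> = y / w ^ lam"
  have "\<zeta> ^ m = y ^ m / (w ^ m) ^ lam"
    unfolding \<zeta>_def power_divide by (simp add: power_mult[symmetric] mult.commute)
  then have "\<zeta> ^ m = 1" unfolding y w using Ef by simp
  then have "poly (map_poly \<iota> (Polynomial.monom 1 m - [:1:])) \<zeta> = 0"
    unfolding map_poly_emb_diff by (simp add: map_poly_monom poly_monom map_poly_pCons)
  moreover have "Polynomial.coeff (Polynomial.monom 1 m - [:1 :: 'k:]) m = 1"
    using m by (simp add: coeff_pCons split: nat.split)
  then have "Polynomial.monom 1 m - [:1 :: 'k:] \<noteq> 0" by (metis coeff_0 zero_neq_one)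
  ultimately have "\<zeta> \<in> range \<iota>" using poly_root_in_range[OF split] by blast
  then have "\<zeta> * w ^ lam \<in> adjoin \<iota> {x, w}"
    using adjoin_superset[of \<iota> "{x, w}"] is_subfield_is_subring[OF is_subfield_adjoin]
    by (intro is_subring_mult is_subring_power) auto
  then have "y \<in> adjoin \<iota> {x, w}" unfolding \<zeta>_def using w0 by simp
  then have "adjoin \<iota> {x, y} \<subseteq> adjoin \<iota> {x, w}"
    using adjoin_superset[of \<iota> "{x, w}"] by (intro adjoin_minimal is_subfield_adjoin) auto
  then show ?thesis using that[OF w] 1 by blast
qed

theorem theorem4p12:
  fixes \<iota> :: "'q::finite_field alg_closure \<Rightarrow> 'a::field"
    and f :: "'q alg_closure poly"
    and m lam r :: nat
    and x y :: 'a
    and P1 P2 Pinf :: "'a set"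
  defines "K \<equiv> range \<iota>"
    and "Kx \<equiv> adjoin \<iota> {x}"
    and "F \<equiv> adjoin \<iota> {x, y}"
  assumes "lam \<ge> 1" and "m \<ge> 2" and "\<not> CHAR('q alg_closure) dvd m"
    and "rsquarefree f" and "Polynomial.degree f = r" and "r \<ge> 2"
    and "gcd m (lam * r) = 1"
    and "field_embedding \<iota>"
    and "transcendental_over \<iota> x"
    and "y ^ m = poly (map_poly \<iota> f) x ^ lam"
    and "Pinf \<in> places K F" and "val F Pinf x < 0"
    and "P1 \<in> places K F" and "totally_ramified Kx F P1"
    and "P2 \<in> places K F" and "totally_ramified Kx F P2"
    and "P1 \<noteq> P2" and "P1 \<noteq> Pinf" and "P2 \<noteq> Pinf"
  shows "pure_gaps \<iota> F P1 P2 =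
           (\<Union>k \<in> {0 .. int r - 3 - \<lfloor>real r / real m\<rfloor>}. \<Union>j \<in> {0 .. k}.
              (\<lambda>s. s + wvec m j) ` (G1 m r k \<union> G3 m r k \<union> G4 m r k)) \<and>
         int (card (pure_gaps \<iota> F P1 P2)) =
           (\<Sum>k = 1 .. int r - 2 - \<lfloor>real r / real m\<rfloor>.
              k * ((int m - \<lceil>real m * k / real r\<rceil>)\<^sup>2
                   - (\<lceil>real m * (k + 1) / real r\<rceil> - \<lceil>real m * k / real r\<rceil>)\<^sup>2))"
proof -
  note m2 = \<open>m \<ge> 2\<close> and r2 = \<open>r \<ge> 2\<close>
  have cop: "coprime m lam" "coprime m r"
    using \<open>gcd m (lam * r) = 1\<close> unfolding coprime_iff_gcd_eq_1[symmetric] by simp_all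
  have f0: "f \<noteq> 0" using \<open>rsquarefree f\<close> unfolding rsquarefree_def by blast
  interpret rf: ratfun \<iota> x
    using \<open>field_embedding \<iota>\<close> \<open>transcendental_over \<iota> x\<close> by unfold_locales
  have root: "\<exists>b. poly p b = 0" if "Polynomial.degree p > 0" for p :: "'q alg_closure poly"
    using alg_closed_imp_poly_has_root[OF that] by blast
  obtain w where w: "w ^ m = rf.E f" "F = adjoin \<iota> {x, w}"
    using rf.kummer_generator[OF root _ cop(1) f0, of y] m2 assms(13)
    unfolding F_def rf.E_def by auto
  interpret kummer \<iota> x f m w
    using m2 r2 cop(2) w(1) \<open>rsquarefree f\<close> \<open>Polynomial.degree f = r\<close>
      \<open>\<not> CHAR('q alg_closure) dvd m\<close>
    by unfold_locales (auto simp: of_nat_eq_0_iff_char_dvd)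
  have KxE: "rf.Kx = Kx" unfolding rf.Kx_def Kx_def ..
  have Pinf: "Pinf \<in> places (range \<iota>) (adjoin \<iota> {x, w})" "x \<notin> ring_at (adjoin \<iota> {x, w}) Pinf"
  proof -
    show *: "Pinf \<in> places (range \<iota>) (adjoin \<iota> {x, w})"
      using \<open>Pinf \<in> places K F\<close> unfolding K_def w(2) .
    show "x \<notin> ring_at (adjoin \<iota> {x, w}) Pinf"
      using kummer_place.val_x_neg[OF kummer_placeI[OF *]] \<open>val F Pinf x < 0\<close> unfolding w(2) by blast
  qed
  \<comment> \<open>Since the place at infinity is unique, x is regular at every other place, and a
    totally ramified one among these lies over a root of f.\<close>
  have tr: "\<exists>\<gamma>. x - \<iota> \<gamma> \<in> P \<and> poly f \<gamma> = 0"
    if P: "P \<in> places (range \<iota>) (adjoin \<iota> {x, w})" "totally_ramified Kx F P" "P \<noteq> Pinf" for P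
  proof -
    interpret kummer_place \<iota> x f m w P using P(1) by (rule kummer_placeI)
    have "x \<in> R" using infinite_place_unique[OF _ Pinf] P(3) by blast
    then show ?thesis using totally_ramified_finite P(2) unfolding KxE w(2) by metis
  qed
  have P: "P1 \<in> places (range \<iota>) (adjoin \<iota> {x, w})" "P2 \<in> places (range \<iota>) (adjoin \<iota> {x, w})"
    using \<open>P1 \<in> places K F\<close> \<open>P2 \<in> places K F\<close> unfolding K_def w(2) by auto
  obtain \<gamma>1 where \<gamma>1: "x - \<iota> \<gamma>1 \<in> P1" "poly f \<gamma>1 = 0"
    using tr[OF P(1)] \<open>totally_ramified Kx F P1\<close> \<open>P1 \<noteq> Pinf\<close> by blast
  obtain \<gamma>2 where \<gamma>2: "x - \<iota> \<gamma>2 \<in> P2" "poly f \<gamma>2 = 0"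
    using tr[OF P(2)] \<open>totally_ramified Kx F P2\<close> \<open>P2 \<noteq> Pinf\<close> by blast
  have "\<gamma>1 \<noteq> \<gamma>2"
    using kummer_place.root_place_unique[OF kummer_placeI[OF P(1)] \<gamma>1 P(2)] \<gamma>2 \<open>P1 \<noteq> P2\<close> by blast
  interpret kummer_gaps \<iota> x f m w \<gamma>1 \<gamma>2 P1 P2 Pinf
    using P \<gamma>1 \<gamma>2 \<open>\<gamma>1 \<noteq> \<gamma>2\<close> Pinf by unfold_locales
  have fl: "\<lfloor>real r / real m\<rfloor> = int (r div m)" by (rule floor_divide_of_nat_eq)
  have gaps: "pure_gaps \<iota> F P1 P2 =
    (\<Union>k\<in>{0..int r - 3 - int (r div m)}. \<Union>j\<in>{0..k}. shifted m r k j)"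
    using pure_gaps_eq gap_set_eq[OF m2 r2] \<open>Polynomial.degree f = r\<close> unfolding w(2) by simp
  have "(\<Union>k\<in>{0..int r - 3 - int (r div m)}. \<Union>j\<in>{0..k}. shifted m r k j) =
    (\<Union>k\<in>{0..int r - 3 - int (r div m)}. \<Union>j\<in>{0..k}.
      (\<lambda>s. s + wvec m j) ` (G1 m r k \<union> G3 m r k \<union> G4 m r k))"
    by (intro SUP_cong refl) (simp add: union_G_eq[OF m2 r2])
  moreover have "int (card (pure_gaps \<iota> F P1 P2)) =
    (\<Sum>k=1..int r - 2 - int (r div m). k * ((int m - \<lceil>real m * real_of_int k / real r\<rceil>)\<^sup>2 -
      (\<lceil>real m * (real_of_int k + 1) / real r\<rceil> - \<lceil>real m * real_of_int k / real r\<rceil>)\<^sup>2))"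
    unfolding gaps card_union[OF m2 r2 order_refl] by (rule gap_count[OF m2 r2 cop(2)])
  ultimately show ?thesis unfolding gaps fl by simp
qed

end
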